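(* Let $\mathbb{M}$ be a monoid and $\mathcal{S},\mathcal{J}\subseteq 2^{\mathbb{M}}$ families of subsets of $\mathbb{M}$. For a category $\mathcal{C}$ and a constraint $\mathcal{F}$ on flows, let ${}_{\mathcal{F}}\mathcal{C}^{\mathbb{M}}$ be the category of $\mathbb{M}$-flows on objects of $\mathcal{C}$ satisfying $\mathcal{F}$. The functor ${}_{\mathcal{F}}\mathcal{C}^{\mathbb{M}}\to\mathcal{C}$ forgetting the action is monadic in all of the following cases. (a) $\mathbb{M}$ is a topological monoid, $\mathcal{C}$ is any of the categories $\mathrm{Top}_{\bullet}$ with $\bullet\in\{\text{blank},\,T_0,\,T_1,\,T_2,\,T_{2f},\,T_{3\frac12}\}$ or $\mathrm{Cpct}_{T_2}$, and the actions $\mathbb{M}\times X\to X$ are required to be separately continuous over $S\times X$ for all $S\in\mathcal{S}$ and jointly continuous over $J\times X$ for all $J\in\mathcal{J}$. (b) $\mathbb{M}$ is equipped with a uniformity, $\mathcal{C}=\mathrm{Unif}_{\bullet}$ with $\bullet\in\{\text{blank},\,T_2,\,(T_2,c)\}$, and the actions are required to be separately uniformly continuous over $S\times X$ for all $S\in\mathcal{S}$ and jointly uniformly continuous over $J\times X$ for all $J\in\mathcal{J}$. (c) $\mathbb{M}$ is an internal monoid in $\mathrm{Top}_{\kappa}$ (for the $\kappa$-product), $\mathcal{C}=\mathrm{Top}_{\kappa}$ or $\mathcal{C}=\mathrm{Top}_{T_2,\kappa}$, and the actions are required to be separately continuous over $\kappa(S)\times X$ for all $S\in\mathcal{S}$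 and jointly continuous over $\kappa(J)\times^{\kappa}X$ for all $J\in\mathcal{J}$. (d) $\mathbb{M}$ is a topological group, $\mathcal{C}=\mathrm{Unif}_{\bullet}$ with $\bullet\in\{\text{blank},\,T_2,\,(T_2,c)\}$, and the actions are required to be either bounded or quasi-bounded (giving two choices of $\mathcal{F}$).
   Context: Categories. $\mathrm{Top}$: topological spaces and continuous maps; $\mathrm{Unif}$: uniform spaces and uniformly continuous maps. Subscripts denote full subcategories: $T_0,T_1,T_2$ the usual separation axioms; $T_{2f}$ functionally Hausdorff (any two distinct points are assigned distinct values by some continuous real-valued function); $T_{3\frac12}$ Tychonoff (Hausdorff completely regular); $\mathrm{Cpct}_{T_2}$ compact Hausdorff spaces; $\mathrm{Unif}_{T_2}$ Hausdorff uniform spaces; $\mathrm{Unif}_{T_2,c}$ complete Hausdorff uniform spaces. $\mathrm{Top}_{\kappa}$ is the full subcategory of $\mathrm{Top}$ on compactly generated spaces (those whose open sets are precisely the subsets whose intersection with every compact subspace is open in that subspace), $\mathrm{Top}_{T_2,\kappa}$ its full subcategory of Hausdorff spaces; $\kappa:\mathrm{Top}\to\mathrm{Top}_{\kappa}$ is the coreflection (right adjoint to the inclusion), and the $\kappa$-product is $X\times^{\kappa}Y:=\kappa(X\times Y)$. An internal monoid in $\mathrm{Top}_\kappa$ is a monoid on a space of $\mathrm{Top}_\kappa$ with multiplication $\mathbb{M}\times^{\kappa}\mathbb{M}\to\mathbb{M}$ continuous. Flows. A flow of $\mathbb{M}$ on $X\in\mathcal{C}$ is a monoid morphism $\mathbb{M}\to\mathcal{C}(X,X)$,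 identified with a unital associative set map $\mathbb{M}\times X\to X$, $(s,x)\mapsto s\triangleright x$, in which each $s$ acts by a morphism of $\mathcal{C}$. Morphisms of flows are equivariant morphisms of $\mathcal{C}$. Subsets of $\mathbb{M}$ carry the subspace topology/uniformity; products in (b) carry the product uniformity. Separate (uniform) continuity over $S\times X$ means that $S\times X\to X$ is (uniformly) continuous in each variable when the other is fixed; joint (uniform) continuity over $J\times X$ means that the map $J\times X\to X$ is (uniformly) continuous. For a topological group $\mathbb{G}$, a flow on a uniform space $X$ is: bounded if for every entourage $V\subseteq X^2$ there is a neighborhood $N$ of $1\in\mathbb{G}$ with $(s\triangleright x,x)\in V$ for all $s\in N$, $x\in X$; quasi-bounded if for every entourage $W\subseteq X^2$ there are a neighborhood $N$ of $1\in\mathbb{G}$ and an entourage $V\subseteq X^2$ with $(s\triangleright x,s\triangleright y)\in W$ for all $s\in N$, $(x,y)\in V$. A functor is monadic if it is, up to an equivalence of its domain commuting (up to natural isomorphism) with the functors to the codomain, the forgetful functor from the Eilenberg–Moore category of algebras of a monad. *)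

theory Defs
  imports "HOL-Analysis.Analysis" "HOL-Library.Equipollence" "HOL-Library.FuncSet" "HOL-Algebra.Group"
begin

section \<open>Categories, functors, monads\<close>

text \<open>Arrows do not record their domain and codomain, so hom-sets need not be disjoint and
  composition takes the objects as arguments: \<open>Comp C X Y Z g f\<close> is the composite of
  \<open>f : X \<rightarrow> Y\<close> and \<open>g : Y \<rightarrow> Z\<close>. Likewise the arrow part of a functor takes the domain and
  codomain of its argument.\<close>

record ('o, 'a) cat =
  Ob :: "'o set"
  Hom :: "'o \<Rightarrow> 'o \<Rightarrow> 'a set"
  Ident :: "'o \<Rightarrow> 'a"
  Comp :: "'o \<Rightarrow> 'o \<Rightarrow> 'o \<Rightarrow> 'a \<Rightarrow> 'a \<Rightarrow> 'a"

definition category :: "('o, 'a) cat \<Rightarrow> bool" where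
  "category C \<longleftrightarrow>
    (\<forall>X\<in>Ob C. Ident C X \<in> Hom C X X) \<and>
    (\<forall>X\<in>Ob C. \<forall>Y\<in>Ob C. \<forall>Z\<in>Ob C. \<forall>f\<in>Hom C X Y. \<forall>g\<in>Hom C Y Z.
       Comp C X Y Z g f \<in> Hom C X Z) \<and>
    (\<forall>X\<in>Ob C. \<forall>Y\<in>Ob C. \<forall>f\<in>Hom C X Y.
       Comp C X X Y f (Ident C X) = f \<and> Comp C X Y Y (Ident C Y) f = f) \<and>
    (\<forall>W\<in>Ob C. \<forall>X\<in>Ob C. \<forall>Y\<in>Ob C. \<forall>Z\<in>Ob C. \<forall>f\<in>Hom C W X. \<forall>g\<in>Hom C X Y. \<forall>h\<in>Hom C Y Z.
       Comp C W Y Z h (Comp C W X Y g f) = Comp C W X Z (Comp C X Y Z h g) f)"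

record ('o, 'a, 'p, 'b) ftr =
  on_ob :: "'o \<Rightarrow> 'p"
  on_hom :: "'o \<Rightarrow> 'o \<Rightarrow> 'a \<Rightarrow> 'b"

definition is_functor :: "('o, 'a) cat \<Rightarrow> ('p, 'b) cat \<Rightarrow> ('o, 'a, 'p, 'b) ftr \<Rightarrow> bool" where
  "is_functor C D F \<longleftrightarrow> category C \<and> category D \<and>
    (\<forall>X\<in>Ob C. on_ob F X \<in> Ob D) \<and>
    (\<forall>X\<in>Ob C. \<forall>Y\<in>Ob C. \<forall>f\<in>Hom C X Y. on_hom F X Y f \<in> Hom D (on_ob F X) (on_ob F Y)) \<and>
    (\<forall>X\<in>Ob C. on_hom F X X (Ident C X) = Ident D (on_ob F X)) \<and>
    (\<forall>X\<in>Ob C. \<forall>Y\<in>Ob C. \<forall>Z\<in>Ob C. \<forall>f\<in>Hom C X Y. \<forall>g\<in>Hom C Y Z.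
       on_hom F X Z (Comp C X Y Z g f) =
       Comp D (on_ob F X) (on_ob F Y) (on_ob F Z) (on_hom F Y Z g) (on_hom F X Y f))"

definition id_ftr :: "('o, 'a, 'o, 'a) ftr" where
  "id_ftr = \<lparr>on_ob = (\<lambda>X. X), on_hom = (\<lambda>X Y f. f)\<rparr>"

definition comp_ftr ::
  "('p, 'b, 'q, 'c) ftr \<Rightarrow> ('o, 'a, 'p, 'b) ftr \<Rightarrow> ('o, 'a, 'q, 'c) ftr" where
  "comp_ftr G F = \<lparr>on_ob = (\<lambda>X. on_ob G (on_ob F X)),
     on_hom = (\<lambda>X Y f. on_hom G (on_ob F X) (on_ob F Y) (on_hom F X Y f))\<rparr>"

definition natural_transformation ::
  "('o, 'a) cat \<Rightarrow> ('p, 'b) cat \<Rightarrow> ('o, 'a, 'p, 'b) ftr \<Rightarrow> ('o, 'a, 'p, 'b) ftr \<Rightarrow> ('o \<Rightarrow> 'b) \<Rightarrow> bool"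
where
  "natural_transformation C D F G \<tau> \<longleftrightarrow> is_functor C D F \<and> is_functor C D G \<and>
    (\<forall>X\<in>Ob C. \<tau> X \<in> Hom D (on_ob F X) (on_ob G X)) \<and>
    (\<forall>X\<in>Ob C. \<forall>Y\<in>Ob C. \<forall>f\<in>Hom C X Y.
       Comp D (on_ob F X) (on_ob F Y) (on_ob G Y) (\<tau> Y) (on_hom F X Y f) =
       Comp D (on_ob F X) (on_ob G X) (on_ob G Y) (on_hom G X Y f) (\<tau> X))"

definition isomorphism :: "('o, 'a) cat \<Rightarrow> 'o \<Rightarrow> 'o \<Rightarrow> 'a \<Rightarrow> bool" where
  "isomorphism C X Y f \<longleftrightarrow> f \<in> Hom C X Y \<and>
    (\<exists>g\<in>Hom C Y X. Comp C X Y X g f = Ident C X \<and> Comp C Y X Y f g = Ident C Y)"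

definition natural_isomorphism ::
  "('o, 'a) cat \<Rightarrow> ('p, 'b) cat \<Rightarrow> ('o, 'a, 'p, 'b) ftr \<Rightarrow> ('o, 'a, 'p, 'b) ftr \<Rightarrow> ('o \<Rightarrow> 'b) \<Rightarrow> bool"
where
  "natural_isomorphism C D F G \<tau> \<longleftrightarrow> natural_transformation C D F G \<tau> \<and>
    (\<forall>X\<in>Ob C. isomorphism D (on_ob F X) (on_ob G X) (\<tau> X))"

definition equivalence :: "('o, 'a) cat \<Rightarrow> ('p, 'b) cat \<Rightarrow> ('o, 'a, 'p, 'b) ftr \<Rightarrow> bool" where
  "equivalence C D K \<longleftrightarrow> is_functor C D K \<and>
    (\<exists>L. is_functor D C L \<and>
      (\<exists>\<sigma>. natural_isomorphism C C (comp_ftr L K) id_ftr \<sigma>) \<and>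
      (\<exists>\<tau>. natural_isomorphism D D (comp_ftr K L) id_ftr \<tau>))"

definition monad ::
  "('o, 'a) cat \<Rightarrow> ('o, 'a, 'o, 'a) ftr \<Rightarrow> ('o \<Rightarrow> 'a) \<Rightarrow> ('o \<Rightarrow> 'a) \<Rightarrow> bool" where
  "monad C T \<eta> \<mu> \<longleftrightarrow> is_functor C C T \<and>
    natural_transformation C C id_ftr T \<eta> \<and>
    natural_transformation C C (comp_ftr T T) T \<mu> \<and>
    (\<forall>X\<in>Ob C. let TX = on_ob T X; TTX = on_ob T TX; TTTX = on_ob T TTX in
       Comp C TX TTX TX (\<mu> X) (\<eta> TX) = Ident C TX \<and>
       Comp C TX TTX TX (\<mu> X) (on_hom T X TX (\<eta> X)) = Ident C TX \<and>
       Comp C TTTX TTX TX (\<mu> X) (\<mu> TX) = Comp C TTTX TTX TX (\<mu> X) (on_hom T TTX TX (\<mu> X)))"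

definition EM_category ::
  "('o, 'a) cat \<Rightarrow> ('o, 'a, 'o, 'a) ftr \<Rightarrow> ('o \<Rightarrow> 'a) \<Rightarrow> ('o \<Rightarrow> 'a) \<Rightarrow> ('o \<times> 'a, 'a) cat" where
  "EM_category C T \<eta> \<mu> = \<lparr>
     Ob = {(X, h). X \<in> Ob C \<and> h \<in> Hom C (on_ob T X) X \<and>
       Comp C X (on_ob T X) X h (\<eta> X) = Ident C X \<and>
       Comp C (on_ob T (on_ob T X)) (on_ob T X) X h (on_hom T (on_ob T X) X h) =
       Comp C (on_ob T (on_ob T X)) (on_ob T X) X h (\<mu> X)},
     Hom = (\<lambda>(X, h) (Y, k). {f \<in> Hom C X Y.
       Comp C (on_ob T X) X Y f h = Comp C (on_ob T X) (on_ob T Y) Y k (on_hom T X Y f)}),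
     Ident = (\<lambda>(X, h). Ident C X),
     Comp = (\<lambda>(X, _) (Y, _) (Z, _). Comp C X Y Z)\<rparr>"

text \<open>Both for algebras and for flows: an object is a pair of an underlying object and a
  structure on it, which is forgotten.\<close>

definition forgetful :: "('o \<times> 's, 'a, 'o, 'a) ftr" where
  "forgetful = \<lparr>on_ob = fst, on_hom = (\<lambda>X Y f. f)\<rparr>"

definition monadic :: "('p, 'b) cat \<Rightarrow> ('o, 'a) cat \<Rightarrow> ('p, 'b, 'o, 'a) ftr \<Rightarrow> bool" where
  "monadic D C U \<longleftrightarrow> is_functor D C U \<and>
    (\<exists>T \<eta> \<mu> K \<sigma>. monad C T \<eta> \<mu> \<and>
       equivalence D (EM_category C T \<eta> \<mu>) K \<and>
       natural_isomorphism D C (comp_ftr forgetful K) U \<sigma>)"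

section \<open>Flows\<close>

definition End_monoid :: "('o, 'a) cat \<Rightarrow> 'o \<Rightarrow> 'a monoid" where
  "End_monoid C X = \<lparr>carrier = Hom C X X, mult = Comp C X X X, one = Ident C X\<rparr>"

text \<open>A flow is an object together with a monoid morphism to its endomorphisms, made extensional
  so that flows which agree on the carrier of the monoid are equal.\<close>

definition flow_category ::
  "('o, 'a) cat \<Rightarrow> ('m, 'r) monoid_scheme \<Rightarrow> ('o \<Rightarrow> ('m \<Rightarrow> 'a) \<Rightarrow> bool) \<Rightarrow>
    ('o \<times> ('m \<Rightarrow> 'a), 'a) cat" where
  "flow_category C M F = \<lparr>
     Ob = {(X, \<alpha>). X \<in> Ob C \<and> \<alpha> \<in> extensional (carrier M) \<and>
       \<alpha> \<in> hom M (End_monoid C X) \<and> \<alpha> \<one>\<^bsub>M\<^esub> = Ident C X \<and> F X \<alpha>},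
     Hom = (\<lambda>(X, \<alpha>) (Y, \<beta>). {f \<in> Hom C X Y.
       \<forall>s\<in>carrier M. Comp C X X Y f (\<alpha> s) = Comp C X Y Y (\<beta> s) f}),
     Ident = (\<lambda>(X, \<alpha>). Ident C X),
     Comp = (\<lambda>(X, _) (Y, _) (Z, _). Comp C X Y Z)\<rparr>"

section \<open>Size\<close>

text \<open>The type \<open>'u\<close> plays the role of a universe: the sets of the categories of spaces are the
  subsets of \<open>'u\<close> of smaller cardinality than \<open>'u\<close>. Cardinalities of Grothendieck universes are
  strong limits; regularity is not required here. Every strong limit type is infinite.\<close>

definition strong_limit :: "'u itself \<Rightarrow> bool" where
  "strong_limit (_ :: 'u itself) \<longleftrightarrow>
    (\<forall>A :: 'u set. A \<prec> (UNIV :: 'u set) \<longrightarrow> Pow A \<prec> (UNIV :: 'u set))"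

text \<open>Morphisms are represented by extensional functions, so that equality of morphisms is
  equality of maps on the carrier.\<close>

definition concrete_category ::
  "('o \<Rightarrow> 'u set) \<Rightarrow> ('o \<Rightarrow> 'o \<Rightarrow> ('u \<Rightarrow> 'u) \<Rightarrow> bool) \<Rightarrow> ('o \<Rightarrow> bool) \<Rightarrow> ('o, 'u \<Rightarrow> 'u) cat" where
  "concrete_category U mor P = \<lparr>
     Ob = {X. U X \<prec> (UNIV :: 'u set) \<and> P X},
     Hom = (\<lambda>X Y. {f \<in> extensional (U X). mor X Y f}),
     Ident = (\<lambda>X. \<lambda>x\<in>U X. x),
     Comp = (\<lambda>X Y Z g f. compose (U X) g f)\<rparr>"

section \<open>Topological spaces\<close>

definition Top :: "('u topology \<Rightarrow> bool) \<Rightarrow> ('u topology, 'u \<Rightarrow> 'u) cat" where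
  "Top P = concrete_category topspace continuous_map P"

definition functionally_Hausdorff_space :: "'u topology \<Rightarrow> bool" where
  "functionally_Hausdorff_space X \<longleftrightarrow>
    (\<forall>x\<in>topspace X. \<forall>y\<in>topspace X. x \<noteq> y \<longrightarrow>
      (\<exists>f. continuous_map X euclideanreal f \<and> f x \<noteq> f y))"

definition Tychonoff_space :: "'u topology \<Rightarrow> bool" where
  "Tychonoff_space X \<longleftrightarrow> Hausdorff_space X \<and> completely_regular_space X"

definition topological_monoid :: "('m, 'r) monoid_scheme \<Rightarrow> 'm topology \<Rightarrow> bool" where
  "topological_monoid M T \<longleftrightarrow> Group.monoid M \<and> topspace T = carrier M \<and>
    continuous_map (prod_topology T T) T (\<lambda>(s, t). s \<otimes>\<^bsub>M\<^esub> t)"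

definition topological_group :: "('m, 'r) monoid_scheme \<Rightarrow> 'm topology \<Rightarrow> bool" where
  "topological_group G T \<longleftrightarrow> Group.group G \<and> topological_monoid G T \<and>
    continuous_map T T (\<lambda>s. inv\<^bsub>G\<^esub> s)"

definition separately_continuous ::
  "'m topology \<Rightarrow> 'u topology \<Rightarrow> ('m \<Rightarrow> 'u \<Rightarrow> 'u) \<Rightarrow> bool" where
  "separately_continuous A X \<alpha> \<longleftrightarrow>
    (\<forall>s\<in>topspace A. continuous_map X X (\<alpha> s)) \<and>
    (\<forall>x\<in>topspace X. continuous_map A X (\<lambda>s. \<alpha> s x))"

definition top_constraint ::
  "'m topology \<Rightarrow> 'm set set \<Rightarrow> 'm set set \<Rightarrow> 'u topology \<Rightarrow> ('m \<Rightarrow> 'u \<Rightarrow> 'u) \<Rightarrow> bool" where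
  "top_constraint T \<S> \<J> X \<alpha> \<longleftrightarrow>
    (\<forall>S\<in>\<S>. separately_continuous (subtopology T S) X \<alpha>) \<and>
    (\<forall>J\<in>\<J>. continuous_map (prod_topology (subtopology T J) X) X (\<lambda>(s, x). \<alpha> s x))"

section \<open>Compactly generated spaces\<close>

text \<open>The coreflection into compactly generated spaces (\<^const>\<open>k_space\<close>); the lemmas
  \<open>k_space_kappa\<close>, \<open>continuous_map_kappa_id\<close> and \<open>continuous_map_into_kappa\<close> below
  give its universal property.\<close>

definition kappa :: "'a topology \<Rightarrow> 'a topology" where
  "kappa X = topology (\<lambda>U. U \<subseteq> topspace X \<and>
    (\<forall>K. compactin X K \<longrightarrow> openin (subtopology X K) (K \<inter> U)))"

lemma openin_kappa:
  "openin (kappa X) U \<longleftrightarrow>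
    U \<subseteq> topspace X \<and> (\<forall>K. compactin X K \<longrightarrow> openin (subtopology X K) (K \<inter> U))"
proof -
  have "istopology (\<lambda>U. U \<subseteq> topspace X \<and>
    (\<forall>K. compactin X K \<longrightarrow> openin (subtopology X K) (K \<inter> U)))"
    unfolding istopology_def
  proof (intro conjI allI impI)
    fix S T K
    assume S: "S \<subseteq> topspace X \<and> (\<forall>K. compactin X K \<longrightarrow> openin (subtopology X K) (K \<inter> S))"
      and T: "T \<subseteq> topspace X \<and> (\<forall>K. compactin X K \<longrightarrow> openin (subtopology X K) (K \<inter> T))"
    then show "S \<inter> T \<subseteq> topspace X" by blast
    assume "compactin X K"
    then have "openin (subtopology X K) ((K \<inter> S) \<inter> (K \<inter> T))"
      using S T by blast
    moreover have "(K \<inter> S) \<inter> (K \<inter> T) = K \<inter> (S \<inter> T)"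
      by blast
    ultimately show "openin (subtopology X K) (K \<inter> (S \<inter> T))"
      by simp
  next
    fix \<K> K
    assume *: "\<forall>U\<in>\<K>. U \<subseteq> topspace X \<and>
      (\<forall>K. compactin X K \<longrightarrow> openin (subtopology X K) (K \<inter> U))"
    then show "\<Union>\<K> \<subseteq> topspace X" by blast
    assume "compactin X K"
    then have "openin (subtopology X K) (\<Union>U\<in>\<K>. K \<inter> U)"
      using * by (intro openin_Union) blast
    moreover have "(\<Union>U\<in>\<K>. K \<inter> U) = K \<inter> \<Union>\<K>"
      by blast
    ultimately show "openin (subtopology X K) (K \<inter> \<Union>\<K>)"
      by simp
  qed
  then show ?thesis
    unfolding kappa_def by (simp only: topology_inverse')
qed

lemma openin_imp_openin_kappa: "openin X U \<Longrightarrow> openin (kappa X) U"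
  by (simp add: openin_kappa openin_subset openin_subtopology_Int2)

lemma topspace_kappa [simp]: "topspace (kappa X) = topspace X"
proof
  show "topspace (kappa X) \<subseteq> topspace X"
    using openin_kappa[of X "topspace (kappa X)"] by simp
  show "topspace X \<subseteq> topspace (kappa X)"
    by (simp add: openin_imp_openin_kappa openin_subset)
qed

lemma continuous_map_kappa_id: "continuous_map (kappa X) X id"
  unfolding continuous_map_def
proof (intro conjI allI impI)
  show "id \<in> topspace (kappa X) \<rightarrow> topspace X"
    by simp
  fix U assume U: "openin X U"
  then have "{x \<in> topspace (kappa X). id x \<in> U} = U"
    using openin_subset by fastforce
  then show "openin (kappa X) {x \<in> topspace (kappa X). id x \<in> U}"
    using openin_imp_openin_kappa[OF U] by simp
qed

lemma continuous_map_into_kappa: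
  assumes Y: "k_space Y" and f: "continuous_map Y X f"
  shows "continuous_map Y (kappa X) f"
  unfolding continuous_map_def
proof (intro conjI allI impI)
  show "f \<in> topspace Y \<rightarrow> topspace (kappa X)"
    using f by (simp add: continuous_map_def)
  fix U assume U: "openin (kappa X) U"
  have "openin (subtopology Y K) (K \<inter> {x \<in> topspace Y. f x \<in> U})" if K: "compactin Y K" for K
  proof -
    have "compactin X (f ` K)"
      using K f image_compactin by blast
    then have o: "openin (subtopology X (f ` K)) (f ` K \<inter> U)"
      using openin_kappa[THEN iffD1, OF U] by simp
    have "continuous_map (subtopology Y K) (subtopology X (f ` K)) f"
      unfolding continuous_map_in_subtopology
      using continuous_map_from_subtopology[OF f] by simp
    then have "openin (subtopology Y K)
        {x \<in> topspace (subtopology Y K). f x \<in> f ` K \<inter> U}"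
      using o by (rule openin_continuous_map_preimage)
    moreover have "{x \<in> topspace (subtopology Y K). f x \<in> f ` K \<inter> U} =
        K \<inter> {x \<in> topspace Y. f x \<in> U}"
      by auto
    ultimately show ?thesis by simp
  qed
  then show "openin Y {x \<in> topspace Y. f x \<in> U}"
    using k_space_open[THEN iffD1, OF Y] by simp
qed

lemma subtopology_kappa_compactin:
  assumes "compactin X K"
  shows "subtopology (kappa X) K = subtopology X K"
  unfolding topology_eq
proof (intro allI iffI)
  fix S
  assume "openin (subtopology (kappa X) K) S"
  then obtain U where "openin (kappa X) U" "S = K \<inter> U"
    by (metis openin_subtopology Int_commute)
  then show "openin (subtopology X K) S"
    using assms openin_kappa by metis
next
  fix S
  assume "openin (subtopology X K) S"
  then show "openin (subtopology (kappa X) K) S"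
    by (metis openin_subtopology openin_imp_openin_kappa)
qed

lemma compactin_kappa: "compactin (kappa X) K \<longleftrightarrow> compactin X K"
proof
  assume "compactin (kappa X) K"
  then show "compactin X K"
    using image_compactin[OF _ continuous_map_kappa_id] by (metis image_id id_apply)
next
  assume K: "compactin X K"
  then show "compactin (kappa X) K"
    using subtopology_kappa_compactin[OF K] by (simp add: compactin_subspace)
qed

lemma k_space_kappa: "k_space (kappa X)"
  unfolding k_space_open
proof (intro allI impI)
  fix U
  assume U: "U \<subseteq> topspace (kappa X) \<and>
    (\<forall>K. compactin (kappa X) K \<longrightarrow> openin (subtopology (kappa X) K) (K \<inter> U))"
  have "openin (subtopology X K) (K \<inter> U)" if "compactin X K" for K
    using U that by (metis compactin_kappa subtopology_kappa_compactin)
  then show "openin (kappa X) U"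
    using U by (simp add: openin_kappa)
qed

definition kappa_monoid :: "('m, 'r) monoid_scheme \<Rightarrow> 'm topology \<Rightarrow> bool" where
  "kappa_monoid M T \<longleftrightarrow> Group.monoid M \<and> k_space T \<and> topspace T = carrier M \<and>
    continuous_map (kappa (prod_topology T T)) T (\<lambda>(s, t). s \<otimes>\<^bsub>M\<^esub> t)"

definition kappa_constraint ::
  "'m topology \<Rightarrow> 'm set set \<Rightarrow> 'm set set \<Rightarrow> 'u topology \<Rightarrow> ('m \<Rightarrow> 'u \<Rightarrow> 'u) \<Rightarrow> bool" where
  "kappa_constraint T \<S> \<J> X \<alpha> \<longleftrightarrow>
    (\<forall>S\<in>\<S>. separately_continuous (kappa (subtopology T S)) X \<alpha>) \<and>
    (\<forall>J\<in>\<J>. continuous_map (kappa (prod_topology (kappa (subtopology T J)) X)) X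
      (\<lambda>(s, x). \<alpha> s x))"

section \<open>Uniform spaces\<close>

text \<open>The library has uniform spaces only as a type class, so those with an explicit carrier are
  introduced here. Entourages are subsets of the square of the carrier. The empty set carries a
  uniformity, whose only entourage is empty.\<close>

record 'a uspace =
  upoints :: "'a set"
  entourages :: "('a \<times> 'a) set set"

definition uniform_structure :: "'a uspace \<Rightarrow> bool" where
  "uniform_structure X \<longleftrightarrow>
    upoints X \<times> upoints X \<in> entourages X \<and>
    (\<forall>V\<in>entourages X. Id_on (upoints X) \<subseteq> V \<and> V \<subseteq> upoints X \<times> upoints X) \<and>
    (\<forall>V\<in>entourages X. \<forall>W. V \<subseteq> W \<and> W \<subseteq> upoints X \<times> upoints X \<longrightarrow> W \<in> entourages X) \<and>
    (\<forall>V\<in>entourages X. \<forall>W\<in>entourages X. V \<inter> W \<in> entourages X) \<and>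
    (\<forall>V\<in>entourages X. V\<inverse> \<in> entourages X) \<and>
    (\<forall>V\<in>entourages X. \<exists>W\<in>entourages X. W O W \<subseteq> V)"

definition unif_continuous :: "'a uspace \<Rightarrow> 'b uspace \<Rightarrow> ('a \<Rightarrow> 'b) \<Rightarrow> bool" where
  "unif_continuous X Y f \<longleftrightarrow> f \<in> upoints X \<rightarrow> upoints Y \<and>
    (\<forall>W\<in>entourages Y. {(x, x') \<in> upoints X \<times> upoints X. (f x, f x') \<in> W} \<in> entourages X)"

definition sub_uspace :: "'a uspace \<Rightarrow> 'a set \<Rightarrow> 'a uspace" where
  "sub_uspace X S = \<lparr>upoints = upoints X \<inter> S,
     entourages = {V \<inter> (S \<times> S) |V. V \<in> entourages X}\<rparr>"

definition prod_uspace :: "'a uspace \<Rightarrow> 'b uspace \<Rightarrow> ('a \<times> 'b) uspace" where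
  "prod_uspace X Y = \<lparr>upoints = upoints X \<times> upoints Y,
     entourages = {E. E \<subseteq> (upoints X \<times> upoints Y) \<times> (upoints X \<times> upoints Y) \<and>
       (\<exists>V\<in>entourages X. \<exists>W\<in>entourages Y.
         {((x, y), (x', y')) |x y x' y'. (x, x') \<in> V \<and> (y, y') \<in> W} \<subseteq> E)}\<rparr>"

definition Hausdorff_uspace :: "'a uspace \<Rightarrow> bool" where
  "Hausdorff_uspace X \<longleftrightarrow>
    (\<forall>x\<in>upoints X. \<forall>y\<in>upoints X. x \<noteq> y \<longrightarrow> (\<exists>V\<in>entourages X. (x, y) \<notin> V))"

text \<open>Every Cauchy filter converges. Filters on the carrier are the filters on the ambient type
  below its principal filter.\<close>

definition complete_uspace :: "'a uspace \<Rightarrow> bool" where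
  "complete_uspace X \<longleftrightarrow>
    (\<forall>F. F \<noteq> bot \<and> F \<le> principal (upoints X) \<and>
         (\<forall>V\<in>entourages X. eventually (\<lambda>p. p \<in> V) (F \<times>\<^sub>F F)) \<longrightarrow>
      (\<exists>x\<in>upoints X. \<forall>V\<in>entourages X. eventually (\<lambda>y. (x, y) \<in> V) F))"

definition Unif :: "('u uspace \<Rightarrow> bool) \<Rightarrow> ('u uspace, 'u \<Rightarrow> 'u) cat" where
  "Unif P = concrete_category upoints unif_continuous (\<lambda>X. uniform_structure X \<and> P X)"

definition separately_unif_continuous ::
  "'m uspace \<Rightarrow> 'u uspace \<Rightarrow> ('m \<Rightarrow> 'u \<Rightarrow> 'u) \<Rightarrow> bool" where
  "separately_unif_continuous A X \<alpha> \<longleftrightarrow>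
    (\<forall>s\<in>upoints A. unif_continuous X X (\<alpha> s)) \<and>
    (\<forall>x\<in>upoints X. unif_continuous A X (\<lambda>s. \<alpha> s x))"

definition unif_constraint ::
  "'m uspace \<Rightarrow> 'm set set \<Rightarrow> 'm set set \<Rightarrow> 'u uspace \<Rightarrow> ('m \<Rightarrow> 'u \<Rightarrow> 'u) \<Rightarrow> bool" where
  "unif_constraint \<U> \<S> \<J> X \<alpha> \<longleftrightarrow>
    (\<forall>S\<in>\<S>. separately_unif_continuous (sub_uspace \<U> S) X \<alpha>) \<and>
    (\<forall>J\<in>\<J>. unif_continuous (prod_uspace (sub_uspace \<U> J) X) X (\<lambda>(s, x). \<alpha> s x))"

definition neighborhood :: "'a topology \<Rightarrow> 'a \<Rightarrow> 'a set \<Rightarrow> bool" where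
  "neighborhood T x N \<longleftrightarrow> N \<subseteq> topspace T \<and> (\<exists>U. openin T U \<and> x \<in> U \<and> U \<subseteq> N)"

definition bounded_flow ::
  "('m, 'r) monoid_scheme \<Rightarrow> 'm topology \<Rightarrow> 'u uspace \<Rightarrow> ('m \<Rightarrow> 'u \<Rightarrow> 'u) \<Rightarrow> bool" where
  "bounded_flow G T X \<alpha> \<longleftrightarrow>
    (\<forall>V\<in>entourages X. \<exists>N. neighborhood T \<one>\<^bsub>G\<^esub> N \<and>
      (\<forall>s\<in>N. \<forall>x\<in>upoints X. (\<alpha> s x, x) \<in> V))"

definition quasi_bounded_flow ::
  "('m, 'r) monoid_scheme \<Rightarrow> 'm topology \<Rightarrow> 'u uspace \<Rightarrow> ('m \<Rightarrow> 'u \<Rightarrow> 'u) \<Rightarrow> bool" where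
  "quasi_bounded_flow G T X \<alpha> \<longleftrightarrow>
    (\<forall>W\<in>entourages X. \<exists>N. neighborhood T \<one>\<^bsub>G\<^esub> N \<and>
      (\<exists>V\<in>entourages X. \<forall>s\<in>N. \<forall>(x, y)\<in>V. (\<alpha> s x, \<alpha> s y) \<in> W))"

end

(*
If every object X of C has a free flow Q X, and the constraint F passes to retracts, then the
comparison functor to the algebras of the resulting monad is an isomorphism of categories: an algebra
h : Q X -> X is itself equivariant for the action h o s o eta of M on X, so X is a retract of Q X and
satisfies F, and h is the counit of this flow. No coequalizers are needed.

The constraints F are inherited along initial structures. The free flow on X is therefore obtained
inside the product of all flows Y, indexed by the morphisms X -> Y: it is the union of the orbits of
the image of X. When C consists of compact Hausdorff or complete Hausdorff spaces, it is the closure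
of this union, whose cardinality is bounded by that of the second power set. The strong limit
hypothesis keeps these sets small.
*)

theory Submission
  imports Defs
begin

section \<open>Monadicity from free flows\<close>

text \<open>In general the product of all flows under X has too many points to be an object of the
  category, although each factor is one. It is used only as a set of functions: an invariant part
  that contains the orbits and has fewer elements than \<open>'u\<close> is transported along a
  bijection to a subset of \<open>'u\<close>, and there it receives the initial structure. Existence
  in the universal property is then immediate, since the extension of an arrow is the coordinate
  indexed by that arrow. Uniqueness is the delicate half, because an equivariant map is forced on
  the orbits only. So either the object consists of the orbits alone, which works when the axioms on
  the spaces pass to subspaces of products, or it is their closure and all targets are Hausdorff.
  The orbits are indexed by pairs from M and X, so they are few because \<open>'u\<close> is
  infinite; the closure costs two further power sets.\<close>

locale abstract_category =
  fixes C :: "('o, 'a) cat"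
  assumes category: "category C"
begin

lemma Ident_in [simp]: "X \<in> Ob C \<Longrightarrow> Ident C X \<in> Hom C X X"
  using category by (simp add: category_def)

lemma Comp_in [simp]:
  "\<lbrakk>f \<in> Hom C X Y; g \<in> Hom C Y Z; X \<in> Ob C; Y \<in> Ob C; Z \<in> Ob C\<rbrakk> \<Longrightarrow> Comp C X Y Z g f \<in> Hom C X Z"
  using category unfolding category_def by blast

lemma Comp_Ident [simp]:
  "\<lbrakk>f \<in> Hom C X Y; X \<in> Ob C; Y \<in> Ob C\<rbrakk> \<Longrightarrow> Comp C X X Y f (Ident C X) = f"
  using category unfolding category_def by blast

lemma Ident_Comp [simp]:
  "\<lbrakk>f \<in> Hom C X Y; X \<in> Ob C; Y \<in> Ob C\<rbrakk> \<Longrightarrow> Comp C X Y Y (Ident C Y) f = f"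
  using category unfolding category_def by blast

lemma Comp_assoc:
  "\<lbrakk>f \<in> Hom C W X; g \<in> Hom C X Y; h \<in> Hom C Y Z; W \<in> Ob C; X \<in> Ob C; Y \<in> Ob C; Z \<in> Ob C\<rbrakk> \<Longrightarrow>
    Comp C W X Z (Comp C X Y Z h g) f = Comp C W Y Z h (Comp C W X Y g f)"
  using category unfolding category_def by metis

lemma isomorphism_Ident: "X \<in> Ob C \<Longrightarrow> isomorphism C X X (Ident C X)"
  unfolding isomorphism_def by (intro conjI bexI[of _ "Ident C X"]) simp_all

text \<open>The comparison functor has a strict inverse and commutes strictly with the forgetful
  functors. Identity components turn such equalities into the natural isomorphisms that
  \<open>equivalence\<close> and \<open>monadic\<close> ask for.\<close>

lemma natural_isomorphism_Ident:
  assumes "is_functor B C G" "is_functor B C H"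
    and "\<And>X. X \<in> Ob B \<Longrightarrow> on_ob G X = on_ob H X"
    and "\<And>X Y f. \<lbrakk>X \<in> Ob B; Y \<in> Ob B; f \<in> Hom B X Y\<rbrakk> \<Longrightarrow> on_hom G X Y f = on_hom H X Y f"
  shows "natural_isomorphism B C G H (\<lambda>X. Ident C (on_ob H X))"
  using assms unfolding natural_isomorphism_def natural_transformation_def
  by (auto simp: is_functor_def isomorphism_Ident)

end

lemma is_functor_id_ftr: "category C \<Longrightarrow> is_functor C C id_ftr"
  by (simp add: is_functor_def id_ftr_def)

lemma is_functor_comp_ftr:
  assumes "is_functor B C F" "is_functor C D G"
  shows "is_functor B D (comp_ftr G F)"
  using assms unfolding is_functor_def comp_ftr_def by simp

section \<open>Categories of flows and of algebras\<close>

lemma flow_Ob_iff: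
  "(X, \<alpha>) \<in> Ob (flow_category C M F) \<longleftrightarrow> X \<in> Ob C \<and> \<alpha> \<in> extensional (carrier M) \<and>
    (\<forall>s\<in>carrier M. \<alpha> s \<in> Hom C X X) \<and>
    (\<forall>s\<in>carrier M. \<forall>t\<in>carrier M. \<alpha> (s \<otimes>\<^bsub>M\<^esub> t) = Comp C X X X (\<alpha> s) (\<alpha> t)) \<and>
    \<alpha> \<one>\<^bsub>M\<^esub> = Ident C X \<and> F X \<alpha>"
  by (auto simp: flow_category_def hom_def End_monoid_def)

lemma flow_Hom_iff:
  "f \<in> Hom (flow_category C M F) (X, \<alpha>) (Y, \<beta>) \<longleftrightarrow>
    f \<in> Hom C X Y \<and> (\<forall>s\<in>carrier M. Comp C X X Y f (\<alpha> s) = Comp C X Y Y (\<beta> s) f)"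
  by (simp add: flow_category_def)

lemma flow_Ident [simp]: "Ident (flow_category C M F) (X, \<alpha>) = Ident C X"
  by (simp add: flow_category_def)

lemma flow_Comp [simp]:
  "Comp (flow_category C M F) (X, \<alpha>) (Y, \<beta>) (Z, \<gamma>) = Comp C X Y Z"
  by (simp add: flow_category_def)

lemma EM_Ob_iff:
  "(X, h) \<in> Ob (EM_category C T \<eta> \<mu>) \<longleftrightarrow> X \<in> Ob C \<and> h \<in> Hom C (on_ob T X) X \<and>
    Comp C X (on_ob T X) X h (\<eta> X) = Ident C X \<and>
    Comp C (on_ob T (on_ob T X)) (on_ob T X) X h (on_hom T (on_ob T X) X h) =
    Comp C (on_ob T (on_ob T X)) (on_ob T X) X h (\<mu> X)"
  by (simp add: EM_category_def)

lemma EM_Hom_iff: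
  "f \<in> Hom (EM_category C T \<eta> \<mu>) (X, h) (Y, k) \<longleftrightarrow> f \<in> Hom C X Y \<and>
    Comp C (on_ob T X) X Y f h = Comp C (on_ob T X) (on_ob T Y) Y k (on_hom T X Y f)"
  by (simp add: EM_category_def)

lemma EM_Ident [simp]: "Ident (EM_category C T \<eta> \<mu>) (X, h) = Ident C X"
  by (simp add: EM_category_def)

lemma EM_Comp [simp]: "Comp (EM_category C T \<eta> \<mu>) (X, h) (Y, k) (Z, l) = Comp C X Y Z"
  by (simp add: EM_category_def)

context abstract_category
begin

lemma category_flow_category: "category (flow_category C M F)"
proof -
  let ?D = "flow_category C M F"
  have "Comp C X Y Z g f \<in> Hom ?D (X, \<alpha>) (Z, \<gamma>)"
    if ob: "(X, \<alpha>) \<in> Ob ?D" "(Y, \<beta>) \<in> Ob ?D" "(Z, \<gamma>) \<in> Ob ?D"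
      and f: "f \<in> Hom ?D (X, \<alpha>) (Y, \<beta>)" and g: "g \<in> Hom ?D (Y, \<beta>) (Z, \<gamma>)"
    for X \<alpha> Y \<beta> Z \<gamma> f g
  proof -
    have [simp]: "X \<in> Ob C" "Y \<in> Ob C" "Z \<in> Ob C" "f \<in> Hom C X Y" "g \<in> Hom C Y Z"
      "\<And>s. s \<in> carrier M \<Longrightarrow> \<alpha> s \<in> Hom C X X" "\<And>s. s \<in> carrier M \<Longrightarrow> \<beta> s \<in> Hom C Y Y"
      "\<And>s. s \<in> carrier M \<Longrightarrow> \<gamma> s \<in> Hom C Z Z"
      using ob f g by (auto simp: flow_Ob_iff flow_Hom_iff)
    have "Comp C X X Z (Comp C X Y Z g f) (\<alpha> s) = Comp C X Z Z (\<gamma> s) (Comp C X Y Z g f)"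
      if [simp]: "s \<in> carrier M" for s
    proof -
      have "Comp C X X Z (Comp C X Y Z g f) (\<alpha> s) = Comp C X Y Z g (Comp C X Y Y (\<beta> s) f)"
        using f by (simp add: Comp_assoc flow_Hom_iff)
      also have "\<dots> = Comp C X Y Z (Comp C Y Y Z g (\<beta> s)) f"
        by (simp add: Comp_assoc)
      also have "\<dots> = Comp C X Z Z (\<gamma> s) (Comp C X Y Z g f)"
        using g by (simp add: Comp_assoc flow_Hom_iff)
      finally show ?thesis .
    qed
    then show ?thesis by (simp add: flow_Hom_iff)
  qed
  moreover have "Ident C X \<in> Hom ?D (X, \<alpha>) (X, \<alpha>)" if "(X, \<alpha>) \<in> Ob ?D" for X \<alpha>
    using that by (simp add: flow_Ob_iff flow_Hom_iff)
  moreover have "X \<in> Ob C" if "(X, \<alpha>) \<in> Ob ?D" for X \<alpha>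
    using that by (simp add: flow_Ob_iff)
  moreover have "f \<in> Hom C X Y" if "f \<in> Hom ?D (X, \<alpha>) (Y, \<beta>)" for X \<alpha> Y \<beta> f
    using that by (simp add: flow_Hom_iff)
  ultimately show ?thesis
    unfolding category_def Ball_def split_paired_All flow_Ident flow_Comp
    by (intro conjI allI impI; metis Comp_Ident Ident_Comp Comp_assoc)
qed

lemma is_functor_forgetful_flow: "is_functor (flow_category C M F) C forgetful"
  unfolding is_functor_def forgetful_def
  using category category_flow_category by (auto simp: flow_Ob_iff flow_Hom_iff)

lemma category_EM_category:
  assumes T: "is_functor C C T"
  shows "category (EM_category C T \<eta> \<mu>)"
proof -
  let ?E = "EM_category C T \<eta> \<mu>"
  have T_ob [simp]: "on_ob T X \<in> Ob C" if "X \<in> Ob C" for X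
    using T that by (simp add: is_functor_def)
  have T_hom [simp]: "on_hom T X Y f \<in> Hom C (on_ob T X) (on_ob T Y)"
    if "f \<in> Hom C X Y" "X \<in> Ob C" "Y \<in> Ob C" for X Y f
    using T that by (simp add: is_functor_def)
  have "Comp C X Y Z g f \<in> Hom ?E (X, h) (Z, l)"
    if ob: "(X, h) \<in> Ob ?E" "(Y, k) \<in> Ob ?E" "(Z, l) \<in> Ob ?E"
      and f: "f \<in> Hom ?E (X, h) (Y, k)" and g: "g \<in> Hom ?E (Y, k) (Z, l)" for X h Y k Z l f g
  proof -
    have [simp]: "X \<in> Ob C" "Y \<in> Ob C" "Z \<in> Ob C" "f \<in> Hom C X Y" "g \<in> Hom C Y Z"
      "h \<in> Hom C (on_ob T X) X" "k \<in> Hom C (on_ob T Y) Y" "l \<in> Hom C (on_ob T Z) Z"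
      using ob f g by (auto simp: EM_Ob_iff EM_Hom_iff)
    have "Comp C (on_ob T X) X Z (Comp C X Y Z g f) h =
        Comp C (on_ob T X) Y Z g (Comp C (on_ob T X) (on_ob T Y) Y k (on_hom T X Y f))"
      using f by (simp add: Comp_assoc EM_Hom_iff)
    also have "\<dots> = Comp C (on_ob T X) (on_ob T Y) Z (Comp C (on_ob T Y) Y Z g k) (on_hom T X Y f)"
      by (simp add: Comp_assoc)
    also have "\<dots> = Comp C (on_ob T X) (on_ob T Z) Z l
        (Comp C (on_ob T X) (on_ob T Y) (on_ob T Z) (on_hom T Y Z g) (on_hom T X Y f))"
      using g by (simp add: Comp_assoc EM_Hom_iff)
    also have "\<dots> = Comp C (on_ob T X) (on_ob T Z) Z l (on_hom T X Z (Comp C X Y Z g f))"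
      using T by (simp add: is_functor_def)
    finally show ?thesis by (simp add: EM_Hom_iff)
  qed
  moreover have "on_hom T X X (Ident C X) = Ident C (on_ob T X)" if "X \<in> Ob C" for X
    using T that by (simp add: is_functor_def)
  then have "Ident C X \<in> Hom ?E (X, h) (X, h)" if "(X, h) \<in> Ob ?E" for X h
    using that by (simp add: EM_Ob_iff EM_Hom_iff)
  moreover have "X \<in> Ob C" if "(X, h) \<in> Ob ?E" for X h
    using that by (simp add: EM_Ob_iff)
  moreover have "f \<in> Hom C X Y" if "f \<in> Hom ?E (X, h) (Y, k)" for X h Y k f
    using that by (simp add: EM_Hom_iff)
  ultimately show ?thesis
    unfolding category_def Ball_def split_paired_All EM_Ident EM_Comp
    by (intro conjI allI impI; metis Comp_Ident Ident_Comp Comp_assoc)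
qed

lemma is_functor_forgetful_EM:
  assumes "is_functor C C T"
  shows "is_functor (EM_category C T \<eta> \<mu>) C forgetful"
proof -
  let ?E = "EM_category C T \<eta> \<mu>"
  have Ob: "X \<in> Ob C" if "(X, h) \<in> Ob ?E" for X h
    using that by (simp add: EM_Ob_iff)
  have Hom: "f \<in> Hom C X Y" if "f \<in> Hom ?E (X, h) (Y, k)" for X h Y k f
    using that by (simp add: EM_Hom_iff)
  show ?thesis
    unfolding is_functor_def forgetful_def Ball_def split_paired_All ftr.simps fst_conv EM_Ident EM_Comp
    using category category_EM_category[OF assms] Ob Hom by blast
qed

end

section \<open>Free flows and their monad\<close>

text \<open>The left adjoint is given objectwise by universal arrows; its functoriality and the
  monad laws come from uniqueness. The assumption \<open>retract\<close> is what allows an algebra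
  to be recognised as a flow satisfying \<open>F\<close>.\<close>

locale free_flows = abstract_category C for C :: "('o, 'a) cat" +
  fixes M :: "('m, 'r) monoid_scheme" and F :: "'o \<Rightarrow> ('m \<Rightarrow> 'a) \<Rightarrow> bool"
    and Q :: "'o \<Rightarrow> 'o" and \<gamma> :: "'o \<Rightarrow> 'm \<Rightarrow> 'a" and \<eta> :: "'o \<Rightarrow> 'a"
  assumes monoid_M: "Group.monoid M"
    and free_Ob: "X \<in> Ob C \<Longrightarrow> (Q X, \<gamma> X) \<in> Ob (flow_category C M F)"
    and unit_in [simp]: "X \<in> Ob C \<Longrightarrow> \<eta> X \<in> Hom C X (Q X)"
    and universal: "\<lbrakk>X \<in> Ob C; (Y, \<beta>) \<in> Ob (flow_category C M F); f \<in> Hom C X Y\<rbrakk> \<Longrightarrow>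
      \<exists>!g. g \<in> Hom (flow_category C M F) (Q X, \<gamma> X) (Y, \<beta>) \<and> Comp C X (Q X) Y g (\<eta> X) = f"
    and retract: "\<lbrakk>X \<in> Ob C; (Y, \<beta>) \<in> Ob (flow_category C M F); i \<in> Hom C X Y; r \<in> Hom C Y X;
      Comp C X Y X r i = Ident C X\<rbrakk> \<Longrightarrow>
      F X (\<lambda>s\<in>carrier M. Comp C X Y X r (Comp C X Y Y (\<beta> s) i))"
begin

abbreviation D where "D \<equiv> flow_category C M F"

lemma free_simps [simp]:
  assumes "X \<in> Ob C"
  shows "Q X \<in> Ob C" "s \<in> carrier M \<Longrightarrow> \<gamma> X s \<in> Hom C (Q X) (Q X)"
  using free_Ob[OF assms] by (auto simp: flow_Ob_iff)

definition lift where
  "lift X Y \<beta> f = (THE g. g \<in> Hom D (Q X, \<gamma> X) (Y, \<beta>) \<and> Comp C X (Q X) Y g (\<eta> X) = f)"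

context
  fixes X Y \<beta> f
  assumes X: "X \<in> Ob C" and Y: "(Y, \<beta>) \<in> Ob D" and f: "f \<in> Hom C X Y"
begin

lemma lift_in_D: "lift X Y \<beta> f \<in> Hom D (Q X, \<gamma> X) (Y, \<beta>)"
  and lift_unit: "Comp C X (Q X) Y (lift X Y \<beta> f) (\<eta> X) = f"
  unfolding lift_def using theI'[OF universal[OF X Y f]] by blast+

end

text \<open>The uniqueness half of \<open>universal\<close> in the form used below: equations
  between equivariant maps out of a free flow are checked after composing with
  \<open>\<eta>\<close>.\<close>

lemma flow_map_eqI:
  assumes "X \<in> Ob C" "(Y, \<beta>) \<in> Ob D"
    and "g \<in> Hom D (Q X, \<gamma> X) (Y, \<beta>)" "h \<in> Hom D (Q X, \<gamma> X) (Y, \<beta>)"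
    and "Comp C X (Q X) Y g (\<eta> X) = Comp C X (Q X) Y h (\<eta> X)"
  shows "g = h"
proof -
  have "Comp C X (Q X) Y h (\<eta> X) \<in> Hom C X Y"
    using assms by (simp add: flow_Hom_iff flow_Ob_iff)
  then show ?thesis
    using universal[OF assms(1,2)] assms by blast
qed

definition counit where "counit X \<alpha> = lift X X \<alpha> (Ident C X)"
definition Q_map where "Q_map X Y f = lift X (Q Y) (\<gamma> Y) (Comp C X Y (Q Y) (\<eta> Y) f)"
definition join where "join X = counit (Q X) (\<gamma> X)"
definition T where "T = \<lparr>on_ob = Q, on_hom = Q_map\<rparr>"

lemma T_simps [simp]: "on_ob T = Q" "on_hom T = Q_map"
  by (simp_all add: T_def)

lemma counit_in_D: "(X, \<alpha>) \<in> Ob D \<Longrightarrow> counit X \<alpha> \<in> Hom D (Q X, \<gamma> X) (X, \<alpha>)"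
  and counit_unit [simp]: "(X, \<alpha>) \<in> Ob D \<Longrightarrow> Comp C X (Q X) X (counit X \<alpha>) (\<eta> X) = Ident C X"
  by (auto simp: counit_def flow_Ob_iff intro!: lift_in_D lift_unit)

lemma counit_in [simp]: "(X, \<alpha>) \<in> Ob D \<Longrightarrow> counit X \<alpha> \<in> Hom C (Q X) X"
  using counit_in_D by (simp add: flow_Hom_iff)

context
  fixes X Y f
  assumes [simp]: "f \<in> Hom C X Y" "X \<in> Ob C" "Y \<in> Ob C"
begin

lemma Q_map_in_D: "Q_map X Y f \<in> Hom D (Q X, \<gamma> X) (Q Y, \<gamma> Y)"
  and Q_map_unit: "Comp C X (Q X) (Q Y) (Q_map X Y f) (\<eta> X) = Comp C X Y (Q Y) (\<eta> Y) f"
  by (auto simp: Q_map_def free_Ob intro!: lift_in_D lift_unit)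

lemma Q_map_in [simp]: "Q_map X Y f \<in> Hom C (Q X) (Q Y)"
  using Q_map_in_D by (simp add: flow_Hom_iff)

end

lemma Comp_in_D:
  assumes "(Y, \<beta>) \<in> Ob D" "(X, \<alpha>) \<in> Ob D" "(Z, \<delta>) \<in> Ob D"
    and "f \<in> Hom D (X, \<alpha>) (Y, \<beta>)" "g \<in> Hom D (Y, \<beta>) (Z, \<delta>)"
  shows "Comp C X Y Z g f \<in> Hom D (X, \<alpha>) (Z, \<delta>)"
proof -
  interpret D: abstract_category D
    by unfold_locales (rule category_flow_category)
  show ?thesis using D.Comp_in[OF assms(4,5) assms(2,1,3)] by simp
qed

text \<open>Both sides are equivariant and restrict to f along \<open>\<eta> X\<close>. Applied to
  suitable equivariant maps f, this one square yields naturality and associativity of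
  \<open>join\<close>, the algebra law for \<open>counit\<close>, and functoriality of
  \<open>K\<close>.\<close>

lemma counit_natural:
  assumes X: "(X, \<alpha>) \<in> Ob D" and Y: "(Y, \<beta>) \<in> Ob D" and f: "f \<in> Hom D (X, \<alpha>) (Y, \<beta>)"
  shows "Comp C (Q X) (Q Y) Y (counit Y \<beta>) (Q_map X Y f) = Comp C (Q X) X Y f (counit X \<alpha>)"
proof (rule flow_map_eqI)
  have [simp]: "X \<in> Ob C" "Y \<in> Ob C" "f \<in> Hom C X Y"
    using assms by (auto simp: flow_Ob_iff flow_Hom_iff)
  note [simp] = counit_in[OF X] counit_in[OF Y]
  show "X \<in> Ob C" by simp
  show "(Y, \<beta>) \<in> Ob D" by fact
  show "Comp C (Q X) (Q Y) Y (counit Y \<beta>) (Q_map X Y f) \<in> Hom D (Q X, \<gamma> X) (Y, \<beta>)"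
    by (rule Comp_in_D[OF free_Ob[of Y]]) (simp_all add: free_Ob Y counit_in_D Q_map_in_D)
  show "Comp C (Q X) X Y f (counit X \<alpha>) \<in> Hom D (Q X, \<gamma> X) (Y, \<beta>)"
    by (rule Comp_in_D[OF X]) (simp_all add: free_Ob X Y counit_in_D f)
  have "Comp C X (Q X) Y (Comp C (Q X) (Q Y) Y (counit Y \<beta>) (Q_map X Y f)) (\<eta> X) =
      Comp C X Y Y (Comp C Y (Q Y) Y (counit Y \<beta>) (\<eta> Y)) f"
    by (simp add: Comp_assoc Q_map_unit)
  also have "\<dots> = Comp C X (Q X) Y (Comp C (Q X) X Y f (counit X \<alpha>)) (\<eta> X)"
    by (simp add: Comp_assoc X Y)
  finally show "Comp C X (Q X) Y (Comp C (Q X) (Q Y) Y (counit Y \<beta>) (Q_map X Y f)) (\<eta> X) =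
      Comp C X (Q X) Y (Comp C (Q X) X Y f (counit X \<alpha>)) (\<eta> X)" .
qed

lemma is_functor_T: "is_functor C C T"
proof -
  have "Q_map X X (Ident C X) = Ident C (Q X)" if [simp]: "X \<in> Ob C" for X
    by (rule flow_map_eqI[of X "Q X" "\<gamma> X"])
      (simp_all add: free_Ob Q_map_unit Q_map_in_D, simp add: flow_Hom_iff)
  moreover have "Q_map X Z (Comp C X Y Z g f) = Comp C (Q X) (Q Y) (Q Z) (Q_map Y Z g) (Q_map X Y f)"
    if [simp]: "X \<in> Ob C" "Y \<in> Ob C" "Z \<in> Ob C" "f \<in> Hom C X Y" "g \<in> Hom C Y Z" for X Y Z f g
  proof (rule flow_map_eqI[of X "Q Z" "\<gamma> Z"])
    show "Comp C (Q X) (Q Y) (Q Z) (Q_map Y Z g) (Q_map X Y f) \<in> Hom D (Q X, \<gamma> X) (Q Z, \<gamma> Z)"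
      by (rule Comp_in_D[OF free_Ob[of Y]]) (simp_all add: free_Ob Q_map_in_D)
    have "Comp C X (Q X) (Q Z) (Comp C (Q X) (Q Y) (Q Z) (Q_map Y Z g) (Q_map X Y f)) (\<eta> X) =
        Comp C X (Q Y) (Q Z) (Q_map Y Z g) (Comp C X Y (Q Y) (\<eta> Y) f)"
      by (simp add: Comp_assoc Q_map_unit)
    also have "\<dots> = Comp C X Y (Q Z) (Comp C Y (Q Y) (Q Z) (Q_map Y Z g) (\<eta> Y)) f"
      by (simp add: Comp_assoc)
    also have "\<dots> = Comp C X (Q X) (Q Z) (Q_map X Z (Comp C X Y Z g f)) (\<eta> X)"
      by (simp add: Q_map_unit) (simp add: Comp_assoc)
    finally show "Comp C X (Q X) (Q Z) (Q_map X Z (Comp C X Y Z g f)) (\<eta> X) =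
        Comp C X (Q X) (Q Z) (Comp C (Q X) (Q Y) (Q Z) (Q_map Y Z g) (Q_map X Y f)) (\<eta> X)"
      by simp
  qed (simp_all add: free_Ob Q_map_in_D)
  ultimately show ?thesis
    by (simp add: is_functor_def category)
qed

lemma join_in [simp]: "X \<in> Ob C \<Longrightarrow> join X \<in> Hom C (Q (Q X)) (Q X)"
  by (simp add: join_def free_Ob)

lemma monad_T: "monad C T \<eta> join"
proof -
  have unit: "natural_transformation C C id_ftr T \<eta>"
    by (auto simp: natural_transformation_def is_functor_T is_functor_id_ftr category)
      (auto simp: id_ftr_def Q_map_unit)
  have join: "natural_transformation C C (comp_ftr T T) T join"
    using is_functor_comp_ftr[OF is_functor_T is_functor_T] is_functor_T
      counit_natural[OF free_Ob free_Ob Q_map_in_D]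
    unfolding natural_transformation_def comp_ftr_def join_def by (simp add: free_Ob)
  \<comment> \<open>This unit law is not an instance of \<open>counit_unit\<close>. Both sides are
    equivariant, and naturality of \<open>\<eta>\<close> reduces their restrictions along
    \<open>\<eta> X\<close> to the other unit law.\<close>
  have "Comp C (Q X) (Q (Q X)) (Q X) (join X) (Q_map X (Q X) (\<eta> X)) = Ident C (Q X)"
    if [simp]: "X \<in> Ob C" for X
  proof (rule flow_map_eqI[of X "Q X" "\<gamma> X"])
    show "Comp C (Q X) (Q (Q X)) (Q X) (join X) (Q_map X (Q X) (\<eta> X)) \<in> Hom D (Q X, \<gamma> X) (Q X, \<gamma> X)"
      by (rule Comp_in_D[OF free_Ob[of "Q X"]]) (simp_all add: free_Ob Q_map_in_D join_def counit_in_D)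
    have "Comp C X (Q X) (Q X) (Comp C (Q X) (Q (Q X)) (Q X) (join X) (Q_map X (Q X) (\<eta> X))) (\<eta> X) =
        Comp C X (Q X) (Q X) (Comp C (Q X) (Q (Q X)) (Q X) (join X) (\<eta> (Q X))) (\<eta> X)"
      by (simp add: Comp_assoc Q_map_unit)
    then show "Comp C X (Q X) (Q X) (Comp C (Q X) (Q (Q X)) (Q X) (join X) (Q_map X (Q X) (\<eta> X))) (\<eta> X) =
        Comp C X (Q X) (Q X) (Ident C (Q X)) (\<eta> X)"
      by (simp add: join_def free_Ob)
  qed (simp_all add: free_Ob flow_Hom_iff)
  moreover have "Comp C (Q X) (Q (Q X)) (Q X) (join X) (\<eta> (Q X)) = Ident C (Q X)" if "X \<in> Ob C" for X
    using that by (simp add: join_def free_Ob)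
  \<comment> \<open>Associativity is naturality of the counit at \<open>join X\<close>, which is
    itself an equivariant map.\<close>
  moreover have "Comp C (Q (Q (Q X))) (Q (Q X)) (Q X) (join X) (join (Q X)) =
      Comp C (Q (Q (Q X))) (Q (Q X)) (Q X) (join X) (Q_map (Q (Q X)) (Q X) (join X))"
    if X: "X \<in> Ob C" for X
    using counit_natural[OF free_Ob[of "Q X"] free_Ob[of X] counit_in_D[OF free_Ob[of X]]] X
    unfolding join_def by simp
  ultimately show ?thesis
    unfolding monad_def Let_def T_simps by (intro conjI ballI unit join is_functor_T)
qed

section \<open>The comparison functor and its inverse\<close>

definition K where "K = \<lparr>on_ob = (\<lambda>(X, \<alpha>). (X, counit X \<alpha>)), on_hom = (\<lambda>X Y f. f)\<rparr>"

definition action where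
  "action X h = (\<lambda>s\<in>carrier M. Comp C X (Q X) X h (Comp C X (Q X) (Q X) (\<gamma> X s) (\<eta> X)))"

definition L where "L = \<lparr>on_ob = (\<lambda>(X, h). (X, action X h)), on_hom = (\<lambda>X Y f. f)\<rparr>"

abbreviation E where "E \<equiv> EM_category C T \<eta> join"

text \<open>The associativity law of the algebra is naturality of the counit at the counit, regarded
  as an equivariant map from the free flow.\<close>

lemma K_Ob:
  assumes X: "(X, \<alpha>) \<in> Ob D"
  shows "(X, counit X \<alpha>) \<in> Ob E"
proof -
  have "X \<in> Ob C" using X by (simp add: flow_Ob_iff)
  from counit_natural[OF free_Ob[OF this] X counit_in_D[OF X]] this show ?thesis
    by (simp add: EM_Ob_iff join_def X)
qed

lemma is_functor_K: "is_functor D E K"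
proof -
  have "f \<in> Hom E (X, counit X \<alpha>) (Y, counit Y \<beta>)"
    if "(X, \<alpha>) \<in> Ob D" "(Y, \<beta>) \<in> Ob D" "f \<in> Hom D (X, \<alpha>) (Y, \<beta>)" for X \<alpha> Y \<beta> f
    using counit_natural[OF that] that(3) by (simp add: EM_Hom_iff flow_Hom_iff)
  then show ?thesis
    unfolding is_functor_def Ball_def split_paired_All K_def
    using category_flow_category[of M F] category_EM_category[OF is_functor_T, of \<eta> join] K_Ob
    by simp
qed

context
  fixes X h
  assumes alg: "(X, h) \<in> Ob E"
begin

lemma alg_simps [simp]: "X \<in> Ob C" "h \<in> Hom C (Q X) X" "Comp C X (Q X) X h (\<eta> X) = Ident C X"
  using alg by (auto simp: EM_Ob_iff)

lemma action_in [simp]: "s \<in> carrier M \<Longrightarrow> action X h s \<in> Hom C X X"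
  by (simp add: action_def)

text \<open>Naturality rewrites \<eta> after h as \<open>Q_map (Q X) X h\<close> after
  \<open>\<eta> (Q X)\<close>. Equivariance of that map moves s to the free flow on
  \<open>Q X\<close>, and the algebra law replaces its composite with h by h after
  \<open>join X\<close>. Since \<open>join X\<close> is equivariant and left inverse to
  \<open>\<eta> (Q X)\<close>, what remains inside collapses to the action of s.\<close>

lemma algebra_equivariant:
  assumes [simp]: "s \<in> carrier M"
  shows "Comp C (Q X) X X (action X h s) h = Comp C (Q X) (Q X) X h (\<gamma> X s)"
proof -
  have "Comp C (Q X) X X (action X h s) h = Comp C (Q X) (Q X) X h
      (Comp C (Q X) (Q X) (Q X) (\<gamma> X s) (Comp C (Q X) X (Q X) (\<eta> X) h))"
    by (simp add: action_def Comp_assoc)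
  also have "Comp C (Q X) X (Q X) (\<eta> X) h = Comp C (Q X) (Q (Q X)) (Q X) (Q_map (Q X) X h) (\<eta> (Q X))"
    by (simp add: Q_map_unit)
  also have "Comp C (Q X) (Q X) (Q X) (\<gamma> X s) \<dots> =
      Comp C (Q X) (Q (Q X)) (Q X) (Comp C (Q (Q X)) (Q X) (Q X) (\<gamma> X s) (Q_map (Q X) X h)) (\<eta> (Q X))"
    by (simp add: Comp_assoc)
  also have "\<dots> = Comp C (Q X) (Q (Q X)) (Q X) (Comp C (Q (Q X)) (Q (Q X)) (Q X)
      (Q_map (Q X) X h) (\<gamma> (Q X) s)) (\<eta> (Q X))"
    using Q_map_in_D[of h "Q X" X] by (simp add: flow_Hom_iff)
  also have "Comp C (Q X) (Q X) X h \<dots> = Comp C (Q X) (Q (Q X)) X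
      (Comp C (Q (Q X)) (Q X) X h (Q_map (Q X) X h))
      (Comp C (Q X) (Q (Q X)) (Q (Q X)) (\<gamma> (Q X) s) (\<eta> (Q X)))"
    by (simp add: Comp_assoc)
  also have "Comp C (Q (Q X)) (Q X) X h (Q_map (Q X) X h) = Comp C (Q (Q X)) (Q X) X h (join X)"
    using alg by (simp add: EM_Ob_iff)
  also have "Comp C (Q X) (Q (Q X)) X (Comp C (Q (Q X)) (Q X) X h (join X))
      (Comp C (Q X) (Q (Q X)) (Q (Q X)) (\<gamma> (Q X) s) (\<eta> (Q X))) =
      Comp C (Q X) (Q X) X h (Comp C (Q X) (Q (Q X)) (Q X)
        (Comp C (Q (Q X)) (Q (Q X)) (Q X) (join X) (\<gamma> (Q X) s)) (\<eta> (Q X)))"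
    by (simp add: Comp_assoc)
  also have "Comp C (Q (Q X)) (Q (Q X)) (Q X) (join X) (\<gamma> (Q X) s) =
      Comp C (Q (Q X)) (Q X) (Q X) (\<gamma> X s) (join X)"
    using counit_in_D[OF free_Ob, of X] by (simp add: flow_Hom_iff join_def)
  also have "Comp C (Q X) (Q (Q X)) (Q X) \<dots> (\<eta> (Q X)) = \<gamma> X s"
    by (simp add: Comp_assoc) (simp add: join_def free_Ob)
  finally show ?thesis .
qed

lemma action_Ob: "(X, action X h) \<in> Ob D"
proof -
  have "action X h (s \<otimes>\<^bsub>M\<^esub> t) = Comp C X X X (action X h s) (action X h t)"
    if [simp]: "s \<in> carrier M" "t \<in> carrier M" for s t
  proof -
    have [simp]: "s \<otimes>\<^bsub>M\<^esub> t \<in> carrier M"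
      using monoid_M by (simp add: monoid.m_closed)
    \<comment> \<open>By \<open>algebra_equivariant\<close> the outer action moves inside h, where
      it meets the action of t on the free flow and multiplicativity of \<open>\<gamma> X\<close>
      applies.\<close>
    have "Comp C X X X (action X h s) (action X h t) =
      Comp C X (Q X) X (Comp C (Q X) X X (action X h s) h) (Comp C X (Q X) (Q X) (\<gamma> X t) (\<eta> X))"
      by (simp add: Comp_assoc) (simp add: action_def)
    also have "\<dots> = Comp C X (Q X) X h
        (Comp C X (Q X) (Q X) (Comp C (Q X) (Q X) (Q X) (\<gamma> X s) (\<gamma> X t)) (\<eta> X))"
      by (simp add: algebra_equivariant) (simp add: Comp_assoc)
    also have "\<dots> = action X h (s \<otimes>\<^bsub>M\<^esub> t)"
      using free_Ob[of X] by (simp add: action_def flow_Ob_iff)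
    finally show ?thesis by simp
  qed
  moreover have "action X h \<one>\<^bsub>M\<^esub> = Ident C X"
    using free_Ob[of X] monoid_M by (simp add: action_def flow_Ob_iff monoid.one_closed)
  moreover have "F X (action X h)"
    unfolding action_def by (rule retract) (simp_all add: free_Ob)
  ultimately show ?thesis
    by (simp add: flow_Ob_iff) (simp add: action_def)
qed

text \<open>By \<open>algebra_equivariant\<close>, h is an equivariant map from the free flow, and
  the unit law says that it restricts to the identity along \<eta>. The counit is the only such
  map.\<close>

lemma counit_action: "counit X (action X h) = h"
  by (rule flow_map_eqI[of X X "action X h"])
    (simp_all add: action_Ob counit_in_D, simp add: flow_Hom_iff algebra_equivariant)

end

text \<open>Equivariance of the counit moves s outside, where the counit cancels \<eta>. Flows are
  extensional in the monoid variable, so the equation also holds off the carrier.\<close>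

lemma action_counit:
  assumes "(X, \<alpha>) \<in> Ob D"
  shows "action X (counit X \<alpha>) = \<alpha>"
proof
  fix s
  have X [simp]: "X \<in> Ob C" "counit X \<alpha> \<in> Hom C (Q X) X"
    using assms by (auto simp: flow_Ob_iff)
  show "action X (counit X \<alpha>) s = \<alpha> s"
  proof (cases "s \<in> carrier M")
    case True
    then have [simp]: "\<alpha> s \<in> Hom C X X" "\<gamma> X s \<in> Hom C (Q X) (Q X)"
      using assms by (auto simp: flow_Ob_iff)
    have "action X (counit X \<alpha>) s =
        Comp C X (Q X) X (Comp C (Q X) (Q X) X (counit X \<alpha>) (\<gamma> X s)) (\<eta> X)"
      using True by (simp add: action_def Comp_assoc)
    also have "\<dots> = Comp C X (Q X) X (Comp C (Q X) X X (\<alpha> s) (counit X \<alpha>)) (\<eta> X)"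
      using counit_in_D[OF assms] True by (simp add: flow_Hom_iff)
    also have "\<dots> = \<alpha> s"
      by (simp add: Comp_assoc assms)
    finally show ?thesis .
  next
    case False
    then show ?thesis
      using assms by (simp add: action_def flow_Ob_iff extensional_def)
  qed
qed

lemma is_functor_L: "is_functor E D L"
proof -
  have "f \<in> Hom D (X, action X h) (Y, action Y k)"
    if X: "(X, h) \<in> Ob E" and Y: "(Y, k) \<in> Ob E" and f: "f \<in> Hom E (X, h) (Y, k)" for X h Y k f
  proof -
    note [simp] = alg_simps[OF X] alg_simps[OF Y]
    have [simp]: "f \<in> Hom C X Y" using f by (simp add: EM_Hom_iff)
    have "Comp C X X Y f (action X h s) = Comp C X Y Y (action Y k s) f"
      if [simp]: "s \<in> carrier M" for s
    proof -
      \<comment> \<open>The square of an algebra morphism trades h for k, then equivariance of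
        \<open>Q_map X Y f\<close> moves s across, and naturality of \<eta> returns f to the right
        end.\<close>
      have "Comp C X X Y f (action X h s) =
          Comp C X (Q X) Y (Comp C (Q X) X Y f h) (Comp C X (Q X) (Q X) (\<gamma> X s) (\<eta> X))"
        by (simp add: action_def Comp_assoc)
      also have "Comp C (Q X) X Y f h = Comp C (Q X) (Q Y) Y k (Q_map X Y f)"
        using f by (simp add: EM_Hom_iff)
      also have "Comp C X (Q X) Y \<dots> (Comp C X (Q X) (Q X) (\<gamma> X s) (\<eta> X)) =
          Comp C X (Q Y) Y k (Comp C X (Q X) (Q Y)
            (Comp C (Q X) (Q X) (Q Y) (Q_map X Y f) (\<gamma> X s)) (\<eta> X))"
        by (simp add: Comp_assoc)
      also have "Comp C (Q X) (Q X) (Q Y) (Q_map X Y f) (\<gamma> X s) =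
          Comp C (Q X) (Q Y) (Q Y) (\<gamma> Y s) (Q_map X Y f)"
        using Q_map_in_D[of f X Y] by (simp add: flow_Hom_iff)
      also have "Comp C X (Q X) (Q Y) \<dots> (\<eta> X) =
          Comp C X Y (Q Y) (Comp C Y (Q Y) (Q Y) (\<gamma> Y s) (\<eta> Y)) f"
        by (simp add: Comp_assoc Q_map_unit)
      also have "Comp C X (Q Y) Y k \<dots> = Comp C X Y Y (action Y k s) f"
        by (simp add: action_def Comp_assoc)
      finally show ?thesis .
    qed
    then show ?thesis by (simp add: flow_Hom_iff)
  qed
  then show ?thesis
    unfolding is_functor_def Ball_def split_paired_All L_def
    using category_flow_category[of M F] category_EM_category[OF is_functor_T, of \<eta> join] action_Ob
    by simp
qed

theorem monadic_forgetful: "monadic D C forgetful"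
proof -
  interpret D: abstract_category D
    by unfold_locales (rule category_flow_category)
  interpret E: abstract_category E
    by unfold_locales (rule category_EM_category[OF is_functor_T])
  have "natural_isomorphism D D (comp_ftr L K) id_ftr (\<lambda>X. Ident D (on_ob (id_ftr :: (_, 'a, _, 'a) ftr) X))"
    by (rule D.natural_isomorphism_Ident)
      (rule is_functor_comp_ftr[OF is_functor_K is_functor_L], rule is_functor_id_ftr[OF D.category],
        auto simp: comp_ftr_def K_def L_def id_ftr_def action_counit)
  moreover have "natural_isomorphism E E (comp_ftr K L) id_ftr (\<lambda>X. Ident E (on_ob (id_ftr :: (_, 'a, _, 'a) ftr) X))"
    by (rule E.natural_isomorphism_Ident)
      (rule is_functor_comp_ftr[OF is_functor_L is_functor_K], rule is_functor_id_ftr[OF E.category],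
        auto simp: comp_ftr_def K_def L_def id_ftr_def counit_action)
  ultimately have equivalence: "equivalence D E K"
    unfolding equivalence_def using is_functor_K is_functor_L by (intro conjI exI)
  have forgetful: "natural_isomorphism D C (comp_ftr forgetful K) forgetful
      (\<lambda>X. Ident C (on_ob (forgetful :: (_, 'a, _, 'a) ftr) X))"
  proof (rule natural_isomorphism_Ident)
    show "is_functor D C (comp_ftr forgetful K)"
      using is_functor_K is_functor_forgetful_EM[OF is_functor_T] by (rule is_functor_comp_ftr)
    show "is_functor D C forgetful" by (rule is_functor_forgetful_flow)
  qed (auto simp: comp_ftr_def forgetful_def K_def)
  show ?thesis
    unfolding monadic_def
  proof (intro conjI exI)
    show "is_functor D C forgetful" by (rule is_functor_forgetful_flow)
    show "monad C T \<eta> join" by (rule monad_T)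
    show "equivalence D E K" by (rule equivalence)
    show "natural_isomorphism D C (comp_ftr forgetful K) forgetful
      (\<lambda>X. Ident C (on_ob (forgetful :: (_, 'a, _, 'a) ftr) X))" by (rule forgetful)
  qed
qed

end

text \<open>Passes from bare existence of free flows, which is what the constructions below deliver,
  to the functions required by \<open>free_flows\<close>.\<close>

lemma (in abstract_category) monadic_flow_category:
  assumes M: "Group.monoid M"
    and free: "\<And>X. X \<in> Ob C \<Longrightarrow> \<exists>Q \<gamma> \<eta>. (Q, \<gamma>) \<in> Ob (flow_category C M F) \<and> \<eta> \<in> Hom C X Q \<and>
      (\<forall>Y \<beta> f. (Y, \<beta>) \<in> Ob (flow_category C M F) \<longrightarrow> f \<in> Hom C X Y \<longrightarrow>
        (\<exists>!g. g \<in> Hom (flow_category C M F) (Q, \<gamma>) (Y, \<beta>) \<and> Comp C X Q Y g \<eta> = f))"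
    and retract: "\<And>X Y \<beta> i r. \<lbrakk>X \<in> Ob C; (Y, \<beta>) \<in> Ob (flow_category C M F); i \<in> Hom C X Y; r \<in> Hom C Y X;
      Comp C X Y X r i = Ident C X\<rbrakk> \<Longrightarrow>
      F X (\<lambda>s\<in>carrier M. Comp C X Y X r (Comp C X Y Y (\<beta> s) i))"
  shows "monadic (flow_category C M F) C forgetful"
proof -
  let ?R = "\<lambda>X (Q, \<gamma>, \<eta>). (Q, \<gamma>) \<in> Ob (flow_category C M F) \<and> \<eta> \<in> Hom C X Q \<and>
      (\<forall>Y \<beta> f. (Y, \<beta>) \<in> Ob (flow_category C M F) \<longrightarrow> f \<in> Hom C X Y \<longrightarrow>
        (\<exists>!g. g \<in> Hom (flow_category C M F) (Q, \<gamma>) (Y, \<beta>) \<and> Comp C X Q Y g \<eta> = f))"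
  \<comment> \<open>Object, action and unit are chosen as one triple, so that the universal property
    holds for the three together.\<close>
  define A where "A X = (SOME q. ?R X q)" for X
  have A: "?R X (A X)" if X: "X \<in> Ob C" for X
  proof -
    have "\<exists>q. ?R X q"
      using free[OF X] by simp
    then show ?thesis
      unfolding A_def by (rule someI_ex)
  qed
  have "free_flows C M F (fst \<circ> A) (fst \<circ> snd \<circ> A) (snd \<circ> snd \<circ> A)"
  proof (intro free_flows.intro free_flows_axioms.intro)
    fix X assume X: "X \<in> Ob C"
    note AX = A[OF X, unfolded case_prod_unfold prod.collapse]
    show "((fst \<circ> A) X, (fst \<circ> snd \<circ> A) X) \<in> Ob (flow_category C M F)"
      and "(snd \<circ> snd \<circ> A) X \<in> Hom C X ((fst \<circ> A) X)"
      using AX by auto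
    show "\<exists>!g. g \<in> Hom (flow_category C M F) ((fst \<circ> A) X, (fst \<circ> snd \<circ> A) X) (Y, \<beta>) \<and>
        Comp C X ((fst \<circ> A) X) Y g ((snd \<circ> snd \<circ> A) X) = f"
      if "(Y, \<beta>) \<in> Ob (flow_category C M F)" "f \<in> Hom C X Y" for Y \<beta> f
      using AX that by simp
  qed (fact abstract_category_axioms M retract)+
  then show ?thesis
    by (rule free_flows.monadic_forgetful)
qed

section \<open>Free flows inside products\<close>

text \<open>By \<open>mor_cong\<close> a morphism may be replaced by its extensional restriction.
  The condition in \<open>mor_id\<close> is there for uniform spaces: the identity is uniformly
  continuous once the entourages obey the axioms, which \<open>P\<close> will include.\<close>

locale concrete =
  fixes U :: "'o \<Rightarrow> 'u set" and mor :: "'o \<Rightarrow> 'o \<Rightarrow> ('u \<Rightarrow> 'u) \<Rightarrow> bool" and P :: "'o \<Rightarrow> bool"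
  assumes mor_funcset: "mor X Y f \<Longrightarrow> f \<in> U X \<rightarrow> U Y"
    and mor_cong: "\<lbrakk>mor X Y f; \<And>x. x \<in> U X \<Longrightarrow> f x = g x\<rbrakk> \<Longrightarrow> mor X Y g"
    and mor_id: "P X \<Longrightarrow> mor X X (\<lambda>x. x)"
    and mor_comp: "\<lbrakk>mor X Y f; mor Y Z g\<rbrakk> \<Longrightarrow> mor X Z (\<lambda>x. g (f x))"
begin

abbreviation C where "C \<equiv> concrete_category U mor P"

lemma concrete_simps [simp]:
  "X \<in> Ob C \<longleftrightarrow> U X \<prec> (UNIV :: 'u set) \<and> P X"
  "f \<in> Hom C X Y \<longleftrightarrow> f \<in> extensional (U X) \<and> mor X Y f"
  "Ident C X = (\<lambda>x\<in>U X. x)"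
  "Comp C X Y Z g f = compose (U X) g f"
  by (simp_all add: concrete_category_def)

lemma mor_in: "\<lbrakk>mor X Y f; x \<in> U X\<rbrakk> \<Longrightarrow> f x \<in> U Y"
  using mor_funcset by blast

lemma mor_compose: "\<lbrakk>mor X Y f; mor Y Z g\<rbrakk> \<Longrightarrow> mor X Z (compose (U X) g f)"
  by (rule mor_cong[of X Z "\<lambda>x. g (f x)"]) (auto simp: compose_def intro: mor_comp)

lemma category_concrete: "category C"
proof -
  have "compose (U X) f (\<lambda>x\<in>U X. x) = f" if "f \<in> extensional (U X)" for X f
    using that by (auto simp: fun_eq_iff compose_def extensional_def)
  then show ?thesis
    unfolding category_def
    by (auto simp: mor_compose compose_assoc[symmetric] mor_funcset Id_compose intro: mor_cong[OF mor_id])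
qed

end

sublocale concrete \<subseteq> abstract_category C
  by unfold_locales (rule category_concrete)

locale concrete_flows = concrete U mor P
  for U :: "'o \<Rightarrow> 'u set" and mor P +
  fixes M :: "('m, 'r) monoid_scheme" and F :: "'o \<Rightarrow> ('m \<Rightarrow> 'u \<Rightarrow> 'u) \<Rightarrow> bool"
  assumes M: "Group.monoid M"
begin

abbreviation D where "D \<equiv> flow_category C M F"

lemma one_in [simp]: "\<one>\<^bsub>M\<^esub> \<in> carrier M" and mult_in [simp]:
  "\<lbrakk>s \<in> carrier M; t \<in> carrier M\<rbrakk> \<Longrightarrow> s \<otimes>\<^bsub>M\<^esub> t \<in> carrier M"
  using M by (auto simp: monoid.one_closed monoid.m_closed)

lemma flow_mor: "\<lbrakk>(X, \<alpha>) \<in> Ob D; s \<in> carrier M\<rbrakk> \<Longrightarrow> mor X X (\<alpha> s)"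
  by (simp add: flow_Ob_iff)

lemma flow_one: "\<lbrakk>(X, \<alpha>) \<in> Ob D; x \<in> U X\<rbrakk> \<Longrightarrow> \<alpha> \<one>\<^bsub>M\<^esub> x = x"
  by (simp add: flow_Ob_iff)

lemma flow_mult:
  "\<lbrakk>(X, \<alpha>) \<in> Ob D; s \<in> carrier M; t \<in> carrier M; x \<in> U X\<rbrakk> \<Longrightarrow> \<alpha> (s \<otimes>\<^bsub>M\<^esub> t) x = \<alpha> s (\<alpha> t x)"
  by (simp add: flow_Ob_iff compose_eq)

text \<open>The free flow on \<open>X\<close> sits in the product of all flows \<open>Y\<close>, one copy of \<open>Y\<close> for each
  morphism \<open>X \<rightarrow> Y\<close>. This product is too large for \<^const>\<open>Ob\<close>, but no solution set has to be
  chosen since only a small part of it is used.\<close>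

definition arrows :: "'o \<Rightarrow> (('o \<times> ('m \<Rightarrow> 'u \<Rightarrow> 'u)) \<times> ('u \<Rightarrow> 'u)) set" where
  "arrows X = {((Y, \<beta>), f) |Y \<beta> f. (Y, \<beta>) \<in> Ob D \<and> f \<in> Hom C X Y}"

abbreviation target :: "('o \<times> ('m \<Rightarrow> 'u \<Rightarrow> 'u)) \<times> ('u \<Rightarrow> 'u) \<Rightarrow> 'o" where
  "target i \<equiv> fst (fst i)"

text \<open>For an index \<open>((Y, \<beta>), f)\<close> the term \<open>snd (fst i)\<close> is
  \<beta>, so this is the coordinatewise action on the product.\<close>

definition act where "act X s q = (\<lambda>i\<in>arrows X. snd (fst i) s (q i))"

text \<open>The restricted function is the image of x under the canonical map to the product: its
  coordinate at an arrow is the value of that arrow at x.\<close>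

definition orbit_point where "orbit_point X s x = act X s (\<lambda>i\<in>arrows X. snd i x)"

definition orbits where "orbits X = (\<lambda>(s, x). orbit_point X s x) ` (carrier M \<times> U X)"

lemma arrows_flow: "i \<in> arrows X \<Longrightarrow> (target i, snd (fst i)) \<in> Ob D"
  and arrows_mor: "i \<in> arrows X \<Longrightarrow> mor X (target i) (snd i)"
  and arrows_P: "i \<in> arrows X \<Longrightarrow> P (target i)"
  and arrows_F: "i \<in> arrows X \<Longrightarrow> F (target i) (snd (fst i))"
  by (auto simp: arrows_def flow_Ob_iff)

lemma orbits_subset: "orbits X \<subseteq> (\<Pi>\<^sub>E i\<in>arrows X. U (target i))"
proof -
  have "snd (fst i) s (snd i x) \<in> U (target i)"
    if "s \<in> carrier M" "x \<in> U X" "i \<in> arrows X" for s x i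
    using that by (meson mor_in flow_mor arrows_flow arrows_mor)
  then show ?thesis
    by (auto simp: orbits_def orbit_point_def act_def)
qed

lemma act_act:
  assumes "s \<in> carrier M" "t \<in> carrier M" "\<And>i. i \<in> arrows X \<Longrightarrow> q i \<in> U (target i)"
  shows "act X s (act X t q) = act X (s \<otimes>\<^bsub>M\<^esub> t) q"
  unfolding act_def by (rule restrict_ext) (simp add: assms flow_mult[OF arrows_flow])

lemma act_orbit_point:
  "\<lbrakk>s \<in> carrier M; t \<in> carrier M; x \<in> U X\<rbrakk> \<Longrightarrow>
    act X s (orbit_point X t x) = orbit_point X (s \<otimes>\<^bsub>M\<^esub> t) x"
  by (simp add: orbit_point_def act_act mor_in[OF arrows_mor])

lemma act_orbits:
  assumes "s \<in> carrier M" "q \<in> orbits X"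
  shows "act X s q \<in> orbits X"
proof -
  obtain t x where t: "t \<in> carrier M" "x \<in> U X" "q = orbit_point X t x"
    using assms(2) by (auto simp: orbits_def)
  have "act X s q = orbit_point X (s \<otimes>\<^bsub>M\<^esub> t) x"
    using assms(1) t by (simp add: act_orbit_point)
  then show ?thesis
    using assms(1) t by (auto simp: orbits_def)
qed

lemma orbits_lepoll: "orbits X \<lesssim> carrier M \<times> U X"
  unfolding orbits_def by (rule image_lepoll)

text \<open>Q is a copy, inside \<open>'u\<close>, of the set Q0 of functions. The assumptions
  \<open>proj\<close> and \<open>into\<close> say that it carries the initial structure for the
  coordinates, and \<open>dense\<close> supplies uniqueness. The assumption
  \<open>constraint\<close> ranges over every \<gamma> that h intertwines with \<open>act\<close>,
  because the action itself is only constructed inside the proof.\<close>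

lemma universal_flow:
  assumes X: "X \<in> Ob C" and Q: "Q \<in> Ob C"
    and h: "bij_betw h (U Q) Q0" and Q0: "orbits X \<subseteq> Q0" "Q0 \<subseteq> extensional (arrows X)"
    and act: "\<And>s q. \<lbrakk>s \<in> carrier M; q \<in> Q0\<rbrakk> \<Longrightarrow> act X s q \<in> Q0"
    and proj: "\<And>i. i \<in> arrows X \<Longrightarrow> mor Q (target i) (\<lambda>u. h u i)"
    and into: "\<And>Z g. \<lbrakk>Z \<in> Ob C; g \<in> U Z \<rightarrow> U Q;
      \<And>i. i \<in> arrows X \<Longrightarrow> mor Z (target i) (\<lambda>z. h (g z) i)\<rbrakk> \<Longrightarrow> mor Z Q g"
    and constraint: "\<And>\<gamma>. (\<And>s u. \<lbrakk>s \<in> carrier M; u \<in> U Q\<rbrakk> \<Longrightarrow> \<gamma> s u \<in> U Q \<and> h (\<gamma> s u) = act X s (h u)) \<Longrightarrow>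
      F Q \<gamma>"
    and dense: "\<And>Y g g' u. \<lbrakk>Y \<in> Ob C; mor Q Y g; mor Q Y g';
      \<And>u. \<lbrakk>u \<in> U Q; h u \<in> orbits X\<rbrakk> \<Longrightarrow> g u = g' u; u \<in> U Q\<rbrakk> \<Longrightarrow> g u = g' u"
  shows "\<exists>Q \<gamma> \<eta>. (Q, \<gamma>) \<in> Ob D \<and> \<eta> \<in> Hom C X Q \<and>
      (\<forall>Y \<beta> f. (Y, \<beta>) \<in> Ob D \<longrightarrow> f \<in> Hom C X Y \<longrightarrow>
        (\<exists>!g. g \<in> Hom D (Q, \<gamma>) (Y, \<beta>) \<and> Comp C X Q Y g \<eta> = f))"
proof -
  define k where "k = inv_into (U Q) h"
  have k: "k q \<in> U Q" "h (k q) = q" if "q \<in> Q0" for q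
    using h that unfolding k_def
    by (metis bij_betw_imp_surj_on inv_into_into, metis bij_betw_inv_into_right)
  have h_in: "h u \<in> Q0" if "u \<in> U Q" for u
    using h that by (rule bij_betw_apply)
  have h_inj: "u = v" if "h u = h v" "u \<in> U Q" "v \<in> U Q" for u v
    using h that by (auto simp: bij_betw_def inj_on_def)
  have h_proj: "h u i \<in> U (target i)" if "u \<in> U Q" "i \<in> arrows X" for u i
    using mor_in[OF proj] that by blast
  have orbit_in: "orbit_point X s x \<in> Q0" if "s \<in> carrier M" "x \<in> U X" for s x
    using Q0(1) that by (auto simp: orbits_def)
  define \<gamma> where "\<gamma> = (\<lambda>s\<in>carrier M. \<lambda>u\<in>U Q. k (act X s (h u)))"
  \<comment> \<open>Writing the image of x as the orbit point at the unit makes membership in Q0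
    evident; its coordinates are the values of the arrows at x because flows are unital.\<close>
  define \<eta> where "\<eta> = (\<lambda>x\<in>U X. k (orbit_point X \<one>\<^bsub>M\<^esub> x))"
  have \<gamma>: "\<gamma> s u \<in> U Q" "h (\<gamma> s u) = act X s (h u)" if "s \<in> carrier M" "u \<in> U Q" for s u
    using that k[OF act[OF _ h_in]] by (auto simp: \<gamma>_def)
  have \<eta>: "\<eta> x \<in> U Q" "h (\<eta> x) = orbit_point X \<one>\<^bsub>M\<^esub> x" if "x \<in> U X" for x
    using that k[OF orbit_in] by (auto simp: \<eta>_def)
  have \<gamma>_mor: "mor Q Q (\<gamma> s)" if s: "s \<in> carrier M" for s
  proof (rule into[OF Q])
    show "\<gamma> s \<in> U Q \<rightarrow> U Q" using \<gamma> s by auto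
    show "mor Q (target i) (\<lambda>z. h (\<gamma> s z) i)" if i: "i \<in> arrows X" for i
      by (rule mor_cong[OF mor_comp[OF proj[OF i] flow_mor[OF arrows_flow[OF i] s]]])
        (simp add: \<gamma> s act_def i)
  qed
  have \<gamma>_mult: "\<gamma> (s \<otimes>\<^bsub>M\<^esub> t) u = \<gamma> s (\<gamma> t u)"
    if s: "s \<in> carrier M" "t \<in> carrier M" and u: "u \<in> U Q" for s t u
  proof (rule h_inj)
    show "h (\<gamma> (s \<otimes>\<^bsub>M\<^esub> t) u) = h (\<gamma> s (\<gamma> t u))"
      using s u by (simp add: \<gamma> act_act h_proj)
  qed (use s u \<gamma> in auto)
  have \<gamma>_one: "\<gamma> \<one>\<^bsub>M\<^esub> u = u" if u: "u \<in> U Q" for u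
  proof (rule h_inj)
    show "h (\<gamma> \<one>\<^bsub>M\<^esub> u) = h u"
      using h_in[OF u] Q0 u
      by (intro extensionalityI[of _ "arrows X"])
        (auto simp del: split_paired_all simp: \<gamma> act_def flow_one[OF arrows_flow] h_proj)
  qed (use u \<gamma> in auto)
  have "compose (U Q) (\<gamma> s) (\<gamma> t) = \<gamma> (s \<otimes>\<^bsub>M\<^esub> t)" if "s \<in> carrier M" "t \<in> carrier M" for s t
    using that by (auto simp: fun_eq_iff compose_def \<gamma>_mult[symmetric] restrict_def) (auto simp: \<gamma>_def)
  moreover have "\<gamma> \<one>\<^bsub>M\<^esub> = (\<lambda>u\<in>U Q. u)"
    by (auto simp: fun_eq_iff \<gamma>_one restrict_def) (auto simp: \<gamma>_def)
  moreover have "\<gamma> s \<in> extensional (U Q)" if "s \<in> carrier M" for s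
    using that by (simp add: \<gamma>_def)
  moreover have "\<gamma> \<in> extensional (carrier M)"
    by (simp add: \<gamma>_def)
  ultimately have Q\<gamma>: "(Q, \<gamma>) \<in> Ob D"
    unfolding flow_Ob_iff using Q \<gamma>_mor constraint \<gamma> by auto
  have \<eta>_mor: "mor X Q \<eta>"
  proof (rule into[OF X])
    show "\<eta> \<in> U X \<rightarrow> U Q" using \<eta> by auto
    show "mor X (target i) (\<lambda>x. h (\<eta> x) i)" if i: "i \<in> arrows X" for i
      by (rule mor_cong[OF arrows_mor[OF i]])
        (simp add: \<eta> act_def orbit_point_def i flow_one[OF arrows_flow[OF i]] mor_in[OF arrows_mor[OF i]])
  qed
  have universal: "\<exists>!g. g \<in> Hom D (Q, \<gamma>) (Y, \<beta>) \<and> Comp C X Q Y g \<eta> = f"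
    if Y: "(Y, \<beta>) \<in> Ob D" and f: "f \<in> Hom C X Y" for Y \<beta> f
  proof -
    \<comment> \<open>The arrow f, together with its target flow, is one of the indices, and the
      projection to that coordinate is the extension sought.\<close>
    define i where "i = ((Y, \<beta>), f)"
    have i: "i \<in> arrows X" using Y f by (auto simp: i_def arrows_def)
    have i_simps [simp]: "fst i = (Y, \<beta>)" "snd i = f" by (simp_all add: i_def)
    have f_mor: "mor X Y f" using f by simp
    define g where "g = (\<lambda>u\<in>U Q. h u i)"
    have g_mor: "mor Q Y g"
      using proj[OF i] by (auto simp: g_def intro: mor_cong)
    show ?thesis
    proof (rule ex1I[of _ g])
      have "compose (U Q) g (\<gamma> s) = compose (U Q) (\<beta> s) g" if "s \<in> carrier M" for s
        using that i by (auto simp: fun_eq_iff compose_def g_def \<gamma> act_def)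
      moreover have "compose (U X) g \<eta> = f"
      proof
        fix x
        show "compose (U X) g \<eta> x = f x"
          using i f flow_one[OF Y] mor_in[OF f_mor]
          by (cases "x \<in> U X")
            (auto simp: compose_def g_def \<eta> orbit_point_def act_def extensional_def)
      qed
      ultimately show "g \<in> Hom D (Q, \<gamma>) (Y, \<beta>) \<and> Comp C X Q Y g \<eta> = f"
        unfolding flow_Hom_iff using g_mor by (simp add: g_def)
      fix g' assume g': "g' \<in> Hom D (Q, \<gamma>) (Y, \<beta>) \<and> Comp C X Q Y g' \<eta> = f"
      then have g'_ext: "g' \<in> extensional (U Q)" and g'_mor: "mor Q Y g'"
        by (auto simp: flow_Hom_iff)
      \<comment> \<open>Such a u is s applied to \<eta>(x), so equivariance forces the value
        \<beta>(s)(f(x)).\<close>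
      have "g' u = g u" if u: "u \<in> U Q" "h u \<in> orbits X" for u
      proof -
        obtain s x where s: "s \<in> carrier M" and x: "x \<in> U X" and sx: "h u = orbit_point X s x"
          using u(2) by (auto simp: orbits_def)
        have "h u = h (\<gamma> s (\<eta> x))"
          using s x M by (simp add: sx \<gamma> \<eta> act_orbit_point monoid.r_one)
        then have "u = \<gamma> s (\<eta> x)"
          using h_inj u(1) \<gamma> \<eta> s x by blast
        then have "g' u = compose (U Q) g' (\<gamma> s) (\<eta> x)"
          using \<eta>[OF x] by (simp add: compose_def)
        also have "compose (U Q) g' (\<gamma> s) = compose (U Q) (\<beta> s) g'"
          using g' s by (simp add: flow_Hom_iff)
        also have "compose (U Q) (\<beta> s) g' (\<eta> x) = \<beta> s (compose (U X) g' \<eta> x)"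
          using x \<eta>[OF x] by (simp add: compose_def)
        also have "compose (U X) g' \<eta> x = f x"
          using g' by simp
        also have "\<beta> s (f x) = g u"
          using u i x by (simp add: g_def sx orbit_point_def act_def)
        finally show ?thesis .
      qed
      then have "g' u = g u" if "u \<in> U Q" for u
        using dense[OF _ g'_mor g_mor] that Y by (auto simp: flow_Ob_iff)
      then show "g' = g"
        using g'_ext by (intro extensionalityI[of _ "U Q"]) (auto simp: g_def)
    qed
  qed
  have "\<eta> \<in> Hom C X Q"
    using \<eta>_mor by (simp add: \<eta>_def)
  with Q\<gamma> universal show ?thesis by blast
qed

end

section \<open>Cardinalities\<close>

text \<open>If \<open>'u\<close> had n points, deleting one would leave a strictly smaller set whose
  power set has 2^(n-1) >= n elements, against the strict bound in
  \<open>strong_limit\<close>.\<close>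

lemma strong_limit_infinite:
  assumes "strong_limit TYPE('u)"
  shows "infinite (UNIV :: 'u set)"
proof
  assume fin: "finite (UNIV :: 'u set)"
  fix x :: 'u
  let ?n = "card (UNIV :: 'u set)"
  have n: "?n > 0" using fin by (simp add: card_gt_0_iff)
  have "\<not> UNIV - {x} \<approx> (UNIV :: 'u set)"
    using fin by (metis Diff_iff UNIV_I card_subset_eq eqpoll_iff_card finite_subset insertI1 subset_UNIV)
  then have "Pow (UNIV - {x}) \<prec> (UNIV :: 'u set)"
    using assms unfolding strong_limit_def by (simp add: lesspoll_def subset_imp_lepoll)
  then have "2 ^ card (UNIV - {x}) \<le> ?n" "2 ^ card (UNIV - {x}) \<noteq> ?n"
    using fin by (auto simp: lesspoll_def lepoll_iff_card_le eqpoll_iff_card card_Pow)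
  moreover have "card (UNIV - {x}) = ?n - 1"
    using fin by (simp add: card_Diff_singleton)
  ultimately show False
    using n less_exp[of "?n - 1"] by (metis Suc_leI Suc_diff_1 le_antisym)
qed

context
  includes cardinal_syntax
begin

lemma lepoll_linear: "A \<lesssim> B \<or> B \<lesssim> A"
  using ordLeq_total[OF card_of_Well_order card_of_Well_order, of A B]
  unfolding lepoll_def card_of_ordLeq[symmetric] by blast

lemma infinite_Times_lepoll:
  assumes "infinite A" "B \<lesssim> A"
  shows "A \<times> B \<lesssim> A"
proof (cases "B = {}")
  case False
  have "|B| \<le>o |A|"
    using assms(2) unfolding lepoll_def card_of_ordLeq .
  then show ?thesis
    using card_of_Times_infinite[OF assms(1) False] unfolding card_of_ordIso[symmetric]
    using eqpoll_def eqpoll_imp_lepoll by blast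
qed (simp add: lepoll_refl)

end

text \<open>The larger factor absorbs the smaller one if it is infinite; otherwise the product is
  finite.\<close>

lemma Times_lesspoll:
  assumes "infinite C" "A \<prec> C" "B \<prec> C"
  shows "A \<times> B \<prec> C"
proof -
  have *: "A \<times> B \<prec> C" if "B \<lesssim> A" "A \<prec> C" for A :: "'d set" and B :: "'e set"
  proof (cases "finite A")
    case True
    then have "finite B"
      using that(1) by (auto simp: lepoll_def intro: inj_on_finite)
    then have "finite (A \<times> B)"
      using True by simp
    then show ?thesis
      using assms(1) by (rule finite_lesspoll_infinite[rotated])
  next
    case False
    then show ?thesis
      using infinite_Times_lepoll that lesspoll_trans1 by blast
  qed
  show ?thesis
    using lepoll_linear[of A B]
  proof
    assume "A \<lesssim> B"
    then show ?thesis
      using *[of A B] assms times_commute_eqpoll eq_lesspoll_trans by blast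
  qed (use * assms in blast)
qed

text \<open>Free flows arise as sets of functions, whereas objects must have carriers in
  \<open>'u\<close>; this moves a small set of any type into the universe.\<close>

lemma bij_betw_lesspoll_UNIV:
  assumes "Q \<prec> (UNIV :: 'u set)"
  obtains A :: "'u set" and h where "bij_betw h A Q" "A \<prec> (UNIV :: 'u set)"
proof -
  obtain g :: "'a \<Rightarrow> 'u" where g: "inj_on g Q"
    using assms lesspoll_imp_lepoll unfolding lepoll_def by blast
  then have "bij_betw g Q (g ` Q)"
    by (rule inj_on_imp_bij_betw)
  then have "bij_betw (inv_into Q g) (g ` Q) Q" "g ` Q \<lesssim> Q"
    by (auto intro: bij_betw_inv_into image_lepoll)
  then show thesis
    using that assms lesspoll_trans1 by blast
qed

text \<open>The definition of \<open>strong_limit\<close> speaks of subsets of \<open>'u\<close>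
  only. Transport extends it to other types, so that it can be iterated on the double power set of
  the orbits.\<close>

lemma Pow_lesspoll:
  assumes "strong_limit TYPE('u)" "A \<prec> (UNIV :: 'u set)"
  shows "Pow A \<prec> (UNIV :: 'u set)"
proof -
  obtain B :: "'u set" and h where h: "bij_betw h B A" and "B \<prec> (UNIV :: 'u set)"
    using bij_betw_lesspoll_UNIV[OF assms(2)] by blast
  then have "Pow B \<prec> (UNIV :: 'u set)"
    using assms(1) unfolding strong_limit_def by blast
  moreover have "Pow A \<approx> Pow B"
    using bij_betw_Pow[OF h] eqpoll_def eqpoll_sym by blast
  ultimately show ?thesis
    using eq_lesspoll_trans by blast
qed

section \<open>Initial structures\<close>

text \<open>\<open>ini I Y A h\<close> is the initial structure on \<open>A\<close> for the family of maps
  \<open>\<lambda>u. h u i\<close> from \<open>A\<close> to \<open>Y i\<close>.\<close>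

locale initial_flows = concrete_flows U mor P M F
  for U :: "'o \<Rightarrow> 'u set" and mor P and M :: "('m, 'r) monoid_scheme" and F +
  fixes ini :: "(('o \<times> ('m \<Rightarrow> 'u \<Rightarrow> 'u)) \<times> ('u \<Rightarrow> 'u)) set \<Rightarrow>
      ((('o \<times> ('m \<Rightarrow> 'u \<Rightarrow> 'u)) \<times> ('u \<Rightarrow> 'u)) \<Rightarrow> 'o) \<Rightarrow> 'u set \<Rightarrow>
      ('u \<Rightarrow> (('o \<times> ('m \<Rightarrow> 'u \<Rightarrow> 'u)) \<times> ('u \<Rightarrow> 'u)) \<Rightarrow> 'u) \<Rightarrow> 'o"
  assumes U_ini: "\<lbrakk>\<And>i. i \<in> I \<Longrightarrow> P (Y i); h \<in> A \<rightarrow> (\<Pi>\<^sub>E i\<in>I. U (Y i))\<rbrakk> \<Longrightarrow> U (ini I Y A h) = A"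
    and ini_proj: "\<lbrakk>\<And>i. i \<in> I \<Longrightarrow> P (Y i); h \<in> A \<rightarrow> (\<Pi>\<^sub>E i\<in>I. U (Y i)); i \<in> I\<rbrakk> \<Longrightarrow>
      mor (ini I Y A h) (Y i) (\<lambda>u. h u i)"
    and ini_into: "\<lbrakk>\<And>i. i \<in> I \<Longrightarrow> P (Y i); h \<in> A \<rightarrow> (\<Pi>\<^sub>E i\<in>I. U (Y i)); P Z; g \<in> U Z \<rightarrow> A;
      \<And>i. i \<in> I \<Longrightarrow> mor Z (Y i) (\<lambda>z. h (g z) i)\<rbrakk> \<Longrightarrow> mor Z (ini I Y A h) g"
    and F_ini: "\<lbrakk>\<And>i. i \<in> I \<Longrightarrow> P (Y i); h \<in> A \<rightarrow> (\<Pi>\<^sub>E i\<in>I. U (Y i)); \<And>i. i \<in> I \<Longrightarrow> F (Y i) (\<beta> i);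
      \<And>s u. \<lbrakk>s \<in> carrier M; u \<in> A\<rbrakk> \<Longrightarrow> \<gamma> s u \<in> A;
      \<And>s u i. \<lbrakk>s \<in> carrier M; u \<in> A; i \<in> I\<rbrakk> \<Longrightarrow> h (\<gamma> s u) i = \<beta> i s (h u i)\<rbrakk> \<Longrightarrow> F (ini I Y A h) \<gamma>"
    and F_retract: "\<lbrakk>P Z; P W; F W \<delta>; mor Z W j; mor W Z r;
      \<And>s x. \<lbrakk>s \<in> carrier M; x \<in> U Z\<rbrakk> \<Longrightarrow> \<gamma> s x = r (\<delta> s (j x)); \<And>x. x \<in> U Z \<Longrightarrow> r (j x) = x\<rbrakk> \<Longrightarrow> F Z \<gamma>"
begin

text \<open>Density in the categorical sense: morphisms to objects of the category are determined on
  the orbits. It is trivial if there are no other points, and follows from topological density if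
  the targets are Hausdorff.\<close>

definition dense_orbits where
  "dense_orbits X A h \<longleftrightarrow>
    (\<forall>Y g g'. P Y \<longrightarrow> mor (ini (arrows X) target A h) Y g \<longrightarrow> mor (ini (arrows X) target A h) Y g' \<longrightarrow>
      (\<forall>u\<in>A. h u \<in> orbits X \<longrightarrow> g u = g' u) \<longrightarrow> (\<forall>u\<in>A. g u = g' u))"

text \<open>The last clause ranges over all copies of Q0 in \<open>'u\<close>, because the copy is
  selected only in \<open>monadic_flows\<close>, from the cardinality bound.\<close>

definition flow_hull where
  "flow_hull X Q0 \<longleftrightarrow> orbits X \<subseteq> Q0 \<and> Q0 \<subseteq> (\<Pi>\<^sub>E i\<in>arrows X. U (target i)) \<and>
    (\<forall>s\<in>carrier M. \<forall>q\<in>Q0. act X s q \<in> Q0) \<and> Q0 \<prec> (UNIV :: 'u set) \<and>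
    (\<forall>A h. bij_betw h A Q0 \<longrightarrow> P (ini (arrows X) target A h) \<and> dense_orbits X A h)"

theorem monadic_flows:
  assumes hull: "\<And>X. X \<in> Ob C \<Longrightarrow> \<exists>Q0. flow_hull X Q0"
  shows "monadic D C forgetful"
proof (rule monadic_flow_category[OF M])
  fix X assume X: "X \<in> Ob C"
  obtain Q0 where "flow_hull X Q0"
    using hull[OF X] by blast
  then have orb: "orbits X \<subseteq> Q0" and Q0: "Q0 \<subseteq> (\<Pi>\<^sub>E i\<in>arrows X. U (target i))"
    and act: "\<And>s q. \<lbrakk>s \<in> carrier M; q \<in> Q0\<rbrakk> \<Longrightarrow> act X s q \<in> Q0"
    and small: "Q0 \<prec> (UNIV :: 'u set)"
    and P_ini: "\<And>A h. bij_betw h A Q0 \<Longrightarrow> P (ini (arrows X) target A h)"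
    and dense: "\<And>A h. bij_betw h A Q0 \<Longrightarrow> dense_orbits X A h"
    unfolding flow_hull_def by simp_all
  obtain A :: "'u set" and h where h: "bij_betw h A Q0" and A: "A \<prec> (UNIV :: 'u set)"
    using bij_betw_lesspoll_UNIV[OF small] by blast
  note P = arrows_P[of _ X]
  have hA: "h \<in> A \<rightarrow> (\<Pi>\<^sub>E i\<in>arrows X. U (target i))"
    using h Q0 by (auto simp: bij_betw_def)
  let ?Q = "ini (arrows X) target A h"
  have U: "U ?Q = A"
    by (rule U_ini[OF P hA])
  show "\<exists>Q \<gamma> \<eta>. (Q, \<gamma>) \<in> Ob D \<and> \<eta> \<in> Hom C X Q \<and>
      (\<forall>Y \<beta> f. (Y, \<beta>) \<in> Ob D \<longrightarrow> f \<in> Hom C X Y \<longrightarrow>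
        (\<exists>!g. g \<in> Hom D (Q, \<gamma>) (Y, \<beta>) \<and> Comp C X Q Y g \<eta> = f))"
  proof (rule universal_flow[OF X])
    show "?Q \<in> Ob C" using P_ini[OF h] A by (simp add: U)
    show "bij_betw h (U ?Q) Q0" using h by (simp add: U)
    show "orbits X \<subseteq> Q0" by (rule orb)
    show "Q0 \<subseteq> extensional (arrows X)" using Q0 by (auto simp: PiE_def)
    show "act X s q \<in> Q0" if "s \<in> carrier M" "q \<in> Q0" for s q
      using that by (rule act)
    show "mor ?Q (target i) (\<lambda>u. h u i)" if "i \<in> arrows X" for i
      by (rule ini_proj[OF P hA that])
    show "mor Z ?Q g" if "Z \<in> Ob C" "g \<in> U Z \<rightarrow> U ?Q" "\<And>i. i \<in> arrows X \<Longrightarrow> mor Z (target i) (\<lambda>z. h (g z) i)"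
      for Z g
      using that by (intro ini_into[OF P hA]) (simp_all add: U)
    show "F ?Q \<gamma>" if \<gamma>: "\<And>s u. \<lbrakk>s \<in> carrier M; u \<in> U ?Q\<rbrakk> \<Longrightarrow> \<gamma> s u \<in> U ?Q \<and> h (\<gamma> s u) = act X s (h u)"
      for \<gamma>
    proof (rule F_ini[OF P hA arrows_F])
      show "\<gamma> s u \<in> A" if "s \<in> carrier M" "u \<in> A" for s u
        using \<gamma> that by (simp add: U)
      show "h (\<gamma> s u) i = snd (fst i) s (h u i)" if "s \<in> carrier M" "u \<in> A" "i \<in> arrows X" for s u i
        using \<gamma> that by (simp add: U act_def)
    qed
    show "g u = g' u" if "Y \<in> Ob C" "mor ?Q Y g" "mor ?Q Y g'"
      "\<And>u. \<lbrakk>u \<in> U ?Q; h u \<in> orbits X\<rbrakk> \<Longrightarrow> g u = g' u" "u \<in> U ?Q" for Y g g' u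
      using that dense[OF h] unfolding dense_orbits_def U concrete_simps(1) by blast
  qed
next
  fix X Y \<beta> j r
  assume *: "X \<in> Ob C" "(Y, \<beta>) \<in> Ob D" "j \<in> Hom C X Y" "r \<in> Hom C Y X"
    and rj: "Comp C X Y X r j = Ident C X"
  have "r (j x) = x" if "x \<in> U X" for x
    using fun_cong[OF rj, of x] that by (simp add: compose_def)
  moreover have "P X" "P Y" "F Y \<beta>" "mor X Y j" "mor Y X r"
    using * by (simp_all add: flow_Ob_iff)
  ultimately show "F X (\<lambda>s\<in>carrier M. Comp C X Y X r (Comp C X Y Y (\<beta> s) j))"
    by (intro F_retract[of X Y \<beta> j r]) (simp_all add: compose_def)
qed

text \<open>If \<open>P\<close> passes to jointly injective initial structures, the orbits alone
  form a hull: they are invariant, there are at most as many as pairs from M and X, and density is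
  vacuous.\<close>

corollary monadic_flows_hereditary:
  assumes size: "strong_limit TYPE('u)" "carrier M \<prec> (UNIV :: 'u set)"
    and P: "\<And>I Y A h. \<lbrakk>\<And>i. i \<in> I \<Longrightarrow> P (Y i); inj_on h A; h ` A \<subseteq> (\<Pi>\<^sub>E i\<in>I. U (Y i))\<rbrakk> \<Longrightarrow>
      P (ini I Y A h)"
  shows "monadic D C forgetful"
proof (rule monadic_flows, unfold flow_hull_def, intro exI conjI allI impI)
  fix X assume X: "X \<in> Ob C"
  show "orbits X \<subseteq> orbits X" by simp
  show "orbits X \<subseteq> (\<Pi>\<^sub>E i\<in>arrows X. U (target i))" by (rule orbits_subset)
  show "\<forall>s\<in>carrier M. \<forall>q\<in>orbits X. act X s q \<in> orbits X" using act_orbits by blast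
  show "orbits X \<prec> (UNIV :: 'u set)"
    using X size by (auto intro!: lesspoll_trans1[OF orbits_lepoll] Times_lesspoll strong_limit_infinite)
  fix A :: "'u set" and h assume h: "bij_betw h A (orbits X)"
  show "P (ini (arrows X) target A h)"
    by (rule P[OF arrows_P]) (use h orbits_subset in \<open>auto simp: bij_betw_def\<close>)
  show "dense_orbits X A h"
    unfolding dense_orbits_def using bij_betw_apply[OF h] by simp
qed

end

section \<open>Flows on topological spaces\<close>

lemma continuous_map_prod_right:
  "continuous_map X Y f \<Longrightarrow> continuous_map (prod_topology A X) (prod_topology A Y) (\<lambda>(s, x). (s, f x))"
  by (auto simp: continuous_map_pairwise o_def case_prod_unfold continuous_map_fst
      intro: continuous_map_compose[OF continuous_map_snd, unfolded o_def])

lemma concrete_Top: "concrete topspace continuous_map P"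
proof
  show "continuous_map X Y f \<Longrightarrow> f \<in> topspace X \<rightarrow> topspace Y" for X Y :: "'a topology" and f
    by (rule continuous_map_funspace)
  show "continuous_map X Y g" if "continuous_map X Y f" "\<And>x. x \<in> topspace X \<Longrightarrow> f x = g x"
    for X Y :: "'a topology" and f g
    using that by (rule continuous_map_eq)
  show "continuous_map X Z (\<lambda>x. g (f x))" if "continuous_map X Y f" "continuous_map Y Z g"
    for X Y Z :: "'a topology" and f g
    using continuous_map_compose[OF that] by (simp add: o_def)
qed simp

section \<open>Initial topologies\<close>

definition top_ini :: "'i set \<Rightarrow> ('i \<Rightarrow> 'b topology) \<Rightarrow> 'a set \<Rightarrow> ('a \<Rightarrow> 'i \<Rightarrow> 'b) \<Rightarrow> 'a topology" where
  "top_ini I Y A h = pullback_topology A h (product_topology Y I)"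

context
  fixes I :: "'i set" and Y :: "'i \<Rightarrow> 'b topology" and A :: "'a set" and h :: "'a \<Rightarrow> 'i \<Rightarrow> 'b"
  assumes h: "h \<in> A \<rightarrow> (\<Pi>\<^sub>E i\<in>I. topspace (Y i))"
begin

lemma topspace_top_ini: "topspace (top_ini I Y A h) = A"
  using h by (auto simp: top_ini_def topspace_pullback_topology)

lemma continuous_map_top_ini: "continuous_map (top_ini I Y A h) (product_topology Y I) h"
  using continuous_map_pullback[OF continuous_map_id, of A h "product_topology Y I"]
  by (simp add: top_ini_def)

lemma continuous_map_top_ini_proj: "i \<in> I \<Longrightarrow> continuous_map (top_ini I Y A h) (Y i) (\<lambda>u. h u i)"
  using continuous_map_top_ini by (simp add: continuous_map_componentwise)

lemma continuous_map_into_top_ini: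
  assumes "g \<in> topspace Z \<rightarrow> A" "\<And>i. i \<in> I \<Longrightarrow> continuous_map Z (Y i) (\<lambda>z. h (g z) i)"
  shows "continuous_map Z (top_ini I Y A h) g"
  unfolding top_ini_def
proof (rule continuous_map_pullback')
  show "continuous_map Z (product_topology Y I) (h \<circ> g)"
    using assms h by (force simp: continuous_map_componentwise PiE_def)
  show "topspace Z \<subseteq> g -` A"
    using assms(1) by auto
qed

text \<open>For injective h the space is a copy of a subspace of the product, which reduces T0, T1,
  T2, complete regularity and compactness to their behaviour under products and subspaces.\<close>

lemma top_ini_homeomorphic:
  assumes "inj_on h A"
  shows "top_ini I Y A h homeomorphic_space subtopology (product_topology Y I) (h ` A)"
proof -
  have "homeomorphic_maps (top_ini I Y A h) (subtopology (product_topology Y I) (h ` A)) h (inv_into A h)"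
    unfolding homeomorphic_maps_def
  proof (intro conjI)
    have *: "topspace (subtopology (product_topology Y I) (h ` A)) = h ` A"
      using h by auto
    show "continuous_map (top_ini I Y A h) (subtopology (product_topology Y I) (h ` A)) h"
      using continuous_map_top_ini by (simp add: continuous_map_in_subtopology topspace_top_ini)
    show "continuous_map (subtopology (product_topology Y I) (h ` A)) (top_ini I Y A h) (inv_into A h)"
    proof (rule continuous_map_into_top_ini)
      show "inv_into A h \<in> topspace (subtopology (product_topology Y I) (h ` A)) \<rightarrow> A"
        unfolding * by (auto intro: inv_into_into)
      fix i assume "i \<in> I"
      then have "continuous_map (subtopology (product_topology Y I) (h ` A)) (Y i) (\<lambda>q. q i)"
        by (intro continuous_map_from_subtopology continuous_map_product_projection)
      then show "continuous_map (subtopology (product_topology Y I) (h ` A)) (Y i) (\<lambda>q. h (inv_into A h q) i)"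
        by (rule continuous_map_eq) (unfold *, auto simp: f_inv_into_f)
    qed
    show "\<forall>x\<in>topspace (top_ini I Y A h). inv_into A h (h x) = x"
      using assms by (simp add: topspace_top_ini)
    show "\<forall>y\<in>topspace (subtopology (product_topology Y I) (h ` A)). h (inv_into A h y) = y"
      unfolding * by (simp add: f_inv_into_f)
  qed
  then show ?thesis
    unfolding homeomorphic_space_def by blast
qed

lemma t0_space_top_ini: "\<lbrakk>inj_on h A; \<And>i. i \<in> I \<Longrightarrow> t0_space (Y i)\<rbrakk> \<Longrightarrow> t0_space (top_ini I Y A h)"
  unfolding homeomorphic_t0_space[OF top_ini_homeomorphic]
  by (intro t0_space_subtopology) (simp add: t0_space_product_topology)

lemma t1_space_top_ini: "\<lbrakk>inj_on h A; \<And>i. i \<in> I \<Longrightarrow> t1_space (Y i)\<rbrakk> \<Longrightarrow> t1_space (top_ini I Y A h)"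
  unfolding homeomorphic_t1_space[OF top_ini_homeomorphic]
  by (intro t1_space_subtopology) (simp add: t1_space_product_topology)

lemma Hausdorff_space_top_ini:
  "\<lbrakk>inj_on h A; \<And>i. i \<in> I \<Longrightarrow> Hausdorff_space (Y i)\<rbrakk> \<Longrightarrow> Hausdorff_space (top_ini I Y A h)"
  unfolding homeomorphic_Hausdorff_space[OF top_ini_homeomorphic]
  by (intro Hausdorff_space_subtopology) (simp add: Hausdorff_space_product_topology)

lemma completely_regular_space_top_ini:
  "\<lbrakk>inj_on h A; \<And>i. i \<in> I \<Longrightarrow> completely_regular_space (Y i)\<rbrakk> \<Longrightarrow>
    completely_regular_space (top_ini I Y A h)"
  unfolding homeomorphic_completely_regular_space[OF top_ini_homeomorphic]
  by (intro completely_regular_space_subtopology) (simp add: completely_regular_space_product_topology)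

text \<open>Distinct points differ in some coordinate; a real function separating the two values
  there is composed with the coordinate map.\<close>

lemma functionally_Hausdorff_space_top_ini:
  assumes inj: "inj_on h A" and Y: "\<And>i. i \<in> I \<Longrightarrow> functionally_Hausdorff_space (Y i)"
  shows "functionally_Hausdorff_space (top_ini I Y A h)"
  unfolding functionally_Hausdorff_space_def topspace_top_ini
proof (intro ballI impI)
  fix x y assume xy: "x \<in> A" "y \<in> A" "x \<noteq> y"
  then have "h x \<noteq> h y" "h x \<in> (\<Pi>\<^sub>E i\<in>I. topspace (Y i))" "h y \<in> (\<Pi>\<^sub>E i\<in>I. topspace (Y i))"
    using inj h by (auto dest: inj_onD)
  then obtain i where i: "i \<in> I" "h x i \<noteq> h y i" "h x i \<in> topspace (Y i)" "h y i \<in> topspace (Y i)"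
    by (metis PiE_ext PiE_mem)
  then obtain f where "continuous_map (Y i) euclideanreal f" "f (h x i) \<noteq> f (h y i)"
    using Y unfolding functionally_Hausdorff_space_def by blast
  then show "\<exists>f. continuous_map (top_ini I Y A h) euclideanreal f \<and> f x \<noteq> f y"
    using continuous_map_compose[OF continuous_map_top_ini_proj[OF i(1)]]
    by (intro exI[of _ "f \<circ> (\<lambda>u. h u i)"]) auto
qed

text \<open>Tychonoff's theorem makes the product compact, and the image of h is closed in
  it.\<close>

lemma compact_space_top_ini:
  assumes "inj_on h A" "\<And>i. i \<in> I \<Longrightarrow> compact_space (Y i)" "closedin (product_topology Y I) (h ` A)"
  shows "compact_space (top_ini I Y A h)"
  unfolding homeomorphic_compact_space[OF top_ini_homeomorphic[OF assms(1)]]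
  using assms(2,3) by (intro compact_space_subtopology closedin_compact_space)
    (auto simp: compact_space_product_topology)

text \<open>Open sets of the initial topology are preimages of open sets of the product. This
  carries density of the orbits in their closure over to the transported copy.\<close>

lemma closure_of_top_ini:
  assumes "u \<in> A" "S \<subseteq> h ` A" "h u \<in> product_topology Y I closure_of S"
  shows "u \<in> top_ini I Y A h closure_of {u \<in> A. h u \<in> S}"
  unfolding in_closure_of topspace_top_ini
proof (intro conjI allI impI assms(1))
  fix V assume "u \<in> V \<and> openin (top_ini I Y A h) V"
  then obtain W where W: "openin (product_topology Y I) W" "V = h -` W \<inter> A" "h u \<in> W"
    by (auto simp: top_ini_def openin_pullback_topology)
  then obtain d where "d \<in> S" "d \<in> W"
    using assms(3) unfolding in_closure_of by blast
  then show "\<exists>v. v \<in> {u \<in> A. h u \<in> S} \<and> v \<in> V"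
    using assms(2) W(2) by blast
qed

end

text \<open>A point of the closure is determined by the traces on \<open>S\<close> of its open neighbourhoods.\<close>

lemma Hausdorff_closure_of_lepoll:
  assumes X: "Hausdorff_space X"
  shows "X closure_of S \<lesssim> Pow (Pow S)"
proof -
  define tr where "tr x = {W \<inter> S |W. openin X W \<and> x \<in> W}" for x
  have "x = y" if x: "x \<in> X closure_of S" and y: "y \<in> X closure_of S" and xy: "tr x = tr y" for x y
  proof (rule ccontr)
    assume "x \<noteq> y"
    then obtain V W where V: "openin X V" "x \<in> V" and W: "openin X W" "y \<in> W" and VW: "disjnt V W"
      using X x y unfolding Hausdorff_space_def in_closure_of by meson
    have "V \<inter> S \<in> tr y"
      using V xy unfolding tr_def by blast
    then obtain V' where V': "openin X V'" "y \<in> V'" "V' \<inter> S = V \<inter> S"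
      unfolding tr_def by auto
    then have "openin X (V' \<inter> W)" "y \<in> V' \<inter> W"
      using W by auto
    then obtain d where "d \<in> S" "d \<in> V' \<inter> W"
      using y unfolding in_closure_of by blast
    then show False
      using V' VW unfolding disjnt_def by blast
  qed
  then have "inj_on tr (X closure_of S)"
    by (auto intro: inj_onI)
  then show ?thesis
    unfolding lepoll_def by (intro exI[of _ tr]) (auto simp: tr_def)
qed

section \<open>Inheritance of continuity constraints\<close>

text \<open>Continuity into the initial topology is tested in each coordinate, and there \<gamma> is
  the given action \<beta>(i) after the coordinate map.\<close>

lemma top_constraint_ini:
  assumes T: "topspace T \<subseteq> carrier M" and h: "h \<in> A \<rightarrow> (\<Pi>\<^sub>E i\<in>I. topspace (Y i))"
    and \<beta>: "\<And>i. i \<in> I \<Longrightarrow> top_constraint T \<S> \<J> (Y i) (\<beta> i)"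
    and \<gamma>: "\<And>s u. \<lbrakk>s \<in> carrier M; u \<in> A\<rbrakk> \<Longrightarrow> \<gamma> s u \<in> A"
      "\<And>s u i. \<lbrakk>s \<in> carrier M; u \<in> A; i \<in> I\<rbrakk> \<Longrightarrow> h (\<gamma> s u) i = \<beta> i s (h u i)"
  shows "top_constraint T \<S> \<J> (top_ini I Y A h) \<gamma>"
  unfolding top_constraint_def separately_continuous_def
proof (intro conjI ballI)
  note into = continuous_map_into_top_ini[OF h] and proj = continuous_map_top_ini_proj[OF h]
    and [simp] = topspace_top_ini[OF h]
  have hu: "h u i \<in> topspace (Y i)" if "u \<in> A" "i \<in> I" for u i
    using h that by (auto simp: PiE_def Pi_def)
  show "continuous_map (top_ini I Y A h) (top_ini I Y A h) (\<gamma> s)"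
    if S: "S \<in> \<S>" and s: "s \<in> topspace (subtopology T S)" for S s
  proof (rule into)
    have sM: "s \<in> carrier M" using s T by auto
    show "\<gamma> s \<in> topspace (top_ini I Y A h) \<rightarrow> A" using \<gamma>(1) sM by simp
    fix i assume i: "i \<in> I"
    have "continuous_map (Y i) (Y i) (\<beta> i s)"
      using \<beta>[OF i] S s unfolding top_constraint_def separately_continuous_def by blast
    from continuous_map_compose[OF proj[OF i] this]
    show "continuous_map (top_ini I Y A h) (Y i) (\<lambda>u. h (\<gamma> s u) i)"
      by (rule continuous_map_eq) (simp add: \<gamma>(2) sM i)
  qed
  show "continuous_map (subtopology T S) (top_ini I Y A h) (\<lambda>s. \<gamma> s u)"
    if S: "S \<in> \<S>" and u: "u \<in> topspace (top_ini I Y A h)" for S u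
  proof (rule into)
    show "(\<lambda>s. \<gamma> s u) \<in> topspace (subtopology T S) \<rightarrow> A"
      using \<gamma>(1) u T by auto
    fix i assume i: "i \<in> I"
    have "continuous_map (subtopology T S) (Y i) (\<lambda>s. \<beta> i s (h u i))"
      using \<beta>[OF i] S u hu i unfolding top_constraint_def separately_continuous_def by simp
    then show "continuous_map (subtopology T S) (Y i) (\<lambda>s. h (\<gamma> s u) i)"
      by (rule continuous_map_eq) (use \<gamma>(2) u T i in auto)
  qed
  show "continuous_map (prod_topology (subtopology T J) (top_ini I Y A h)) (top_ini I Y A h) (\<lambda>(s, u). \<gamma> s u)"
    if J: "J \<in> \<J>" for J
  proof (rule into)
    show "(\<lambda>(s, u). \<gamma> s u) \<in> topspace (prod_topology (subtopology T J) (top_ini I Y A h)) \<rightarrow> A"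
      using \<gamma>(1) T by auto
    fix i assume i: "i \<in> I"
    have "continuous_map (prod_topology (subtopology T J) (Y i)) (Y i) (\<lambda>(s, y). \<beta> i s y)"
      using \<beta>[OF i] J unfolding top_constraint_def by blast
    from continuous_map_compose[OF continuous_map_prod_right[OF proj[OF i]] this]
    show "continuous_map (prod_topology (subtopology T J) (top_ini I Y A h)) (Y i)
        (\<lambda>z. h (case z of (s, u) \<Rightarrow> \<gamma> s u) i)"
      by (rule continuous_map_eq) (use \<gamma>(2) T i in auto)
  qed
qed

text \<open>Each map to be tested is a corresponding map for \<beta>, composed with j in the space
  variable and followed by r.\<close>

lemma top_constraint_retract:
  assumes T: "topspace T \<subseteq> carrier M" and \<beta>: "top_constraint T \<S> \<J> Y \<beta>"
    and j: "continuous_map X Y j" and r: "continuous_map Y X r"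
    and \<gamma>: "\<And>s x. \<lbrakk>s \<in> carrier M; x \<in> topspace X\<rbrakk> \<Longrightarrow> \<gamma> s x = r (\<beta> s (j x))"
  shows "top_constraint T \<S> \<J> X \<gamma>"
  unfolding top_constraint_def separately_continuous_def
proof (intro conjI ballI)
  show "continuous_map X X (\<gamma> s)" if S: "S \<in> \<S>" and s: "s \<in> topspace (subtopology T S)" for S s
  proof -
    have "continuous_map Y Y (\<beta> s)"
      using \<beta> S s unfolding top_constraint_def separately_continuous_def by blast
    from continuous_map_compose[OF continuous_map_compose[OF j this] r]
    show ?thesis by (rule continuous_map_eq) (use \<gamma> s T in auto)
  qed
  show "continuous_map (subtopology T S) X (\<lambda>s. \<gamma> s x)" if S: "S \<in> \<S>" and x: "x \<in> topspace X" for S x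
  proof -
    have "continuous_map (subtopology T S) Y (\<lambda>s. \<beta> s (j x))"
      using \<beta> S x continuous_map_funspace[OF j]
      unfolding top_constraint_def separately_continuous_def by (simp add: Pi_iff)
    from continuous_map_compose[OF this r]
    show ?thesis by (rule continuous_map_eq) (use \<gamma> x T in auto)
  qed
  show "continuous_map (prod_topology (subtopology T J) X) X (\<lambda>(s, x). \<gamma> s x)" if J: "J \<in> \<J>" for J
  proof -
    have "continuous_map (prod_topology (subtopology T J) Y) Y (\<lambda>(s, y). \<beta> s y)"
      using \<beta> J unfolding top_constraint_def by blast
    from continuous_map_compose[OF continuous_map_compose[OF continuous_map_prod_right[OF j] this] r]
    show ?thesis by (rule continuous_map_eq) (use \<gamma> T in auto)
  qed
qed

lemma initial_flows_Top:
  assumes "topological_monoid M T"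
  shows "initial_flows topspace continuous_map P M (top_constraint T \<S> \<J>) top_ini"
proof -
  interpret concrete topspace continuous_map P by (rule concrete_Top)
  have T: "topspace T \<subseteq> carrier M" and M: "Group.monoid M"
    using assms by (auto simp: topological_monoid_def)
  show ?thesis
    apply (intro initial_flows.intro initial_flows_axioms.intro concrete_flows.intro
        concrete_flows_axioms.intro concrete_axioms M)
    subgoal premises p by (rule topspace_top_ini[OF p(2)])
    subgoal premises p by (rule continuous_map_top_ini_proj[OF p(2,3)])
    subgoal premises p by (rule continuous_map_into_top_ini[OF p(2,4,5)])
    subgoal premises p for I Y h A \<beta> \<gamma>
      by (rule top_constraint_ini[OF T, where h = h and A = A and \<beta> = \<beta> and \<gamma> = \<gamma>]) (fact p)+
    subgoal premises p for X Y \<beta> j r \<gamma>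
      by (rule top_constraint_retract[OF T, where Y = Y and \<beta> = \<beta> and j = j and r = r and \<gamma> = \<gamma>]) (fact p)+
    done
qed

lemma monadic_Top_hereditary:
  fixes P :: "'u topology \<Rightarrow> bool"
  assumes size: "strong_limit TYPE('u)" "carrier M \<prec> (UNIV :: 'u set)" and T: "topological_monoid M T"
    and P: "P \<in> {\<lambda>_. True, t0_space, t1_space, Hausdorff_space, functionally_Hausdorff_space, Tychonoff_space}"
  shows "monadic (flow_category (Top P) M (top_constraint T \<S> \<J>)) (Top P) forgetful"
  unfolding Top_def
proof (rule initial_flows.monadic_flows_hereditary[OF initial_flows_Top[OF T] size])
  fix I and Y :: "_ \<Rightarrow> 'u topology" and A :: "'u set" and h :: "'u \<Rightarrow> _ \<Rightarrow> 'u"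
  assume Y: "\<And>i. i \<in> I \<Longrightarrow> P (Y i)" and inj: "inj_on h A" and "h ` A \<subseteq> (\<Pi>\<^sub>E i\<in>I. topspace (Y i))"
  then have h: "h \<in> A \<rightarrow> (\<Pi>\<^sub>E i\<in>I. topspace (Y i))"
    by blast
  show "P (top_ini I Y A h)"
    using P
  proof (elim insertE emptyE)
    assume [simp]: "P = t0_space" show ?thesis using t0_space_top_ini[OF h inj] Y by simp
  next
    assume [simp]: "P = t1_space" show ?thesis using t1_space_top_ini[OF h inj] Y by simp
  next
    assume [simp]: "P = Hausdorff_space" show ?thesis using Hausdorff_space_top_ini[OF h inj] Y by simp
  next
    assume [simp]: "P = functionally_Hausdorff_space"
    show ?thesis using functionally_Hausdorff_space_top_ini[OF h inj] Y by simp
  next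
    assume [simp]: "P = Tychonoff_space"
    show ?thesis
      using Hausdorff_space_top_ini[OF h inj] completely_regular_space_top_ini[OF h inj] Y
      by (simp add: Tychonoff_space_def)
  qed simp
qed

lemma monadic_Top_compact_Hausdorff:
  assumes size: "strong_limit TYPE('u)" "carrier M \<prec> (UNIV :: 'u set)" and T: "topological_monoid M T"
  shows "monadic (flow_category (Top (\<lambda>X :: 'u topology. compact_space X \<and> Hausdorff_space X)) M
    (top_constraint T \<S> \<J>)) (Top (\<lambda>X. compact_space X \<and> Hausdorff_space X)) forgetful"
  unfolding Top_def
proof -
  interpret initial_flows topspace continuous_map "\<lambda>X :: 'u topology. compact_space X \<and> Hausdorff_space X"
    M "top_constraint T \<S> \<J>" top_ini
    by (rule initial_flows_Top[OF T])
  show "monadic D C forgetful"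
  proof (rule monadic_flows)
    fix X assume X: "X \<in> Ob C"
    define W where "W = product_topology target (arrows X)"
    define Q0 where "Q0 = W closure_of orbits X"
    have top: "topspace W = (\<Pi>\<^sub>E i\<in>arrows X. topspace (target i))"
      by (simp add: W_def)
    have W: "Hausdorff_space W"
      using arrows_P[of _ X] by (simp add: W_def Hausdorff_space_product_topology)
    have sub: "orbits X \<subseteq> Q0"
      unfolding Q0_def using orbits_subset top by (intro closure_of_subset) blast
    have Q0: "Q0 \<subseteq> (\<Pi>\<^sub>E i\<in>arrows X. topspace (target i))"
      using closure_of_subset_topspace[of W] by (simp add: Q0_def top)
    have "flow_hull X Q0"
      unfolding flow_hull_def
    proof (intro conjI ballI allI impI)
      show "orbits X \<subseteq> Q0" by (rule sub)
      show "Q0 \<subseteq> (\<Pi>\<^sub>E i\<in>arrows X. topspace (target i))" by (rule Q0)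
      show "act X s q \<in> Q0" if s: "s \<in> carrier M" and q: "q \<in> Q0" for s q
      proof -
        \<comment> \<open>The action is continuous on the whole product, so it maps the closure of
          the invariant set of orbits into itself.\<close>
        have "continuous_map W W (act X s)"
          unfolding W_def continuous_map_componentwise
        proof (intro conjI ballI)
          fix i assume i: "i \<in> arrows X"
          have "continuous_map (target i) (target i) (snd (fst i) s)"
            by (rule flow_mor[OF arrows_flow[OF i] s])
          from continuous_map_compose[OF continuous_map_product_projection[OF i, of target] this]
          show "continuous_map (product_topology target (arrows X)) (target i) (\<lambda>q. act X s q i)"
            using i by (simp add: act_def o_def)
        qed (auto simp: act_def)
        then have "act X s ` Q0 \<subseteq> W closure_of (act X s ` orbits X)"
          unfolding Q0_def by (rule continuous_map_image_closure_subset)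
        also have "\<dots> \<subseteq> Q0"
          unfolding Q0_def using act_orbits[OF s] by (intro closure_of_mono) blast
        finally show ?thesis using q by blast
      qed
      have "orbits X \<prec> (UNIV :: 'u set)"
        using X size by (auto intro!: lesspoll_trans1[OF orbits_lepoll] Times_lesspoll strong_limit_infinite)
      \<comment> \<open>The closure embeds into the double power set of the orbits, hence two
        applications of the strong limit property.\<close>
      then show "Q0 \<prec> (UNIV :: 'u set)"
        unfolding Q0_def
        by (intro lesspoll_trans1[OF Hausdorff_closure_of_lepoll[OF W]] Pow_lesspoll size)
      fix A :: "'u set" and h assume "bij_betw h A Q0"
      then have inj: "inj_on h A" and hA: "h ` A = Q0" by (auto simp: bij_betw_def)
      then have h: "h \<in> A \<rightarrow> (\<Pi>\<^sub>E i\<in>arrows X. topspace (target i))"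
        using Q0 by blast
      have "closedin W (h ` A)" by (simp add: hA Q0_def)
      then show "compact_space (top_ini (arrows X) target A h)"
        using arrows_P[of _ X] by (intro compact_space_top_ini[OF h inj]) (simp_all add: W_def)
      show "Hausdorff_space (top_ini (arrows X) target A h)"
        using arrows_P[of _ X] by (intro Hausdorff_space_top_ini[OF h inj]) simp
      show "dense_orbits X A h"
        unfolding dense_orbits_def
      proof (intro allI impI ballI)
        fix Y g g' u
        assume "compact_space Y \<and> Hausdorff_space Y"
          "continuous_map (top_ini (arrows X) target A h) Y g"
          "continuous_map (top_ini (arrows X) target A h) Y g'"
          "\<forall>u\<in>A. h u \<in> orbits X \<longrightarrow> g u = g' u" "u \<in> A"
        \<comment> \<open>The orbits are dense in the copy, and two continuous maps to a Hausdorff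
          space that agree on a dense set are equal.\<close>
        moreover have "u \<in> top_ini (arrows X) target A h closure_of {u \<in> A. h u \<in> orbits X}"
          using \<open>u \<in> A\<close> hA sub by (intro closure_of_top_ini[OF h]) (auto simp: Q0_def W_def)
        ultimately show "g u = g' u"
          by (intro forall_in_closure_of_eq[of u _ _ Y g g']) auto
      qed
    qed
    then show "\<exists>Q0. flow_hull X Q0" ..
  qed
qed

section \<open>Flows on compactly generated spaces\<close>

lemma continuous_map_kappa_kappa: "continuous_map X Y f \<Longrightarrow> continuous_map (kappa X) (kappa Y) f"
  using continuous_map_into_kappa[OF k_space_kappa] continuous_map_compose[OF continuous_map_kappa_id]
  by fastforce

lemma continuous_map_from_kappa: "continuous_map X Y f \<Longrightarrow> continuous_map (kappa X) Y f"
  using continuous_map_compose[OF continuous_map_kappa_id, of X Y f] by simp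

text \<open>The copy of the flow, \<kappa>(S) and the \<kappa>-product are all in the image of
  \<open>kappa\<close>, so continuity into the coreflected initial topology is again tested in each
  coordinate.\<close>

lemma kappa_constraint_ini:
  assumes T: "topspace T \<subseteq> carrier M" and h: "h \<in> A \<rightarrow> (\<Pi>\<^sub>E i\<in>I. topspace (Y i))"
    and \<beta>: "\<And>i. i \<in> I \<Longrightarrow> kappa_constraint T \<S> \<J> (Y i) (\<beta> i)"
    and \<gamma>: "\<And>s u. \<lbrakk>s \<in> carrier M; u \<in> A\<rbrakk> \<Longrightarrow> \<gamma> s u \<in> A"
      "\<And>s u i. \<lbrakk>s \<in> carrier M; u \<in> A; i \<in> I\<rbrakk> \<Longrightarrow> h (\<gamma> s u) i = \<beta> i s (h u i)"
  shows "kappa_constraint T \<S> \<J> (kappa (top_ini I Y A h)) \<gamma>"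
  unfolding kappa_constraint_def separately_continuous_def
proof (intro conjI ballI)
  let ?Q = "kappa (top_ini I Y A h)"
  have proj: "continuous_map ?Q (Y i) (\<lambda>u. h u i)" if "i \<in> I" for i
    by (intro continuous_map_from_kappa continuous_map_top_ini_proj[OF h that])
  note into = continuous_map_into_kappa[OF _ continuous_map_into_top_ini[OF h]]
    and [simp] = topspace_top_ini[OF h]
  have hu: "h u i \<in> topspace (Y i)" if "u \<in> A" "i \<in> I" for u i
    using h that by (auto simp: PiE_def Pi_def)
  show "continuous_map ?Q ?Q (\<gamma> s)"
    if S: "S \<in> \<S>" and s: "s \<in> topspace (kappa (subtopology T S))" for S s
  proof (rule into[OF k_space_kappa])
    have sM: "s \<in> carrier M" using s T by auto
    show "\<gamma> s \<in> topspace ?Q \<rightarrow> A" using \<gamma>(1) sM by simp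
    fix i assume i: "i \<in> I"
    have "continuous_map (Y i) (Y i) (\<beta> i s)"
      using \<beta>[OF i] S s unfolding kappa_constraint_def separately_continuous_def by blast
    from continuous_map_compose[OF proj[OF i] this]
    show "continuous_map ?Q (Y i) (\<lambda>u. h (\<gamma> s u) i)"
      by (rule continuous_map_eq) (simp add: \<gamma>(2) sM i)
  qed
  show "continuous_map (kappa (subtopology T S)) ?Q (\<lambda>s. \<gamma> s u)"
    if S: "S \<in> \<S>" and u: "u \<in> topspace ?Q" for S u
  proof (rule into[OF k_space_kappa])
    show "(\<lambda>s. \<gamma> s u) \<in> topspace (kappa (subtopology T S)) \<rightarrow> A"
      using \<gamma>(1) u T by auto
    fix i assume i: "i \<in> I"
    have "continuous_map (kappa (subtopology T S)) (Y i) (\<lambda>s. \<beta> i s (h u i))"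
      using \<beta>[OF i] S u hu i unfolding kappa_constraint_def separately_continuous_def by simp
    then show "continuous_map (kappa (subtopology T S)) (Y i) (\<lambda>s. h (\<gamma> s u) i)"
      by (rule continuous_map_eq) (use \<gamma>(2) u T i in auto)
  qed
  show "continuous_map (kappa (prod_topology (kappa (subtopology T J)) ?Q)) ?Q (\<lambda>(s, u). \<gamma> s u)"
    if J: "J \<in> \<J>" for J
  proof (rule into[OF k_space_kappa])
    show "(\<lambda>(s, u). \<gamma> s u) \<in> topspace (kappa (prod_topology (kappa (subtopology T J)) ?Q)) \<rightarrow> A"
      using \<gamma>(1) T by auto
    fix i assume i: "i \<in> I"
    have "continuous_map (kappa (prod_topology (kappa (subtopology T J)) (Y i))) (Y i) (\<lambda>(s, y). \<beta> i s y)"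
      using \<beta>[OF i] J unfolding kappa_constraint_def by blast
    from continuous_map_compose[OF continuous_map_kappa_kappa[OF continuous_map_prod_right[OF proj[OF i]]] this]
    show "continuous_map (kappa (prod_topology (kappa (subtopology T J)) ?Q)) (Y i)
        (\<lambda>z. h (case z of (s, u) \<Rightarrow> \<gamma> s u) i)"
      by (rule continuous_map_eq) (use \<gamma>(2) T i in auto)
  qed
qed

lemma kappa_constraint_retract:
  assumes T: "topspace T \<subseteq> carrier M" and \<beta>: "kappa_constraint T \<S> \<J> Y \<beta>"
    and j: "continuous_map X Y j" and r: "continuous_map Y X r"
    and \<gamma>: "\<And>s x. \<lbrakk>s \<in> carrier M; x \<in> topspace X\<rbrakk> \<Longrightarrow> \<gamma> s x = r (\<beta> s (j x))"
  shows "kappa_constraint T \<S> \<J> X \<gamma>"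
  unfolding kappa_constraint_def separately_continuous_def
proof (intro conjI ballI)
  show "continuous_map X X (\<gamma> s)" if S: "S \<in> \<S>" and s: "s \<in> topspace (kappa (subtopology T S))" for S s
  proof -
    have "continuous_map Y Y (\<beta> s)"
      using \<beta> S s unfolding kappa_constraint_def separately_continuous_def by blast
    from continuous_map_compose[OF continuous_map_compose[OF j this] r]
    show ?thesis by (rule continuous_map_eq) (use \<gamma> s T in auto)
  qed
  show "continuous_map (kappa (subtopology T S)) X (\<lambda>s. \<gamma> s x)" if S: "S \<in> \<S>" and x: "x \<in> topspace X" for S x
  proof -
    have "continuous_map (kappa (subtopology T S)) Y (\<lambda>s. \<beta> s (j x))"
      using \<beta> S x continuous_map_funspace[OF j]
      unfolding kappa_constraint_def separately_continuous_def by (simp add: Pi_iff)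
    from continuous_map_compose[OF this r]
    show ?thesis by (rule continuous_map_eq) (use \<gamma> x T in auto)
  qed
  show "continuous_map (kappa (prod_topology (kappa (subtopology T J)) X)) X (\<lambda>(s, x). \<gamma> s x)"
    if J: "J \<in> \<J>" for J
  proof -
    have "continuous_map (kappa (prod_topology (kappa (subtopology T J)) Y)) Y (\<lambda>(s, y). \<beta> s y)"
      using \<beta> J unfolding kappa_constraint_def by blast
    from continuous_map_compose[OF continuous_map_compose[OF
        continuous_map_kappa_kappa[OF continuous_map_prod_right[OF j]] this] r]
    show ?thesis by (rule continuous_map_eq) (use \<gamma> T in auto)
  qed
qed

text \<open>A subspace of a product need not be compactly generated. Its coreflection is: by the
  universal property of \<open>kappa\<close> it is initial with respect to compactly generated
  sources, and these are the only ones since \<open>P\<close> implies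
  \<open>k_space\<close>.\<close>

lemma initial_flows_kappa:
  assumes M: "kappa_monoid M T" and P: "\<And>X. P X \<Longrightarrow> k_space X"
  shows "initial_flows topspace continuous_map P M (kappa_constraint T \<S> \<J>)
    (\<lambda>I Y A h. kappa (top_ini I Y A h))"
proof -
  interpret concrete topspace continuous_map P by (rule concrete_Top)
  have T: "topspace T \<subseteq> carrier M" and M: "Group.monoid M"
    using M by (auto simp: kappa_monoid_def)
  show ?thesis
    apply (intro initial_flows.intro initial_flows_axioms.intro concrete_flows.intro
        concrete_flows_axioms.intro concrete_axioms M)
    subgoal premises p by (simp add: topspace_top_ini[OF p(2)])
    subgoal premises p by (intro continuous_map_from_kappa continuous_map_top_ini_proj[OF p(2,3)])
    subgoal premises p
      by (rule continuous_map_into_kappa[OF P[OF p(3)] continuous_map_into_top_ini[OF p(2,4,5)]])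
    subgoal premises p for I Y h A \<beta> \<gamma>
      by (rule kappa_constraint_ini[OF T, where h = h and A = A and \<beta> = \<beta> and \<gamma> = \<gamma>])
        (fact p)+
    subgoal premises p for X Y \<beta> j r \<gamma>
      by (rule kappa_constraint_retract[OF T, where Y = Y and \<beta> = \<beta> and j = j and r = r and \<gamma> = \<gamma>]) (fact p)+
    done
qed

lemma monadic_kappa:
  fixes P :: "'u topology \<Rightarrow> bool"
  assumes size: "strong_limit TYPE('u)" "carrier M \<prec> (UNIV :: 'u set)" and T: "kappa_monoid M T"
    and P: "P \<in> {k_space, \<lambda>X. k_space X \<and> Hausdorff_space X}"
  shows "monadic (flow_category (Top P) M (kappa_constraint T \<S> \<J>)) (Top P) forgetful"
  unfolding Top_def
proof (rule initial_flows.monadic_flows_hereditary[OF initial_flows_kappa[OF T] size])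
  show "k_space X" if "P X" for X
    using P that by auto
  fix I and Y :: "_ \<Rightarrow> 'u topology" and A :: "'u set" and h :: "'u \<Rightarrow> _ \<Rightarrow> 'u"
  assume Y: "\<And>i. i \<in> I \<Longrightarrow> P (Y i)" and inj: "inj_on h A" and "h ` A \<subseteq> (\<Pi>\<^sub>E i\<in>I. topspace (Y i))"
  then have h: "h \<in> A \<rightarrow> (\<Pi>\<^sub>E i\<in>I. topspace (Y i))"
    by blast
  \<comment> \<open>The coreflection only refines the topology: the identity is a continuous
    injection to a Hausdorff space.\<close>
  have "Hausdorff_space (kappa (top_ini I Y A h))" if "\<And>i. i \<in> I \<Longrightarrow> Hausdorff_space (Y i)"
    using Hausdorff_space_injective_preimage[OF Hausdorff_space_top_ini[OF h inj that] continuous_map_kappa_id]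
    by simp
  then show "P (kappa (top_ini I Y A h))"
    using P Y k_space_kappa by auto
qed

section \<open>Flows on uniform spaces\<close>

context
  fixes X :: "'a uspace"
  assumes X: "uniform_structure X"
begin

lemma entourage_UNIV: "upoints X \<times> upoints X \<in> entourages X"
  using X by (simp add: uniform_structure_def)

lemma entourage_refl: "\<lbrakk>V \<in> entourages X; x \<in> upoints X\<rbrakk> \<Longrightarrow> (x, x) \<in> V"
  using X unfolding uniform_structure_def by blast

lemma entourage_subset: "V \<in> entourages X \<Longrightarrow> V \<subseteq> upoints X \<times> upoints X"
  using X unfolding uniform_structure_def by blast

lemma entourage_mono: "\<lbrakk>V \<in> entourages X; V \<subseteq> W; W \<subseteq> upoints X \<times> upoints X\<rbrakk> \<Longrightarrow> W \<in> entourages X"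
  using X unfolding uniform_structure_def by blast

lemma entourage_Int: "\<lbrakk>V \<in> entourages X; W \<in> entourages X\<rbrakk> \<Longrightarrow> V \<inter> W \<in> entourages X"
  using X unfolding uniform_structure_def by blast

lemma entourage_converse: "V \<in> entourages X \<Longrightarrow> V\<inverse> \<in> entourages X"
  using X unfolding uniform_structure_def by blast

lemma entourage_comp: "V \<in> entourages X \<Longrightarrow> \<exists>W\<in>entourages X. W O W \<subseteq> V"
  using X unfolding uniform_structure_def by blast

lemma entourage_comp_sym:
  assumes "V \<in> entourages X"
  obtains W where "W \<in> entourages X" "W O W \<subseteq> V" "\<And>x y. (x, y) \<in> W \<Longrightarrow> (y, x) \<in> W"
proof -
  obtain W where W: "W \<in> entourages X" "W O W \<subseteq> V"
    using entourage_comp[OF assms] by blast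
  show thesis
    using W entourage_Int[OF W(1) entourage_converse[OF W(1)]] by (intro that[of "W \<inter> W\<inverse>"]) auto
qed

end

lemma unif_continuous_entourage:
  "\<lbrakk>unif_continuous X Y f; W \<in> entourages Y\<rbrakk> \<Longrightarrow>
    {(x, x') \<in> upoints X \<times> upoints X. (f x, f x') \<in> W} \<in> entourages X"
  by (simp add: unif_continuous_def)

lemma unif_continuous_in: "\<lbrakk>unif_continuous X Y f; x \<in> upoints X\<rbrakk> \<Longrightarrow> f x \<in> upoints Y"
  by (auto simp: unif_continuous_def)

lemma unif_continuous_cong:
  assumes "unif_continuous X Y f" "\<And>x. x \<in> upoints X \<Longrightarrow> f x = g x"
  shows "unif_continuous X Y g"
proof -
  have "{(x, x') \<in> upoints X \<times> upoints X. (g x, g x') \<in> W} =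
      {(x, x') \<in> upoints X \<times> upoints X. (f x, f x') \<in> W}" for W
    using assms(2) by auto
  moreover have "g \<in> upoints X \<rightarrow> upoints Y"
    using assms(2) unif_continuous_in[OF assms(1)] by (metis Pi_I)
  ultimately show ?thesis
    using assms(1) by (simp add: unif_continuous_def)
qed

lemma unif_continuous_compose:
  assumes f: "unif_continuous X Y f" and g: "unif_continuous Y Z g"
  shows "unif_continuous X Z (\<lambda>x. g (f x))"
  unfolding unif_continuous_def
proof (intro conjI ballI)
  show "(\<lambda>x. g (f x)) \<in> upoints X \<rightarrow> upoints Z"
    using unif_continuous_in[OF f] unif_continuous_in[OF g] by blast
  fix W assume "W \<in> entourages Z"
  from unif_continuous_entourage[OF f unif_continuous_entourage[OF g this]]
  have "{(x, x') \<in> upoints X \<times> upoints X. (f x, f x') \<in> {(y, y') \<in> upoints Y \<times> upoints Y. (g y, g y') \<in> W}}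
      \<in> entourages X" .
  also have "{(x, x') \<in> upoints X \<times> upoints X. (f x, f x') \<in> {(y, y') \<in> upoints Y \<times> upoints Y. (g y, g y') \<in> W}} =
      {(x, x') \<in> upoints X \<times> upoints X. (g (f x), g (f x')) \<in> W}"
    using unif_continuous_in[OF f] by auto
  finally show "{(x, x') \<in> upoints X \<times> upoints X. (g (f x), g (f x')) \<in> W} \<in> entourages X" .
qed

lemma unif_continuous_id:
  assumes "uniform_structure X"
  shows "unif_continuous X X (\<lambda>x. x)"
proof -
  have "{(x, x') \<in> upoints X \<times> upoints X. (x, x') \<in> W} = W" if "W \<in> entourages X" for W
    using entourage_subset[OF assms that] by auto
  then show ?thesis
    by (simp add: unif_continuous_def)
qed

lemma entourage_prodI:
  "\<lbrakk>V \<in> entourages X; W \<in> entourages Y; {((x, y), (x', y')) |x y x' y'. (x, x') \<in> V \<and> (y, y') \<in> W} \<subseteq> E;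
    E \<subseteq> upoints (prod_uspace X Y) \<times> upoints (prod_uspace X Y)\<rbrakk> \<Longrightarrow> E \<in> entourages (prod_uspace X Y)"
  unfolding prod_uspace_def uspace.simps by blast

lemma unif_continuous_prod_right:
  assumes A: "\<And>V. V \<in> entourages A \<Longrightarrow> V \<subseteq> upoints A \<times> upoints A" and f: "unif_continuous X Y f"
    and X: "uniform_structure X"
  shows "unif_continuous (prod_uspace A X) (prod_uspace A Y) (\<lambda>(s, x). (s, f x))"
  unfolding unif_continuous_def
proof (intro conjI ballI)
  show "(\<lambda>(s, x). (s, f x)) \<in> upoints (prod_uspace A X) \<rightarrow> upoints (prod_uspace A Y)"
    using unif_continuous_in[OF f] by (auto simp: prod_uspace_def)
  fix E assume "E \<in> entourages (prod_uspace A Y)"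
  then obtain V W where V: "V \<in> entourages A" and W: "W \<in> entourages Y"
    and E: "{((s, y), (s', y')) |s y s' y'. (s, s') \<in> V \<and> (y, y') \<in> W} \<subseteq> E"
    by (auto simp: prod_uspace_def)
  let ?W = "{(x, x') \<in> upoints X \<times> upoints X. (f x, f x') \<in> W}"
  have "?W \<in> entourages X"
    by (rule unif_continuous_entourage[OF f W])
  moreover have "{((s, x), (s', x')) |s x s' x'. (s, s') \<in> V \<and> (x, x') \<in> ?W} \<subseteq>
      {(p, p') \<in> upoints (prod_uspace A X) \<times> upoints (prod_uspace A X).
        (case p of (s, x) \<Rightarrow> (s, f x), case p' of (s, x) \<Rightarrow> (s, f x)) \<in> E}"
    using A[OF V] E by (auto simp: prod_uspace_def)
  ultimately show "{(p, p') \<in> upoints (prod_uspace A X) \<times> upoints (prod_uspace A X).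
        (case p of (s, x) \<Rightarrow> (s, f x), case p' of (s, x) \<Rightarrow> (s, f x)) \<in> E} \<in> entourages (prod_uspace A X)"
    by (rule entourage_prodI[OF V]) auto
qed

section \<open>Closure in uniform spaces\<close>

text \<open>This is the closure for the induced topology, phrased through entourages so that no
  topology has to be constructed.\<close>

definition uclosure :: "'a uspace \<Rightarrow> 'a set \<Rightarrow> 'a set" where
  "uclosure X S = {x \<in> upoints X. \<forall>V\<in>entourages X. \<exists>y\<in>S. (x, y) \<in> V}"

lemma uclosureE:
  assumes "x \<in> uclosure X S" "V \<in> entourages X"
  obtains y where "y \<in> S" "(x, y) \<in> V"
  using assms unfolding uclosure_def by blast

lemma uclosure_in: "x \<in> uclosure X S \<Longrightarrow> x \<in> upoints X"
  by (simp add: uclosure_def)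

lemma uclosureI:
  "\<lbrakk>x \<in> upoints X; \<And>V. V \<in> entourages X \<Longrightarrow> \<exists>y\<in>S. (x, y) \<in> V\<rbrakk> \<Longrightarrow> x \<in> uclosure X S"
  by (simp add: uclosure_def)

lemma uclosure_mono:
  assumes "S \<subseteq> S'"
  shows "uclosure X S \<subseteq> uclosure X S'"
proof
  fix x assume x: "x \<in> uclosure X S"
  show "x \<in> uclosure X S'"
    using uclosureE[OF x] assms by (intro uclosureI[OF uclosure_in[OF x]]) blast
qed

lemma uclosure_superset:
  assumes "uniform_structure X" "S \<subseteq> upoints X"
  shows "S \<subseteq> uclosure X S"
proof
  fix x assume "x \<in> S"
  then show "x \<in> uclosure X S"
    using entourage_refl[OF assms(1)] assms(2) by (intro uclosureI) auto
qed

lemma uclosure_uclosure: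
  assumes X: "uniform_structure X"
  shows "uclosure X (uclosure X S) \<subseteq> uclosure X S"
proof
  fix x assume x: "x \<in> uclosure X (uclosure X S)"
  have "\<exists>z\<in>S. (x, z) \<in> V" if V: "V \<in> entourages X" for V
  proof -
    obtain W where W: "W \<in> entourages X" "W O W \<subseteq> V"
      using entourage_comp[OF X V] by blast
    obtain y where y: "y \<in> uclosure X S" "(x, y) \<in> W"
      using x W(1) by (rule uclosureE)
    obtain z where "z \<in> S" "(y, z) \<in> W"
      using y(1) W(1) by (rule uclosureE)
    then show ?thesis using y(2) W(2) by blast
  qed
  then show "x \<in> uclosure X S"
    by (rule uclosureI[OF uclosure_in[OF x]])
qed

lemma unif_continuous_image_uclosure:
  assumes f: "unif_continuous X Y f"
  shows "f ` uclosure X S \<subseteq> uclosure Y (f ` S)"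
proof (rule image_subsetI)
  fix x assume x: "x \<in> uclosure X S"
  show "f x \<in> uclosure Y (f ` S)"
  proof (rule uclosureI)
    show "f x \<in> upoints Y"
      using unif_continuous_in[OF f uclosure_in[OF x]] .
    fix V assume "V \<in> entourages Y"
    from x unif_continuous_entourage[OF f this]
    obtain y where "y \<in> S" "(x, y) \<in> {(x, x') \<in> upoints X \<times> upoints X. (f x, f x') \<in> V}"
      by (rule uclosureE)
    then show "\<exists>y\<in>f ` S. (f x, y) \<in> V" by auto
  qed
qed

text \<open>Some y in S is so near to x that f(y) is close to f(x) and g(y) to g(x). As f(y) = g(y),
  the values at x lie in W O W, hence in the entourage meant to separate them.\<close>

lemma unif_continuous_eq_on_uclosure:
  assumes X: "uniform_structure X" and Y: "uniform_structure Y" "Hausdorff_uspace Y"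
    and f: "unif_continuous X Y f" and g: "unif_continuous X Y g"
    and eq: "\<And>x. x \<in> S \<Longrightarrow> f x = g x" and x: "x \<in> uclosure X S"
  shows "f x = g x"
proof (rule ccontr)
  have xX: "x \<in> upoints X" using x by (simp add: uclosure_def)
  assume "f x \<noteq> g x"
  then obtain V where V: "V \<in> entourages Y" "(f x, g x) \<notin> V"
    using Y(2) unif_continuous_in[OF f xX] unif_continuous_in[OF g xX]
    unfolding Hausdorff_uspace_def by blast
  obtain W where W: "W \<in> entourages Y" "W O W \<subseteq> V" and sym: "\<And>x y. (x, y) \<in> W \<Longrightarrow> (y, x) \<in> W"
    using entourage_comp_sym[OF Y(1) V(1)] by blast
  obtain y where y: "y \<in> S" "(f x, f y) \<in> W" "(g x, g y) \<in> W"
    using x entourage_Int[OF X unif_continuous_entourage[OF f W(1)] unif_continuous_entourage[OF g W(1)]]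
    by (rule uclosureE) auto
  then have "(f y, g x) \<in> W"
    using eq[OF y(1)] sym[OF y(3)] by simp
  then show False
    using y(2) W(2) V(2) by blast
qed

text \<open>A point of the closure is determined by the traces on S of its entourage neighbourhoods.
  If x and z share the trace of W at x, a point of S that is W-close to z and lies in this trace
  links x to z through W O W.\<close>

lemma Hausdorff_uclosure_lepoll:
  assumes X: "uniform_structure X" "Hausdorff_uspace X"
  shows "uclosure X S \<lesssim> Pow (Pow S)"
proof -
  define tr where "tr x = {{y \<in> S. (x, y) \<in> V} |V. V \<in> entourages X}" for x
  have "x = z" if x: "x \<in> uclosure X S" and z: "z \<in> uclosure X S" and xz: "tr x = tr z" for x z
  proof (rule ccontr)
    assume "x \<noteq> z"
    then obtain V where V: "V \<in> entourages X" "(x, z) \<notin> V"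
      using X(2) uclosure_in[OF x] uclosure_in[OF z] unfolding Hausdorff_uspace_def by blast
    obtain W where W: "W \<in> entourages X" "W O W \<subseteq> V" and sym: "\<And>x y. (x, y) \<in> W \<Longrightarrow> (y, x) \<in> W"
      using entourage_comp_sym[OF X(1) V(1)] by blast
    have "{y \<in> S. (x, y) \<in> W} \<in> tr z"
      using W(1) xz unfolding tr_def by blast
    then obtain W' where W': "W' \<in> entourages X" "{y \<in> S. (x, y) \<in> W} = {y \<in> S. (z, y) \<in> W'}"
      unfolding tr_def by blast
    obtain y where "y \<in> S" "(z, y) \<in> W" "(z, y) \<in> W'"
      using z entourage_Int[OF X(1) W(1) W'(1)] by (rule uclosureE) auto
    then have "(x, y) \<in> W" "(y, z) \<in> W"
      using W'(2) sym by blast+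
    then show False
      using W(2) V(2) by blast
  qed
  then have "inj_on tr (uclosure X S)"
    by (auto intro: inj_onI)
  then show ?thesis
    unfolding lepoll_def by (intro exI[of _ tr]) (auto simp: tr_def)
qed

section \<open>Initial uniformities\<close>

text \<open>The filter generated by preimages of entourages under the coordinates; \<V> is a finite
  list of such conditions, each with its index. The empty family gives \<open>A \<times> A\<close>,
  which is the only entourage if I is empty.\<close>

definition unif_ini :: "'i set \<Rightarrow> ('i \<Rightarrow> 'b uspace) \<Rightarrow> 'a set \<Rightarrow> ('a \<Rightarrow> 'i \<Rightarrow> 'b) \<Rightarrow> 'a uspace" where
  "unif_ini I Y A h = \<lparr>upoints = A, entourages = {E. E \<subseteq> A \<times> A \<and>
    (\<exists>\<V>. finite \<V> \<and> \<V> \<subseteq> (SIGMA i:I. entourages (Y i)) \<and>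
      {(u, v) \<in> A \<times> A. \<forall>(i, V)\<in>\<V>. (h u i, h v i) \<in> V} \<subseteq> E)}\<rparr>"

lemma upoints_unif_ini [simp]: "upoints (unif_ini I Y A h) = A"
  by (simp add: unif_ini_def)

lemma entourage_unif_ini_subset: "E \<in> entourages (unif_ini I Y A h) \<Longrightarrow> E \<subseteq> A \<times> A"
  by (simp add: unif_ini_def)

lemma subbasic_entourage:
  "\<lbrakk>i \<in> I; V \<in> entourages (Y i)\<rbrakk> \<Longrightarrow> {(u, v) \<in> A \<times> A. (h u i, h v i) \<in> V} \<in> entourages (unif_ini I Y A h)"
  unfolding unif_ini_def by (auto intro!: exI[of _ "{(i, V)}"])

lemma unif_ini_UNIV: "A \<times> A \<in> entourages (unif_ini I Y A h)"
  unfolding unif_ini_def by (auto intro!: exI[of _ "{}"])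

lemma unif_iniI:
  "\<lbrakk>finite \<V>; \<V> \<subseteq> (SIGMA i:I. entourages (Y i));
    {(u, v) \<in> A \<times> A. \<forall>(i, V)\<in>\<V>. (h u i, h v i) \<in> V} \<subseteq> E; E \<subseteq> A \<times> A\<rbrakk> \<Longrightarrow>
    E \<in> entourages (unif_ini I Y A h)"
  by (auto simp: unif_ini_def simp del: split_paired_all)

lemma unif_iniE:
  assumes "E \<in> entourages (unif_ini I Y A h)"
  obtains \<V> where "finite \<V>" "\<V> \<subseteq> (SIGMA i:I. entourages (Y i))"
    "{(u, v) \<in> A \<times> A. \<forall>(i, V)\<in>\<V>. (h u i, h v i) \<in> V} \<subseteq> E"
  using assms by (auto simp: unif_ini_def)

lemma unif_ini_mono:
  assumes "E \<in> entourages (unif_ini I Y A h)" "E \<subseteq> E'" "E' \<subseteq> A \<times> A"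
  shows "E' \<in> entourages (unif_ini I Y A h)"
  using assms(1) by (rule unif_iniE) (erule (1) unif_iniI, rule order_trans[OF _ assms(2)], assumption, rule assms(3))

lemma unif_ini_Int:
  assumes "E \<in> entourages (unif_ini I Y A h)" "E' \<in> entourages (unif_ini I Y A h)"
  shows "E \<inter> E' \<in> entourages (unif_ini I Y A h)"
proof -
  obtain \<V> where \<V>: "finite \<V>" "\<V> \<subseteq> (SIGMA i:I. entourages (Y i))"
      "{(u, v) \<in> A \<times> A. \<forall>(i, V)\<in>\<V>. (h u i, h v i) \<in> V} \<subseteq> E"
    using assms(1) by (rule unif_iniE)
  obtain \<V>' where \<V>': "finite \<V>'" "\<V>' \<subseteq> (SIGMA i:I. entourages (Y i))"
      "{(u, v) \<in> A \<times> A. \<forall>(i, V)\<in>\<V>'. (h u i, h v i) \<in> V} \<subseteq> E'"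
    using assms(2) by (rule unif_iniE)
  show ?thesis
  proof (rule unif_iniI)
    show "finite (\<V> \<union> \<V>')" "\<V> \<union> \<V>' \<subseteq> (SIGMA i:I. entourages (Y i))"
      using \<V> \<V>' by auto
    show "{(u, v) \<in> A \<times> A. \<forall>(i, V)\<in>\<V> \<union> \<V>'. (h u i, h v i) \<in> V} \<subseteq> E \<inter> E'"
      using \<V>(3) \<V>'(3) by (auto simp: ball_Un)
    show "E \<inter> E' \<subseteq> A \<times> A"
      using entourage_unif_ini_subset[OF assms(1)] by blast
  qed
qed

text \<open>The entourages are the least filter on \<open>A \<times> A\<close> containing the
  subbasic ones. Inducting over its generation spares later proofs any handling of finite
  families.\<close>

lemma unif_ini_induct [consumes 1, case_names UNIV subbasic Int mono]:
  assumes E: "E \<in> entourages (unif_ini I Y A h)"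
    and UNIV: "R (A \<times> A)"
    and subbasic: "\<And>i V. \<lbrakk>i \<in> I; V \<in> entourages (Y i)\<rbrakk> \<Longrightarrow> R {(u, v) \<in> A \<times> A. (h u i, h v i) \<in> V}"
    and Int: "\<And>E E'. \<lbrakk>R E; R E'\<rbrakk> \<Longrightarrow> R (E \<inter> E')"
    and mono: "\<And>E E'. \<lbrakk>R E; E \<subseteq> E'; E' \<subseteq> A \<times> A\<rbrakk> \<Longrightarrow> R E'"
  shows "R E"
proof -
  obtain \<V> where "finite \<V>" and \<V>: "\<V> \<subseteq> (SIGMA i:I. entourages (Y i))"
    and E': "{(u, v) \<in> A \<times> A. \<forall>(i, V)\<in>\<V>. (h u i, h v i) \<in> V} \<subseteq> E"
    using E by (rule unif_iniE)
  from \<open>finite \<V>\<close> \<V> have "R {(u, v) \<in> A \<times> A. \<forall>(i, V)\<in>\<V>. (h u i, h v i) \<in> V}"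
  proof (induction \<V>)
    case empty
    have "{(u, v) \<in> A \<times> A. \<forall>(i, V)\<in>{}. (h u i, h v i) \<in> V} = A \<times> A"
      by auto
    then show ?case using UNIV by simp
  next
    case (insert p \<V>)
    obtain i V where p: "p = (i, V)" by fastforce
    have "{(u, v) \<in> A \<times> A. \<forall>(i, V)\<in>insert p \<V>. (h u i, h v i) \<in> V} =
        {(u, v) \<in> A \<times> A. (h u i, h v i) \<in> V} \<inter> {(u, v) \<in> A \<times> A. \<forall>(i, V)\<in>\<V>. (h u i, h v i) \<in> V}"
      by (auto simp: p)
    then show ?case
      using Int[OF subbasic insert.IH] insert.prems by (auto simp: p)
  qed
  then show ?thesis
    using mono[OF _ E'] entourage_unif_ini_subset[OF E] by blast
qed

text \<open>If B is the full product, the uniformity on B is the product uniformity, and every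
  entourage on A comes from one there.\<close>

lemma unif_ini_pullback:
  assumes "E \<in> entourages (unif_ini I Y A h)" and h: "h \<in> A \<rightarrow> B"
  shows "\<exists>E'\<in>entourages (unif_ini I Y B (\<lambda>q. q)). {(u, v) \<in> A \<times> A. (h u, h v) \<in> E'} \<subseteq> E"
  using assms(1)
proof (induction rule: unif_ini_induct)
  case UNIV
  show ?case using unif_ini_UNIV[of B I Y "\<lambda>q. q"] by blast
next
  case (subbasic i V)
  show ?case
    by (rule bexI[OF _ subbasic_entourage[of i I V Y B "\<lambda>q. q", OF subbasic]]) (use h in auto)
next
  case (Int E E')
  then obtain W W' where "W \<in> entourages (unif_ini I Y B (\<lambda>q. q))" "{(u, v) \<in> A \<times> A. (h u, h v) \<in> W} \<subseteq> E"
    "W' \<in> entourages (unif_ini I Y B (\<lambda>q. q))" "{(u, v) \<in> A \<times> A. (h u, h v) \<in> W'} \<subseteq> E'"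
    by blast
  then show ?case
    by (intro bexI[OF _ unif_ini_Int[of W _ _ _ _ W']]) auto
next
  case (mono E E')
  then show ?case by blast
qed

context
  fixes I :: "'i set" and Y :: "'i \<Rightarrow> 'b uspace" and A :: "'a set" and h :: "'a \<Rightarrow> 'i \<Rightarrow> 'b"
  assumes Y: "\<And>i. i \<in> I \<Longrightarrow> uniform_structure (Y i)" and h: "h \<in> A \<rightarrow> (\<Pi>\<^sub>E i\<in>I. upoints (Y i))"
begin

lemma unif_ini_point: "\<lbrakk>u \<in> A; i \<in> I\<rbrakk> \<Longrightarrow> h u i \<in> upoints (Y i)"
  using h by (auto simp: PiE_def Pi_def)

lemma uniform_structure_unif_ini: "uniform_structure (unif_ini I Y A h)"
  unfolding uniform_structure_def upoints_unif_ini
proof (intro conjI ballI allI impI)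
  show "A \<times> A \<in> entourages (unif_ini I Y A h)" by (rule unif_ini_UNIV)
  fix E assume E: "E \<in> entourages (unif_ini I Y A h)"
  show "E \<subseteq> A \<times> A" by (rule entourage_unif_ini_subset[OF E])
  show "E' \<in> entourages (unif_ini I Y A h)" if "E \<subseteq> E' \<and> E' \<subseteq> A \<times> A" for E'
    using unif_ini_mono[OF E] that by blast
  show "E \<inter> E' \<in> entourages (unif_ini I Y A h)" if "E' \<in> entourages (unif_ini I Y A h)" for E'
    using unif_ini_Int[OF E that] .
  show "Id_on A \<subseteq> E"
    using E
  proof (induction rule: unif_ini_induct)
    case (subbasic i V)
    then show ?case
      using entourage_refl[OF Y] unif_ini_point by (auto simp: Id_on_def)
  qed auto
  show "E\<inverse> \<in> entourages (unif_ini I Y A h)"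
    using E
  proof (induction rule: unif_ini_induct)
    case UNIV
    show ?case using unif_ini_UNIV by (simp add: converse_Times)
  next
    case (subbasic i V)
    have "{(u, v) \<in> A \<times> A. (h u i, h v i) \<in> V}\<inverse> = {(u, v) \<in> A \<times> A. (h u i, h v i) \<in> V\<inverse>}"
      by auto
    then show ?case
      using subbasic_entourage[of i I "V\<inverse>" Y A h] entourage_converse[OF Y[OF subbasic(1)] subbasic(2)]
        subbasic(1) by simp
  next
    case (Int E E')
    then show ?case using unif_ini_Int by (simp add: converse_Int)
  next
    case (mono E E')
    show ?case by (rule unif_ini_mono[OF mono(1)]) (use mono(2,3) in auto)
  qed
  show "\<exists>W\<in>entourages (unif_ini I Y A h). W O W \<subseteq> E"
    using E
  proof (induction rule: unif_ini_induct)
    case UNIV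
    show ?case using unif_ini_UNIV[of A I Y h] by (intro bexI[of _ "A \<times> A"]) auto
  next
    case (subbasic i V)
    then obtain W where W: "W \<in> entourages (Y i)" "W O W \<subseteq> V"
      using entourage_comp[OF Y] by blast
    show ?case
      by (rule bexI[OF _ subbasic_entourage[of i I W Y A h, OF subbasic(1) W(1)]]) (use W(2) in blast)
  next
    case (Int E E')
    then obtain W W' where W: "W \<in> entourages (unif_ini I Y A h)" "W O W \<subseteq> E"
      "W' \<in> entourages (unif_ini I Y A h)" "W' O W' \<subseteq> E'"
      by blast
    show ?case
      by (rule bexI[OF _ unif_ini_Int[OF W(1,3)]]) (use W(2,4) in blast)
  next
    case (mono E E')
    then show ?case by blast
  qed
qed

lemma unif_continuous_unif_ini_proj:
  assumes i: "i \<in> I"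
  shows "unif_continuous (unif_ini I Y A h) (Y i) (\<lambda>u. h u i)"
  unfolding unif_continuous_def upoints_unif_ini
proof (intro conjI ballI)
  show "(\<lambda>u. h u i) \<in> A \<rightarrow> upoints (Y i)"
    using unif_ini_point[OF _ i] by (rule Pi_I)
  fix W assume "W \<in> entourages (Y i)"
  then show "{(u, v) \<in> A \<times> A. (h u i, h v i) \<in> W} \<in> entourages (unif_ini I Y A h)"
    by (rule subbasic_entourage[of i I W Y A h, OF i])
qed

lemma unif_continuous_into_unif_ini:
  assumes Z: "uniform_structure Z" and g: "g \<in> upoints Z \<rightarrow> A"
    and gi: "\<And>i. i \<in> I \<Longrightarrow> unif_continuous Z (Y i) (\<lambda>z. h (g z) i)"
  shows "unif_continuous Z (unif_ini I Y A h) g"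
  unfolding unif_continuous_def upoints_unif_ini
proof (intro conjI ballI g)
  fix E assume "E \<in> entourages (unif_ini I Y A h)"
  then show "{(z, z') \<in> upoints Z \<times> upoints Z. (g z, g z') \<in> E} \<in> entourages Z"
  proof (induction rule: unif_ini_induct)
    case UNIV
    have "{(z, z') \<in> upoints Z \<times> upoints Z. (g z, g z') \<in> A \<times> A} = upoints Z \<times> upoints Z"
      using g by auto
    then show ?case using entourage_UNIV[OF Z] by simp
  next
    case (subbasic i V)
    have "{(z, z') \<in> upoints Z \<times> upoints Z. (g z, g z') \<in> {(u, v) \<in> A \<times> A. (h u i, h v i) \<in> V}} =
        {(z, z') \<in> upoints Z \<times> upoints Z. (h (g z) i, h (g z') i) \<in> V}"
      using g by auto
    then show ?case using unif_continuous_entourage[OF gi[OF subbasic(1)] subbasic(2)] by simp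
  next
    case (Int E E')
    have "{(z, z') \<in> upoints Z \<times> upoints Z. (g z, g z') \<in> E \<inter> E'} =
        {(z, z') \<in> upoints Z \<times> upoints Z. (g z, g z') \<in> E} \<inter> {(z, z') \<in> upoints Z \<times> upoints Z. (g z, g z') \<in> E'}"
      by auto
    then show ?case using entourage_Int[OF Z Int] by simp
  next
    case (mono E E')
    show ?case by (rule entourage_mono[OF Z mono(1)]) (use mono(2) in auto)
  qed
qed

lemma Hausdorff_unif_ini:
  assumes "inj_on h A" and H: "\<And>i. i \<in> I \<Longrightarrow> Hausdorff_uspace (Y i)"
  shows "Hausdorff_uspace (unif_ini I Y A h)"
  unfolding Hausdorff_uspace_def upoints_unif_ini
proof (intro ballI impI)
  fix u v assume uv: "u \<in> A" "v \<in> A" "u \<noteq> v"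
  then have "h u \<noteq> h v" "h u \<in> (\<Pi>\<^sub>E i\<in>I. upoints (Y i))" "h v \<in> (\<Pi>\<^sub>E i\<in>I. upoints (Y i))"
    using assms(1) h by (auto dest: inj_onD)
  then obtain i where i: "i \<in> I" "h u i \<noteq> h v i" by (metis PiE_ext)
  then obtain V where "V \<in> entourages (Y i)" "(h u i, h v i) \<notin> V"
    using H[OF i(1)] unif_ini_point uv unfolding Hausdorff_uspace_def by meson
  then show "\<exists>V\<in>entourages (unif_ini I Y A h). (u, v) \<notin> V"
    using subbasic_entourage[of i I V Y A h, OF i(1)] by (intro bexI) auto
qed

text \<open>Entourages on A are pulled back along h, so closeness in the product to a point h(v) of
  S becomes closeness to v. This brings density of the orbits to the transported copy.\<close>

lemma uclosure_unif_ini: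
  assumes "u \<in> A" "S \<subseteq> h ` A" "h u \<in> uclosure (unif_ini I Y (\<Pi>\<^sub>E i\<in>I. upoints (Y i)) (\<lambda>q. q)) S"
  shows "u \<in> uclosure (unif_ini I Y A h) {u \<in> A. h u \<in> S}"
  unfolding uclosure_def upoints_unif_ini
proof (intro CollectI conjI ballI assms(1))
  fix E assume "E \<in> entourages (unif_ini I Y A h)"
  from unif_ini_pullback[OF this h]
  obtain E' where E': "E' \<in> entourages (unif_ini I Y (\<Pi>\<^sub>E i\<in>I. upoints (Y i)) (\<lambda>q. q))"
    "{(u, v) \<in> A \<times> A. (h u, h v) \<in> E'} \<subseteq> E" by blast
  obtain d where "d \<in> S" "(h u, d) \<in> E'"
    using assms(3) E'(1) by (rule uclosureE)
  moreover from this obtain v where "v \<in> A" "d = h v"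
    using assms(2) by blast
  ultimately show "\<exists>v\<in>{u \<in> A. h u \<in> S}. (u, v) \<in> E"
    using E'(2) assms(1) by blast
qed

text \<open>The coordinate images of a Cauchy filter are Cauchy and so have limits, which together
  form a point of the product. The filter is eventually near this point, so the point belongs to the
  closure of \<open>h\<close> A\<open>, hence to\<close>h \<open>A\<close> itself. Its preimage is a
  limit, since coordinate conditions generate the entourages.\<close>

lemma complete_unif_ini:
  assumes complete: "\<And>i. i \<in> I \<Longrightarrow> complete_uspace (Y i)"
    and closed: "uclosure (unif_ini I Y (\<Pi>\<^sub>E i\<in>I. upoints (Y i)) (\<lambda>q. q)) (h ` A) \<subseteq> h ` A"
  shows "complete_uspace (unif_ini I Y A h)"
  unfolding complete_uspace_def upoints_unif_ini
proof (intro allI impI, elim conjE)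
  fix F :: "'a filter"
  assume bot: "F \<noteq> bot" and "F \<le> principal A"
    and Cauchy: "\<forall>V\<in>entourages (unif_ini I Y A h). eventually (\<lambda>p. p \<in> V) (F \<times>\<^sub>F F)"
  then have FA: "eventually (\<lambda>u. u \<in> A) F"
    by (simp add: le_principal)
  have "\<exists>x\<in>upoints (Y i). \<forall>V\<in>entourages (Y i). eventually (\<lambda>u. (x, h u i) \<in> V) F" if i: "i \<in> I" for i
  proof -
    let ?G = "filtermap (\<lambda>u. h u i) F"
    have "?G \<noteq> bot"
      using bot by (simp add: filtermap_bot_iff)
    moreover have "?G \<le> principal (upoints (Y i))"
      unfolding le_principal eventually_filtermap
      using FA by (rule eventually_mono) (rule unif_ini_point[OF _ i])
    moreover have "eventually (\<lambda>p. p \<in> V) (?G \<times>\<^sub>F ?G)" if V: "V \<in> entourages (Y i)" for V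
    proof -
      have "eventually (\<lambda>p. p \<in> {(u, v) \<in> A \<times> A. (h u i, h v i) \<in> V}) (F \<times>\<^sub>F F)"
        using Cauchy subbasic_entourage[of i I V Y A h, OF i V] by blast
      then obtain R S where "eventually R F" "eventually S F"
        "\<And>u v. R u \<Longrightarrow> S v \<Longrightarrow> (h u i, h v i) \<in> V"
        unfolding eventually_prod_filter by auto
      \<comment> \<open>The two predicates that witness smallness in the image filter are the images
        of R and S under the coordinate map.\<close>
      then show ?thesis
        unfolding eventually_prod_filter eventually_filtermap
        by (intro exI[of _ "\<lambda>y. \<exists>u. R u \<and> y = h u i"] exI[of _ "\<lambda>y. \<exists>u. S u \<and> y = h u i"])
          (auto elim: eventually_mono)
    qed
    ultimately have "\<exists>x\<in>upoints (Y i). \<forall>V\<in>entourages (Y i). eventually (\<lambda>y. (x, y) \<in> V) ?G"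
      using complete[OF i, unfolded complete_uspace_def, THEN spec[of _ ?G]] by simp
    then show ?thesis
      by (simp add: eventually_filtermap)
  qed
  then obtain x where x: "\<And>i. i \<in> I \<Longrightarrow> x i \<in> upoints (Y i)"
    and lim: "\<And>i V. \<lbrakk>i \<in> I; V \<in> entourages (Y i)\<rbrakk> \<Longrightarrow> eventually (\<lambda>u. (x i, h u i) \<in> V) F"
    by metis
  let ?x = "\<lambda>i\<in>I. x i"
  have x_in: "?x \<in> (\<Pi>\<^sub>E i\<in>I. upoints (Y i))"
    using x by auto
  have "?x \<in> uclosure (unif_ini I Y (\<Pi>\<^sub>E i\<in>I. upoints (Y i)) (\<lambda>q. q)) (h ` A)"
    unfolding uclosure_def upoints_unif_ini
  proof (intro CollectI conjI ballI x_in)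
    fix E assume "E \<in> entourages (unif_ini I Y (\<Pi>\<^sub>E i\<in>I. upoints (Y i)) (\<lambda>q. q))"
    then have "eventually (\<lambda>u. (?x, h u) \<in> E) F"
    proof (induction rule: unif_ini_induct)
      case UNIV
      show ?case using FA by (rule eventually_mono) (use x_in h in auto)
    next
      case (subbasic i V)
      show ?case
        using eventually_conj[OF FA lim[OF subbasic]]
        by (rule eventually_mono) (use x_in h subbasic in auto)
    next
      case (Int E E')
      show ?case using eventually_conj[OF Int] by (rule eventually_mono) auto
    next
      case (mono E E')
      show ?case using mono(1) by (rule eventually_mono) (use mono(2) in auto)
    qed
    then have "\<exists>u. u \<in> A \<and> (?x, h u) \<in> E"
      using eventually_happens'[OF bot eventually_conj[OF FA]] by blast
    then show "\<exists>d\<in>h ` A. (?x, d) \<in> E" by blast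
  qed
  then obtain a where a: "a \<in> A" "?x = h a"
    using closed by blast
  have "eventually (\<lambda>u. (a, u) \<in> E) F" if "E \<in> entourages (unif_ini I Y A h)" for E
    using that
  proof (induction rule: unif_ini_induct)
    case UNIV
    show ?case using FA by (rule eventually_mono) (use a in auto)
  next
    case (subbasic i V)
    have "h a i = x i" using a(2)[symmetric] subbasic(1) by simp
    with eventually_conj[OF FA lim[OF subbasic]] show ?case
      by (auto elim!: eventually_mono simp: a(1))
  next
    case (Int E E')
    show ?case using eventually_conj[OF Int] by (rule eventually_mono) auto
  next
    case (mono E E')
    show ?case using mono(1) by (rule eventually_mono) (use mono(2) in auto)
  qed
  then show "\<exists>x\<in>A. \<forall>V\<in>entourages (unif_ini I Y A h). eventually (\<lambda>y. (x, y) \<in> V) F"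
    using a(1) by blast
qed

end

section \<open>Monadicity over uniform spaces\<close>

lemma concrete_Unif: "concrete upoints unif_continuous (\<lambda>X. uniform_structure X \<and> P X)"
proof
  show "unif_continuous X Y f \<Longrightarrow> f \<in> upoints X \<rightarrow> upoints Y" for X Y :: "'a uspace" and f
    by (simp add: unif_continuous_def)
  show "unif_continuous X Y g" if "unif_continuous X Y f" "\<And>x. x \<in> upoints X \<Longrightarrow> f x = g x"
    for X Y :: "'a uspace" and f g
    using that by (rule unif_continuous_cong)
  show "unif_continuous X X (\<lambda>x. x)" if "uniform_structure X \<and> P X" for X :: "'a uspace"
    using that by (intro unif_continuous_id) simp
  show "unif_continuous X Z (\<lambda>x. g (f x))" if "unif_continuous X Y f" "unif_continuous Y Z g"
    for X Y Z :: "'a uspace" and f g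
    using that by (rule unif_continuous_compose)
qed

text \<open>The structural half of \<open>initial_flows\<close> is the same for every constraint;
  the two inheritance assumptions are what each constraint has to supply. Assumptions are
  monomorphic in types, so the index set has the type of \<open>arrows\<close>.\<close>

lemma initial_flows_Unif:
  fixes M :: "('m, 'r) monoid_scheme" and F :: "'u uspace \<Rightarrow> ('m \<Rightarrow> 'u \<Rightarrow> 'u) \<Rightarrow> bool"
  assumes M: "Group.monoid M"
    and ini: "\<And>(I :: (('u uspace \<times> ('m \<Rightarrow> 'u \<Rightarrow> 'u)) \<times> ('u \<Rightarrow> 'u)) set) Y A h \<beta> \<gamma>. \<lbrakk>\<And>i. i \<in> I \<Longrightarrow> uniform_structure (Y i); h \<in> A \<rightarrow> (\<Pi>\<^sub>E i\<in>I. upoints (Y i));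
      \<And>i. i \<in> I \<Longrightarrow> F (Y i) (\<beta> i); \<And>s u. \<lbrakk>s \<in> carrier M; u \<in> A\<rbrakk> \<Longrightarrow> \<gamma> s u \<in> A;
      \<And>s u i. \<lbrakk>s \<in> carrier M; u \<in> A; i \<in> I\<rbrakk> \<Longrightarrow> h (\<gamma> s u) i = \<beta> i s (h u i)\<rbrakk> \<Longrightarrow> F (unif_ini I Y A h) \<gamma>"
    and retract: "\<And>X Y \<beta> j r \<gamma>. \<lbrakk>uniform_structure X; uniform_structure Y; F Y \<beta>; unif_continuous X Y j;
      unif_continuous Y X r; \<And>s x. \<lbrakk>s \<in> carrier M; x \<in> upoints X\<rbrakk> \<Longrightarrow> \<gamma> s x = r (\<beta> s (j x));
      \<And>x. x \<in> upoints X \<Longrightarrow> r (j x) = x\<rbrakk> \<Longrightarrow> F X \<gamma>"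
  shows "initial_flows upoints unif_continuous (\<lambda>X. uniform_structure X \<and> P X) M F unif_ini"
proof -
  interpret concrete upoints unif_continuous "\<lambda>X. uniform_structure X \<and> P X" by (rule concrete_Unif)
  show ?thesis
    apply (intro initial_flows.intro initial_flows_axioms.intro concrete_flows.intro
        concrete_flows_axioms.intro concrete_axioms M)
    subgoal by simp
    subgoal premises p for I Y h A i
      by (rule unif_continuous_unif_ini_proj[OF p(1)[THEN conjunct1] p(2,3)])
    subgoal premises p for I Y h A Z g
      by (rule unif_continuous_into_unif_ini[OF p(1)[THEN conjunct1] p(2) p(3)[THEN conjunct1] p(4,5)])
    subgoal premises p for I Y h A \<beta> \<gamma>
      by (rule ini[where h = h and A = A and \<beta> = \<beta> and \<gamma> = \<gamma>]) (fact p p(1)[THEN conjunct1])+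
    subgoal premises p for X Y \<beta> j r \<gamma>
      by (rule retract[where Y = Y and \<beta> = \<beta> and j = j and r = r and \<gamma> = \<gamma>])
        (fact p p(1)[THEN conjunct1] p(2)[THEN conjunct1])+
    done
qed

lemma monadic_Unif_hereditary:
  fixes P :: "'u uspace \<Rightarrow> bool"
  assumes size: "strong_limit TYPE('u)" "carrier M \<prec> (UNIV :: 'u set)"
    and flows: "initial_flows upoints unif_continuous (\<lambda>X. uniform_structure X \<and> P X) M F unif_ini"
    and P: "P \<in> {\<lambda>_. True, Hausdorff_uspace}"
  shows "monadic (flow_category (Unif P) M F) (Unif P) forgetful"
  unfolding Unif_def
proof (rule initial_flows.monadic_flows_hereditary[OF flows size])
  fix I and Y :: "_ \<Rightarrow> 'u uspace" and A :: "'u set" and h :: "'u \<Rightarrow> _ \<Rightarrow> 'u"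
  assume Y: "\<And>i. i \<in> I \<Longrightarrow> uniform_structure (Y i) \<and> P (Y i)" and inj: "inj_on h A"
    and "h ` A \<subseteq> (\<Pi>\<^sub>E i\<in>I. upoints (Y i))"
  then have h: "h \<in> A \<rightarrow> (\<Pi>\<^sub>E i\<in>I. upoints (Y i))"
    by blast
  note US = Y[THEN conjunct1]
  have "P (unif_ini I Y A h)"
    using P
  proof (elim insertE emptyE)
    assume P: "P = Hausdorff_uspace"
    show ?thesis
      unfolding P by (rule Hausdorff_unif_ini[OF US h inj]) (use Y P in auto)
  qed simp
  then show "uniform_structure (unif_ini I Y A h) \<and> P (unif_ini I Y A h)"
    using uniform_structure_unif_ini[OF US h] by blast
qed

lemma monadic_Unif_complete_Hausdorff:
  fixes F :: "'u uspace \<Rightarrow> _"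
  assumes size: "strong_limit TYPE('u)" "carrier M \<prec> (UNIV :: 'u set)"
    and flows: "initial_flows upoints unif_continuous
      (\<lambda>X. uniform_structure X \<and> Hausdorff_uspace X \<and> complete_uspace X) M F unif_ini"
  shows "monadic (flow_category (Unif (\<lambda>X. Hausdorff_uspace X \<and> complete_uspace X)) M F)
    (Unif (\<lambda>X. Hausdorff_uspace X \<and> complete_uspace X)) forgetful"
  unfolding Unif_def
proof -
  interpret initial_flows upoints unif_continuous
    "\<lambda>X. uniform_structure X \<and> Hausdorff_uspace X \<and> complete_uspace X" M F unif_ini
    by (rule flows)
  show "monadic D C forgetful"
  proof (rule monadic_flows)
    fix X assume X: "X \<in> Ob C"
    define B where "B = (\<Pi>\<^sub>E i\<in>arrows X. upoints (target i))"
    define W where "W = unif_ini (arrows X) target B (\<lambda>q. q)"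
    \<comment> \<open>The closure is taken in the product uniformity: being closed there makes the
      copy complete, and Hausdorffness of the product bounds its cardinality.\<close>
    define Q0 where "Q0 = uclosure W (orbits X)"
    have US: "uniform_structure (target i)" and HS: "Hausdorff_uspace (target i)"
      and CS: "complete_uspace (target i)" if "i \<in> arrows X" for i
      using arrows_P[OF that] by simp_all
    have id: "(\<lambda>q. q) \<in> B \<rightarrow> (\<Pi>\<^sub>E i\<in>arrows X. upoints (target i))"
      by (simp add: B_def)
    have W: "uniform_structure W" "Hausdorff_uspace W"
      unfolding W_def
      by (rule uniform_structure_unif_ini[OF US id], assumption)
        (rule Hausdorff_unif_ini[OF US id _ HS], simp_all)
    have sub: "orbits X \<subseteq> Q0"
      unfolding Q0_def using orbits_subset by (intro uclosure_superset W) (simp add: W_def B_def)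
    have Q0: "Q0 \<subseteq> B"
      unfolding Q0_def uclosure_def W_def by auto
    have "flow_hull X Q0"
      unfolding flow_hull_def
    proof (intro conjI ballI allI impI)
      show "orbits X \<subseteq> Q0" by (rule sub)
      show "Q0 \<subseteq> (\<Pi>\<^sub>E i\<in>arrows X. upoints (target i))" using Q0 by (simp add: B_def)
      show "act X s q \<in> Q0" if s: "s \<in> carrier M" and q: "q \<in> Q0" for s q
      proof -
        have "unif_continuous W W (act X s)"
          unfolding W_def
        proof (rule unif_continuous_into_unif_ini[OF US id])
          show "uniform_structure (unif_ini (arrows X) target B (\<lambda>q. q))"
            using W by (simp add: W_def)
          have in_target: "snd (fst i) s (q i) \<in> upoints (target i)"
            if "q \<in> B" "i \<in> arrows X" for q i
            using mor_in[OF flow_mor[OF arrows_flow[OF that(2)] s]] that by (auto simp: B_def)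
          then show "act X s \<in> upoints (unif_ini (arrows X) target B (\<lambda>q. q)) \<rightarrow> B"
            unfolding act_def upoints_unif_ini by (intro Pi_I) (subst B_def, rule restrict_PiE_iff[THEN iffD2], blast)
          fix i assume i: "i \<in> arrows X"
          have "unif_continuous (unif_ini (arrows X) target B (\<lambda>q. q)) (target i) (\<lambda>q. q i)"
            by (rule unif_continuous_unif_ini_proj[OF US id i])
          from unif_continuous_compose[OF this flow_mor[OF arrows_flow[OF i] s]]
          show "unif_continuous (unif_ini (arrows X) target B (\<lambda>q. q)) (target i) (\<lambda>q. act X s q i)"
            using i by (simp add: act_def)
        qed
        \<comment> \<open>Uniformly continuous maps respect closures, so invariance passes from the
          orbits to Q0.\<close>
        then have "act X s ` Q0 \<subseteq> uclosure W (act X s ` orbits X)"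
          unfolding Q0_def by (rule unif_continuous_image_uclosure)
        also have "\<dots> \<subseteq> Q0"
          unfolding Q0_def using act_orbits[OF s] by (intro uclosure_mono) blast
        finally show ?thesis using q by blast
      qed
      have "orbits X \<prec> (UNIV :: 'u set)"
        using X size by (auto intro!: lesspoll_trans1[OF orbits_lepoll] Times_lesspoll strong_limit_infinite)
      then show "Q0 \<prec> (UNIV :: 'u set)"
        unfolding Q0_def
        by (intro lesspoll_trans1[OF Hausdorff_uclosure_lepoll[OF W]] Pow_lesspoll size)
      fix A :: "'u set" and h assume "bij_betw h A Q0"
      then have inj: "inj_on h A" and hA: "h ` A = Q0" by (auto simp: bij_betw_def)
      then have h: "h \<in> A \<rightarrow> (\<Pi>\<^sub>E i\<in>arrows X. upoints (target i))"
        using Q0 by (auto simp: B_def)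
      show US_ini: "uniform_structure (unif_ini (arrows X) target A h)"
        by (rule uniform_structure_unif_ini[OF US h])
      show "Hausdorff_uspace (unif_ini (arrows X) target A h)"
        by (rule Hausdorff_unif_ini[OF US h inj HS])
      show "complete_uspace (unif_ini (arrows X) target A h)"
      proof (rule complete_unif_ini[OF US h CS])
        show "uclosure (unif_ini (arrows X) target (\<Pi>\<^sub>E i\<in>arrows X. upoints (target i)) (\<lambda>q. q)) (h ` A) \<subseteq> h ` A"
          using uclosure_uclosure[OF W(1), of "orbits X"] by (simp add: hA Q0_def W_def B_def)
      qed
      show "dense_orbits X A h"
        unfolding dense_orbits_def
      proof (intro allI impI ballI)
        fix Y g g' u
        assume Y: "uniform_structure Y \<and> Hausdorff_uspace Y \<and> complete_uspace Y"
          and g: "unif_continuous (unif_ini (arrows X) target A h) Y g"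
          and g': "unif_continuous (unif_ini (arrows X) target A h) Y g'"
          and eq: "\<forall>u\<in>A. h u \<in> orbits X \<longrightarrow> g u = g' u" and u: "u \<in> A"
        have "u \<in> uclosure (unif_ini (arrows X) target A h) {u \<in> A. h u \<in> orbits X}"
          using u hA sub by (intro uclosure_unif_ini[OF US h]) (auto simp: Q0_def W_def B_def)
        then show "g u = g' u"
          by (rule unif_continuous_eq_on_uclosure[OF US_ini _ _ g g', rotated 3]) (use Y eq in auto)
      qed
    qed
    then show "\<exists>Q0. flow_hull X Q0" ..
  qed
qed

lemma monadic_Unif:
  fixes P :: "'u uspace \<Rightarrow> bool"
  assumes size: "strong_limit TYPE('u)" "carrier M \<prec> (UNIV :: 'u set)"
    and flows: "\<And>P. initial_flows upoints unif_continuous (\<lambda>X :: 'u uspace. uniform_structure X \<and> P X) M F unif_ini"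
    and P: "P \<in> {\<lambda>_. True, Hausdorff_uspace, \<lambda>X. Hausdorff_uspace X \<and> complete_uspace X}"
  shows "monadic (flow_category (Unif P) M F) (Unif P) forgetful"
\<comment> \<open>Completeness is the one condition that need not hold for the space of orbits, so
  this case goes through the closure.\<close>
proof (cases "P = (\<lambda>X. Hausdorff_uspace X \<and> complete_uspace X)")
  case True
  then show ?thesis
    using monadic_Unif_complete_Hausdorff[OF size flows] by simp
next
  case False
  then show ?thesis
    using P by (intro monadic_Unif_hereditary[OF size flows]) blast
qed

section \<open>Inheritance of uniform continuity constraints\<close>

lemma sub_uspace_entourage_subset:
  "\<lbrakk>uniform_structure \<U>; V \<in> entourages (sub_uspace \<U> S)\<rbrakk> \<Longrightarrow>
    V \<subseteq> upoints (sub_uspace \<U> S) \<times> upoints (sub_uspace \<U> S)"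
  using entourage_subset[of \<U>] by (auto simp: sub_uspace_def)

lemma uniform_structureI:
  assumes "upoints X \<times> upoints X \<in> entourages X"
    and "\<And>V. V \<in> entourages X \<Longrightarrow> V \<subseteq> upoints X \<times> upoints X"
    and "\<And>V x. \<lbrakk>V \<in> entourages X; x \<in> upoints X\<rbrakk> \<Longrightarrow> (x, x) \<in> V"
    and "\<And>V W. \<lbrakk>V \<in> entourages X; V \<subseteq> W; W \<subseteq> upoints X \<times> upoints X\<rbrakk> \<Longrightarrow> W \<in> entourages X"
    and "\<And>V W. \<lbrakk>V \<in> entourages X; W \<in> entourages X\<rbrakk> \<Longrightarrow> V \<inter> W \<in> entourages X"
    and "\<And>V. V \<in> entourages X \<Longrightarrow> V\<inverse> \<in> entourages X"
    and "\<And>V. V \<in> entourages X \<Longrightarrow> \<exists>W\<in>entourages X. W O W \<subseteq> V"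
  shows "uniform_structure X"
  unfolding uniform_structure_def by (intro conjI ballI allI impI; (rule assms Id_onI subsetI)?) (auto intro: assms)

text \<open>Testing uniform continuity into an initial uniformity in each coordinate uses the filter
  axioms of the source. The sources occurring in the constraints are subspaces of the monoid and
  products of these with the flow, so both must be shown to be uniform spaces.\<close>

lemma uniform_structure_sub_uspace:
  assumes \<U>: "uniform_structure \<U>"
  shows "uniform_structure (sub_uspace \<U> S)"
proof -
  have pts: "upoints (sub_uspace \<U> S) = upoints \<U> \<inter> S"
    by (simp add: sub_uspace_def)
  have I: "V \<inter> (S \<times> S) \<in> entourages (sub_uspace \<U> S)" if "V \<in> entourages \<U>" for V
    using that by (auto simp: sub_uspace_def)
  have E: thesis if "V \<in> entourages (sub_uspace \<U> S)"
    "\<And>V'. \<lbrakk>V' \<in> entourages \<U>; V = V' \<inter> (S \<times> S)\<rbrakk> \<Longrightarrow> thesis" for V thesis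
    using that by (auto simp: sub_uspace_def)
  show ?thesis
  proof (rule uniform_structureI; (unfold pts)?)
    have "(upoints \<U> \<inter> S) \<times> (upoints \<U> \<inter> S) = (upoints \<U> \<times> upoints \<U>) \<inter> (S \<times> S)"
      by blast
    then show "(upoints \<U> \<inter> S) \<times> (upoints \<U> \<inter> S) \<in> entourages (sub_uspace \<U> S)"
      using I[OF entourage_UNIV[OF \<U>]] by simp
    fix V assume V: "V \<in> entourages (sub_uspace \<U> S)"
    obtain V' where V': "V' \<in> entourages \<U>" "V = V' \<inter> (S \<times> S)"
      using V by (rule E)
    show "V \<subseteq> (upoints \<U> \<inter> S) \<times> (upoints \<U> \<inter> S)"
      using entourage_subset[OF \<U> V'(1)] V'(2) by blast
    show "(x, x) \<in> V" if "x \<in> upoints \<U> \<inter> S" for x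
      using entourage_refl[OF \<U> V'(1)] V'(2) that by blast
    show "W \<in> entourages (sub_uspace \<U> S)"
      if W: "V \<subseteq> W" "W \<subseteq> (upoints \<U> \<inter> S) \<times> (upoints \<U> \<inter> S)" for W
    proof -
      \<comment> \<open>A relation on the subspace above the trace of V' is itself a trace, namely
        of its union with V'.\<close>
      have "V' \<union> W \<in> entourages \<U>"
        by (rule entourage_mono[OF \<U> V'(1)]) (use W entourage_subset[OF \<U> V'(1)] in auto)
      moreover have "W = (V' \<union> W) \<inter> (S \<times> S)"
        using W V'(2) by blast
      ultimately show ?thesis using I by metis
    qed
    show "V \<inter> W \<in> entourages (sub_uspace \<U> S)" if W: "W \<in> entourages (sub_uspace \<U> S)" for W
    proof -
      obtain W' where W': "W' \<in> entourages \<U>" "W = W' \<inter> (S \<times> S)"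
        using W by (rule E)
      have "V \<inter> W = (V' \<inter> W') \<inter> (S \<times> S)"
        using V'(2) W'(2) by blast
      then show ?thesis using I[OF entourage_Int[OF \<U> V'(1) W'(1)]] by simp
    qed
    have "V\<inverse> = V'\<inverse> \<inter> (S \<times> S)"
      using V'(2) by blast
    then show "V\<inverse> \<in> entourages (sub_uspace \<U> S)"
      using I[OF entourage_converse[OF \<U> V'(1)]] by simp
    obtain W where "W \<in> entourages \<U>" "W O W \<subseteq> V'"
      using entourage_comp[OF \<U> V'(1)] by blast
    then show "\<exists>W\<in>entourages (sub_uspace \<U> S). W O W \<subseteq> V"
      using V'(2) by (intro bexI[OF _ I]) auto
  qed
qed

lemma uniform_structure_prod_uspace:
  assumes X: "uniform_structure X" and Y: "uniform_structure Y"
  shows "uniform_structure (prod_uspace X Y)"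
proof -
  let ?R = "\<lambda>V W. {((x, y), (x', y')) |x y x' y'. (x, x') \<in> V \<and> (y, y') \<in> W}"
  have E: thesis if "E \<in> entourages (prod_uspace X Y)"
    "\<And>V W. \<lbrakk>V \<in> entourages X; W \<in> entourages Y; ?R V W \<subseteq> E\<rbrakk> \<Longrightarrow> thesis" for E thesis
    using that by (auto simp: prod_uspace_def)
  have pts: "upoints (prod_uspace X Y) = upoints X \<times> upoints Y"
    by (simp add: prod_uspace_def)
  have R: "?R V W \<subseteq> upoints (prod_uspace X Y) \<times> upoints (prod_uspace X Y)"
    if "V \<in> entourages X" "W \<in> entourages Y" for V W
    using entourage_subset[OF X that(1)] entourage_subset[OF Y that(2)] by (auto simp: pts)
  have RI: "?R V W \<in> entourages (prod_uspace X Y)" if "V \<in> entourages X" "W \<in> entourages Y" for V W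
    using that R by (intro entourage_prodI) auto
  show ?thesis
  proof (rule uniform_structureI)
    show "upoints (prod_uspace X Y) \<times> upoints (prod_uspace X Y) \<in> entourages (prod_uspace X Y)"
      by (rule entourage_prodI[OF entourage_UNIV[OF X] entourage_UNIV[OF Y]]) (auto simp: pts)
    fix E assume E': "E \<in> entourages (prod_uspace X Y)"
    obtain V W where V: "V \<in> entourages X" and W: "W \<in> entourages Y" and VW: "?R V W \<subseteq> E"
      using E' by (rule E)
    show E_sub: "E \<subseteq> upoints (prod_uspace X Y) \<times> upoints (prod_uspace X Y)"
      using E' by (simp add: prod_uspace_def)
    show "(p, p) \<in> E" if "p \<in> upoints (prod_uspace X Y)" for p
      using that VW entourage_refl[OF X V] entourage_refl[OF Y W] by (auto simp: pts)
    show "E2 \<in> entourages (prod_uspace X Y)"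
      if "E \<subseteq> E2" "E2 \<subseteq> upoints (prod_uspace X Y) \<times> upoints (prod_uspace X Y)" for E2
      by (rule entourage_prodI[OF V W order_trans[OF VW that(1)] that(2)])
    show "E \<inter> E2 \<in> entourages (prod_uspace X Y)" if "E2 \<in> entourages (prod_uspace X Y)" for E2
    proof -
      obtain V2 W2 where V2: "V2 \<in> entourages X" and W2: "W2 \<in> entourages Y" and "?R V2 W2 \<subseteq> E2"
        using \<open>E2 \<in> _\<close> by (rule E)
      then have "?R (V \<inter> V2) (W \<inter> W2) \<subseteq> E \<inter> E2"
        using VW by auto
      then show ?thesis
        by (rule entourage_prodI[OF entourage_Int[OF X V V2] entourage_Int[OF Y W W2]]) (use E_sub in blast)
    qed
    have "?R (V\<inverse>) (W\<inverse>) \<subseteq> E\<inverse>"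
      using VW by auto
    then show "E\<inverse> \<in> entourages (prod_uspace X Y)"
      by (rule entourage_prodI[OF entourage_converse[OF X V] entourage_converse[OF Y W]]) (use E_sub in blast)
    obtain V' where V': "V' \<in> entourages X" "V' O V' \<subseteq> V"
      using entourage_comp[OF X V] by blast
    obtain W' where W': "W' \<in> entourages Y" "W' O W' \<subseteq> W"
      using entourage_comp[OF Y W] by blast
    have "?R V' W' O ?R V' W' \<subseteq> ?R V W"
      by (auto intro!: subsetD[OF V'(2)] subsetD[OF W'(2)] intro: relcompI)
    then show "\<exists>E'\<in>entourages (prod_uspace X Y). E' O E' \<subseteq> E"
      using VW by (intro bexI[OF _ RI[OF V'(1) W'(1)]]) (rule order_trans)
  qed
qed

text \<open>As for topologies, everything is tested in each coordinate, where \<gamma> is \<beta>(i)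
  after a uniformly continuous projection.\<close>

lemma unif_constraint_ini:
  assumes \<U>: "uniform_structure \<U>" "upoints \<U> \<subseteq> carrier M"
    and Y: "\<And>i. i \<in> I \<Longrightarrow> uniform_structure (Y i)" and h: "h \<in> A \<rightarrow> (\<Pi>\<^sub>E i\<in>I. upoints (Y i))"
    and \<beta>: "\<And>i. i \<in> I \<Longrightarrow> unif_constraint \<U> \<S> \<J> (Y i) (\<beta> i)"
    and \<gamma>: "\<And>s u. \<lbrakk>s \<in> carrier M; u \<in> A\<rbrakk> \<Longrightarrow> \<gamma> s u \<in> A"
      "\<And>s u i. \<lbrakk>s \<in> carrier M; u \<in> A; i \<in> I\<rbrakk> \<Longrightarrow> h (\<gamma> s u) i = \<beta> i s (h u i)"
  shows "unif_constraint \<U> \<S> \<J> (unif_ini I Y A h) \<gamma>"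
  unfolding unif_constraint_def separately_unif_continuous_def
proof (intro conjI ballI)
  let ?Q = "unif_ini I Y A h"
  have Q: "uniform_structure ?Q" by (rule uniform_structure_unif_ini[OF Y h])
  note into = unif_continuous_into_unif_ini[OF Y h] and proj = unif_continuous_unif_ini_proj[OF Y h]
    and sub = uniform_structure_sub_uspace[OF \<U>(1)]
  have hu: "h u i \<in> upoints (Y i)" if "u \<in> A" "i \<in> I" for u i
    using h that by (auto simp: PiE_def Pi_def)
  have sM: "s \<in> carrier M" if "s \<in> upoints (sub_uspace \<U> S)" for s S
    using that \<U>(2) by (auto simp: sub_uspace_def)
  show "unif_continuous ?Q ?Q (\<gamma> s)" if S: "S \<in> \<S>" and s: "s \<in> upoints (sub_uspace \<U> S)" for S s
  proof (rule into[OF _ Q])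
    show "\<gamma> s \<in> upoints ?Q \<rightarrow> A" using \<gamma>(1) sM[OF s] by simp
    fix i assume i: "i \<in> I"
    have "unif_continuous (Y i) (Y i) (\<beta> i s)"
      using \<beta>[OF i] S s unfolding unif_constraint_def separately_unif_continuous_def by blast
    from unif_continuous_compose[OF proj[OF _ i] this]
    show "unif_continuous ?Q (Y i) (\<lambda>u. h (\<gamma> s u) i)"
      by (rule unif_continuous_cong) (simp_all add: \<gamma>(2) sM[OF s] i)
  qed
  show "unif_continuous (sub_uspace \<U> S) ?Q (\<lambda>s. \<gamma> s u)" if S: "S \<in> \<S>" and u: "u \<in> upoints ?Q" for S u
  proof (rule into[OF _ sub])
    show "(\<lambda>s. \<gamma> s u) \<in> upoints (sub_uspace \<U> S) \<rightarrow> A"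
      using \<gamma>(1) u sM by auto
    fix i assume i: "i \<in> I"
    have "unif_continuous (sub_uspace \<U> S) (Y i) (\<lambda>s. \<beta> i s (h u i))"
      using \<beta>[OF i] S u hu i unfolding unif_constraint_def separately_unif_continuous_def by simp
    then show "unif_continuous (sub_uspace \<U> S) (Y i) (\<lambda>s. h (\<gamma> s u) i)"
      by (rule unif_continuous_cong) (use \<gamma>(2) u sM i in auto)
  qed
  show "unif_continuous (prod_uspace (sub_uspace \<U> J) ?Q) ?Q (\<lambda>(s, u). \<gamma> s u)" if J: "J \<in> \<J>" for J
  proof (rule into[OF _ uniform_structure_prod_uspace[OF sub Q]])
    have pts: "upoints (prod_uspace (sub_uspace \<U> J) ?Q) = upoints (sub_uspace \<U> J) \<times> A"
      by (simp add: prod_uspace_def)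
    show "(\<lambda>(s, u). \<gamma> s u) \<in> upoints (prod_uspace (sub_uspace \<U> J) ?Q) \<rightarrow> A"
      using \<gamma>(1) sM unfolding pts by auto
    fix i assume i: "i \<in> I"
    have "unif_continuous (prod_uspace (sub_uspace \<U> J) (Y i)) (Y i) (\<lambda>(s, y). \<beta> i s y)"
      using \<beta>[OF i] J unfolding unif_constraint_def by blast
    from unif_continuous_compose[OF
        unif_continuous_prod_right[OF sub_uspace_entourage_subset[OF \<U>(1)] proj[OF _ i] Q] this]
    show "unif_continuous (prod_uspace (sub_uspace \<U> J) ?Q) (Y i) (\<lambda>z. h (case z of (s, u) \<Rightarrow> \<gamma> s u) i)"
      by (rule unif_continuous_cong) (unfold pts, use \<gamma>(2) sM i in auto)
  qed
qed

lemma unif_constraint_retract: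
  assumes \<U>: "uniform_structure \<U>" "upoints \<U> \<subseteq> carrier M"
    and X: "uniform_structure X" and \<beta>: "unif_constraint \<U> \<S> \<J> Y \<beta>"
    and j: "unif_continuous X Y j" and r: "unif_continuous Y X r"
    and \<gamma>: "\<And>s x. \<lbrakk>s \<in> carrier M; x \<in> upoints X\<rbrakk> \<Longrightarrow> \<gamma> s x = r (\<beta> s (j x))"
  shows "unif_constraint \<U> \<S> \<J> X \<gamma>"
  unfolding unif_constraint_def separately_unif_continuous_def
proof (intro conjI ballI)
  have sM: "s \<in> carrier M" if "s \<in> upoints (sub_uspace \<U> S)" for s S
    using that \<U>(2) by (auto simp: sub_uspace_def)
  show "unif_continuous X X (\<gamma> s)" if S: "S \<in> \<S>" and s: "s \<in> upoints (sub_uspace \<U> S)" for S s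
  proof -
    have "unif_continuous Y Y (\<beta> s)"
      using \<beta> S s unfolding unif_constraint_def separately_unif_continuous_def by blast
    from unif_continuous_compose[OF unif_continuous_compose[OF j this] r]
    show ?thesis by (rule unif_continuous_cong) (use \<gamma> sM[OF s] in auto)
  qed
  show "unif_continuous (sub_uspace \<U> S) X (\<lambda>s. \<gamma> s x)" if S: "S \<in> \<S>" and x: "x \<in> upoints X" for S x
  proof -
    have "unif_continuous (sub_uspace \<U> S) Y (\<lambda>s. \<beta> s (j x))"
      using \<beta> S unif_continuous_in[OF j x]
      unfolding unif_constraint_def separately_unif_continuous_def by blast
    from unif_continuous_compose[OF this r]
    show ?thesis by (rule unif_continuous_cong) (use \<gamma> x sM in auto)
  qed
  show "unif_continuous (prod_uspace (sub_uspace \<U> J) X) X (\<lambda>(s, x). \<gamma> s x)" if J: "J \<in> \<J>" for J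
  proof -
    have pts: "upoints (prod_uspace (sub_uspace \<U> J) X) = upoints (sub_uspace \<U> J) \<times> upoints X"
      by (simp add: prod_uspace_def)
    have "unif_continuous (prod_uspace (sub_uspace \<U> J) Y) Y (\<lambda>(s, y). \<beta> s y)"
      using \<beta> J unfolding unif_constraint_def by blast
    from unif_continuous_compose[OF unif_continuous_compose[OF
        unif_continuous_prod_right[OF sub_uspace_entourage_subset[OF \<U>(1)] j X] this] r]
    show ?thesis by (rule unif_continuous_cong) (unfold pts, use \<gamma> sM in auto)
  qed
qed

section \<open>Inheritance of boundedness and quasi-boundedness\<close>

lemma neighborhood_Int: "\<lbrakk>neighborhood T x N; neighborhood T x N'\<rbrakk> \<Longrightarrow> neighborhood T x (N \<inter> N')"
  unfolding neighborhood_def by (metis Int_iff Int_mono le_infI1 openin_Int)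

lemma neighborhood_topspace: "x \<in> topspace T \<Longrightarrow> neighborhood T x (topspace T)"
  unfolding neighborhood_def by blast

text \<open>An entourage of the initial uniformity involves finitely many coordinates, so finitely
  many neighbourhoods of the unit have to be intersected however large I is. In the induction this
  is the case \<open>Int\<close>.\<close>

lemma bounded_flow_ini:
  assumes T: "topspace T = carrier M" "\<one>\<^bsub>M\<^esub> \<in> carrier M"
    and \<beta>: "\<And>i. i \<in> I \<Longrightarrow> bounded_flow M T (Y i) (\<beta> i)"
    and h: "h \<in> A \<rightarrow> (\<Pi>\<^sub>E i\<in>I. upoints (Y i))"
    and \<gamma>: "\<And>s u. \<lbrakk>s \<in> carrier M; u \<in> A\<rbrakk> \<Longrightarrow> \<gamma> s u \<in> A"
      "\<And>s u i. \<lbrakk>s \<in> carrier M; u \<in> A; i \<in> I\<rbrakk> \<Longrightarrow> h (\<gamma> s u) i = \<beta> i s (h u i)"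
  shows "bounded_flow M T (unif_ini I Y A h) \<gamma>"
  unfolding bounded_flow_def upoints_unif_ini
proof
  fix E assume "E \<in> entourages (unif_ini I Y A h)"
  then show "\<exists>N. neighborhood T \<one>\<^bsub>M\<^esub> N \<and> (\<forall>s\<in>N. \<forall>u\<in>A. (\<gamma> s u, u) \<in> E)"
  proof (induction rule: unif_ini_induct)
    case UNIV
    show ?case
      using T \<gamma>(1) neighborhood_topspace[of "\<one>\<^bsub>M\<^esub>" T] by auto
  next
    case (subbasic i V)
    obtain N where N: "neighborhood T \<one>\<^bsub>M\<^esub> N" "\<And>s x. \<lbrakk>s \<in> N; x \<in> upoints (Y i)\<rbrakk> \<Longrightarrow> (\<beta> i s x, x) \<in> V"
      using \<beta>[OF subbasic(1)] subbasic(2) unfolding bounded_flow_def by blast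
    have "N \<subseteq> carrier M"
      using N(1) T by (simp add: neighborhood_def)
    moreover have "h u i \<in> upoints (Y i)" if "u \<in> A" for u
      using h that subbasic(1) by (auto simp: PiE_def Pi_def)
    ultimately show ?case
      using N \<gamma> subbasic(1) by (intro exI[of _ N]) (auto simp: subset_iff)
  next
    case (Int E E')
    then obtain N N' where "neighborhood T \<one>\<^bsub>M\<^esub> N" "\<forall>s\<in>N. \<forall>u\<in>A. (\<gamma> s u, u) \<in> E"
      "neighborhood T \<one>\<^bsub>M\<^esub> N'" "\<forall>s\<in>N'. \<forall>u\<in>A. (\<gamma> s u, u) \<in> E'"
      by blast
    then show ?case
      by (intro exI[of _ "N \<inter> N'"]) (simp add: neighborhood_Int)
  next
    case (mono E E')
    then show ?case by blast
  qed
qed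

text \<open>Boundedness compares the moved point with the point itself. As
  \<open>r (j x) = x\<close>, the pair in question is the image under r of the pair formed by
  \<open>\<beta> s (j x)\<close> and \<open>j x\<close>.\<close>

lemma bounded_flow_retract:
  assumes T: "topspace T = carrier M" and \<beta>: "bounded_flow M T Y \<beta>"
    and j: "unif_continuous X Y j" and r: "unif_continuous Y X r"
    and \<gamma>: "\<And>s x. \<lbrakk>s \<in> carrier M; x \<in> upoints X\<rbrakk> \<Longrightarrow> \<gamma> s x = r (\<beta> s (j x))"
    and rj: "\<And>x. x \<in> upoints X \<Longrightarrow> r (j x) = x"
  shows "bounded_flow M T X \<gamma>"
  unfolding bounded_flow_def
proof
  fix V assume "V \<in> entourages X"
  then obtain N where N: "neighborhood T \<one>\<^bsub>M\<^esub> N"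
    "\<forall>s\<in>N. \<forall>y\<in>upoints Y. (\<beta> s y, y) \<in> {(y, y') \<in> upoints Y \<times> upoints Y. (r y, r y') \<in> V}"
    using \<beta> unif_continuous_entourage[OF r, of V] unfolding bounded_flow_def by meson
  have "(\<gamma> s x, x) \<in> V" if s: "s \<in> N" and x: "x \<in> upoints X" for s x
  proof -
    have "s \<in> carrier M"
      using N(1) s T by (auto simp: neighborhood_def)
    then show ?thesis
      using N(2) s unif_continuous_in[OF j x] x rj[OF x] \<gamma> by force
  qed
  then show "\<exists>N. neighborhood T \<one>\<^bsub>M\<^esub> N \<and> (\<forall>s\<in>N. \<forall>x\<in>upoints X. (\<gamma> s x, x) \<in> V)"
    using N(1) by blast
qed

lemma quasi_bounded_flowE:
  assumes "quasi_bounded_flow M T X \<alpha>" "W \<in> entourages X"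
  obtains N V where "neighborhood T \<one>\<^bsub>M\<^esub> N" "V \<in> entourages X"
    "\<And>s x y. \<lbrakk>s \<in> N; (x, y) \<in> V\<rbrakk> \<Longrightarrow> (\<alpha> s x, \<alpha> s y) \<in> W"
proof -
  have "\<exists>N. neighborhood T \<one>\<^bsub>M\<^esub> N \<and> (\<exists>V\<in>entourages X. \<forall>s\<in>N. \<forall>(x, y)\<in>V. (\<alpha> s x, \<alpha> s y) \<in> W)"
    using assms unfolding quasi_bounded_flow_def by (rule bspec)
  then show thesis
    by (elim exE conjE bexE) (rule that, auto)
qed

text \<open>As for boundedness, but the entourage on the source varies too: for a subbasic entourage
  it is pulled back from the same coordinate, and for intersections both the neighbourhoods and
  these entourages are intersected.\<close>

lemma quasi_bounded_flow_ini:
  assumes T: "topspace T = carrier M" "\<one>\<^bsub>M\<^esub> \<in> carrier M"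
    and \<beta>: "\<And>i. i \<in> I \<Longrightarrow> quasi_bounded_flow M T (Y i) (\<beta> i)"
    and \<gamma>: "\<And>s u. \<lbrakk>s \<in> carrier M; u \<in> A\<rbrakk> \<Longrightarrow> \<gamma> s u \<in> A"
      "\<And>s u i. \<lbrakk>s \<in> carrier M; u \<in> A; i \<in> I\<rbrakk> \<Longrightarrow> h (\<gamma> s u) i = \<beta> i s (h u i)"
  shows "quasi_bounded_flow M T (unif_ini I Y A h) \<gamma>"
  unfolding quasi_bounded_flow_def
proof
  fix E assume "E \<in> entourages (unif_ini I Y A h)"
  then show "\<exists>N. neighborhood T \<one>\<^bsub>M\<^esub> N \<and>
      (\<exists>V\<in>entourages (unif_ini I Y A h). \<forall>s\<in>N. \<forall>(x, y)\<in>V. (\<gamma> s x, \<gamma> s y) \<in> E)"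
  proof (induction rule: unif_ini_induct)
    case UNIV
    show ?case
      using T \<gamma>(1) neighborhood_topspace[of "\<one>\<^bsub>M\<^esub>" T]
      by (intro exI[of _ "topspace T"] conjI bexI[OF _ unif_ini_UNIV]) auto
  next
    case (subbasic i W)
    obtain N V where N: "neighborhood T \<one>\<^bsub>M\<^esub> N" and V: "V \<in> entourages (Y i)"
      and NV: "\<And>s x y. \<lbrakk>s \<in> N; (x, y) \<in> V\<rbrakk> \<Longrightarrow> (\<beta> i s x, \<beta> i s y) \<in> W"
      using \<beta>[OF subbasic(1)] subbasic(2) by (rule quasi_bounded_flowE) blast
    have "N \<subseteq> carrier M"
      using N T by (simp add: neighborhood_def)
    then show ?case
      using N NV \<gamma> subbasic(1)
      by (intro exI[of _ N] conjI bexI[OF _ subbasic_entourage[of i I V Y A h, OF subbasic(1) V]])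
        (auto simp: subset_iff)
  next
    case (Int E E')
    then obtain N N' V V' where N: "neighborhood T \<one>\<^bsub>M\<^esub> N" "neighborhood T \<one>\<^bsub>M\<^esub> N'"
      and V: "V \<in> entourages (unif_ini I Y A h)" "V' \<in> entourages (unif_ini I Y A h)"
      and "\<forall>s\<in>N. \<forall>(x, y)\<in>V. (\<gamma> s x, \<gamma> s y) \<in> E" "\<forall>s\<in>N'. \<forall>(x, y)\<in>V'. (\<gamma> s x, \<gamma> s y) \<in> E'"
      by (elim exE conjE bexE)
    then show ?case
      by (intro exI[of _ "N \<inter> N'"] conjI neighborhood_Int bexI[OF _ unif_ini_Int[OF V]]) auto
  next
    case (mono E E')
    then obtain N V where "neighborhood T \<one>\<^bsub>M\<^esub> N" "V \<in> entourages (unif_ini I Y A h)"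
      "\<forall>s\<in>N. \<forall>(x, y)\<in>V. (\<gamma> s x, \<gamma> s y) \<in> E"
      by (elim exE conjE bexE)
    with mono(2) show ?case
      by (intro exI[of _ N] conjI bexI[of _ V]) fastforce+
  qed
qed

lemma quasi_bounded_flow_retract:
  assumes T: "topspace T = carrier M" and X: "uniform_structure X" and \<beta>: "quasi_bounded_flow M T Y \<beta>"
    and j: "unif_continuous X Y j" and r: "unif_continuous Y X r"
    and \<gamma>: "\<And>s x. \<lbrakk>s \<in> carrier M; x \<in> upoints X\<rbrakk> \<Longrightarrow> \<gamma> s x = r (\<beta> s (j x))"
  shows "quasi_bounded_flow M T X \<gamma>"
  unfolding quasi_bounded_flow_def
proof
  fix W assume W: "W \<in> entourages X"
  \<comment> \<open>Quasi-boundedness of Y is used for the pullback of W along r; the resulting V is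
    then pulled back along j to an entourage of X.\<close>
  obtain N V where N: "neighborhood T \<one>\<^bsub>M\<^esub> N" and V: "V \<in> entourages Y"
    and NV: "\<And>s x y. \<lbrakk>s \<in> N; (x, y) \<in> V\<rbrakk> \<Longrightarrow>
      (\<beta> s x, \<beta> s y) \<in> {(y, y') \<in> upoints Y \<times> upoints Y. (r y, r y') \<in> W}"
    using \<beta> unif_continuous_entourage[OF r W] by (rule quasi_bounded_flowE) blast
  have "N \<subseteq> carrier M"
    using N T by (simp add: neighborhood_def)
  then have "\<forall>s\<in>N. \<forall>(x, y)\<in>{(x, x') \<in> upoints X \<times> upoints X. (j x, j x') \<in> V}. (\<gamma> s x, \<gamma> s y) \<in> W"
    using NV \<gamma> by fastforce
  then show "\<exists>N. neighborhood T \<one>\<^bsub>M\<^esub> N \<and> (\<exists>V\<in>entourages X. \<forall>s\<in>N. \<forall>(x, y)\<in>V. (\<gamma> s x, \<gamma> s y) \<in> W)"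
    using N unif_continuous_entourage[OF j V] by blast
qed

lemma initial_flows_unif_constraint:
  assumes "Group.monoid M" and \<U>: "uniform_structure \<U>" "upoints \<U> = carrier M"
  shows "initial_flows upoints unif_continuous (\<lambda>X. uniform_structure X \<and> P X) M (unif_constraint \<U> \<S> \<J>) unif_ini"
  apply (rule initial_flows_Unif[OF assms(1)])
  subgoal premises p for I Y A h \<beta> \<gamma>
    by (rule unif_constraint_ini[OF \<U>(1) equalityD1[OF \<U>(2)], where h = h and A = A and \<beta> = \<beta> and \<gamma> = \<gamma>])
      (fact p)+
  subgoal premises p for X Y \<beta> j r \<gamma>
    by (rule unif_constraint_retract[OF \<U>(1) equalityD1[OF \<U>(2)],
          where Y = Y and \<beta> = \<beta> and j = j and r = r and \<gamma> = \<gamma>]) (fact p)+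
  done

context
  fixes M :: "('m, 'r) monoid_scheme" and T :: "'m topology"
  assumes T: "topological_group M T"
begin

lemma topological_groupD: "Group.monoid M" "topspace T = carrier M" "\<one>\<^bsub>M\<^esub> \<in> carrier M"
  using T by (auto simp: topological_group_def topological_monoid_def monoid.one_closed)

lemma initial_flows_bounded:
  "initial_flows upoints unif_continuous (\<lambda>X. uniform_structure X \<and> P X) M (bounded_flow M T) unif_ini"
  apply (rule initial_flows_Unif[OF topological_groupD(1)])
  subgoal premises p for I Y A h \<beta> \<gamma>
    by (rule bounded_flow_ini[OF topological_groupD(2,3), where h = h and A = A and \<beta> = \<beta> and \<gamma> = \<gamma>])
      (fact p)+
  subgoal premises p for X Y \<beta> j r \<gamma>
    by (rule bounded_flow_retract[OF topological_groupD(2),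
          where Y = Y and \<beta> = \<beta> and j = j and r = r and \<gamma> = \<gamma>]) (fact p)+
  done

lemma initial_flows_quasi_bounded:
  "initial_flows upoints unif_continuous (\<lambda>X. uniform_structure X \<and> P X) M (quasi_bounded_flow M T) unif_ini"
  apply (rule initial_flows_Unif[OF topological_groupD(1)])
  subgoal premises p for I Y A h \<beta> \<gamma>
    by (rule quasi_bounded_flow_ini[OF topological_groupD(2,3), where h = h and A = A and \<beta> = \<beta> and \<gamma> = \<gamma>])
      (fact p)+
  subgoal premises p for X Y \<beta> j r \<gamma>
    by (rule quasi_bounded_flow_retract[OF topological_groupD(2),
          where Y = Y and \<beta> = \<beta> and j = j and r = r and \<gamma> = \<gamma>]) (fact p)+
  done

end

theorem theorem2p10:
  fixes M :: "('m, 'r) monoid_scheme" and \<S> \<J> :: "'m set set"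
  assumes "strong_limit TYPE('u)"
    and "Group.monoid M" and "carrier M \<prec> (UNIV :: 'u set)"
    and "\<S> \<subseteq> Pow (carrier M)" and "\<J> \<subseteq> Pow (carrier M)"
  shows
    "(\<forall>T. topological_monoid M T \<longrightarrow>
       (\<forall>P \<in> {\<lambda>_. True, t0_space, t1_space, Hausdorff_space, functionally_Hausdorff_space,
               Tychonoff_space, \<lambda>X. compact_space X \<and> Hausdorff_space X}.
          monadic (flow_category (Top (P :: 'u topology \<Rightarrow> bool)) M (top_constraint T \<S> \<J>))
            (Top P) forgetful)) \<and>
     (\<forall>\<U>. uniform_structure \<U> \<and> upoints \<U> = carrier M \<longrightarrow>
       (\<forall>P \<in> {\<lambda>_. True, Hausdorff_uspace, \<lambda>X. Hausdorff_uspace X \<and> complete_uspace X}.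
          monadic (flow_category (Unif (P :: 'u uspace \<Rightarrow> bool)) M (unif_constraint \<U> \<S> \<J>))
            (Unif P) forgetful)) \<and>
     (\<forall>T. kappa_monoid M T \<longrightarrow>
       (\<forall>P \<in> {k_space, \<lambda>X. k_space X \<and> Hausdorff_space X}.
          monadic (flow_category (Top (P :: 'u topology \<Rightarrow> bool)) M (kappa_constraint T \<S> \<J>))
            (Top P) forgetful)) \<and>
     (\<forall>T. topological_group M T \<longrightarrow>
       (\<forall>P \<in> {\<lambda>_. True, Hausdorff_uspace, \<lambda>X. Hausdorff_uspace X \<and> complete_uspace X}.
        \<forall>F \<in> {bounded_flow M T, quasi_bounded_flow M T}.
          monadic (flow_category (Unif (P :: 'u uspace \<Rightarrow> bool)) M F) (Unif P) forgetful))"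
proof (intro conjI allI impI ballI)
  note size = assms(1,3)
  fix T
  show "monadic (flow_category (Top P) M (top_constraint T \<S> \<J>)) (Top P) forgetful"
    if T: "topological_monoid M T"
      and P: "P \<in> {\<lambda>_. True, t0_space, t1_space, Hausdorff_space, functionally_Hausdorff_space,
        Tychonoff_space, \<lambda>X. compact_space X \<and> Hausdorff_space X}" for P :: "'u topology \<Rightarrow> bool"
  \<comment> \<open>Compactness need not hold for the space of orbits, so this category goes through
    the closure; the other six properties pass to subspaces of products.\<close>
  proof (cases "P = (\<lambda>X. compact_space X \<and> Hausdorff_space X)")
    case True
    then show ?thesis
      using monadic_Top_compact_Hausdorff[OF size T] by simp
  next
    case False
    then show ?thesis
      using P by (intro monadic_Top_hereditary[OF size T]) blast
  qed
  show "monadic (flow_category (Top P) M (kappa_constraint T \<S> \<J>)) (Top P) forgetful"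
    if "kappa_monoid M T" "P \<in> {k_space, \<lambda>X. k_space X \<and> Hausdorff_space X}" for P :: "'u topology \<Rightarrow> bool"
    using that by (rule monadic_kappa[OF size])
  show "monadic (flow_category (Unif P) M F) (Unif P) forgetful"
    if T: "topological_group M T"
      and P: "P \<in> {\<lambda>_. True, Hausdorff_uspace, \<lambda>X. Hausdorff_uspace X \<and> complete_uspace X}"
      and F: "F \<in> {bounded_flow M T, quasi_bounded_flow M T}" for P :: "'u uspace \<Rightarrow> bool" and F
    using F monadic_Unif[OF size initial_flows_bounded[OF T] P]
      monadic_Unif[OF size initial_flows_quasi_bounded[OF T] P] by blast
next
  fix \<U> and P :: "'u uspace \<Rightarrow> bool"
  assume \<U>: "uniform_structure \<U> \<and> upoints \<U> = carrier M"
    and P: "P \<in> {\<lambda>_. True, Hausdorff_uspace, \<lambda>X. Hausdorff_uspace X \<and> complete_uspace X}"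
  show "monadic (flow_category (Unif P) M (unif_constraint \<U> \<S> \<J>)) (Unif P) forgetful"
    using \<U> by (intro monadic_Unif[OF assms(1,3) initial_flows_unif_constraint[OF assms(2)] P]) simp_all
qed

end
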